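(* There is an algorithm which, given a string graph $G$ together with a representation of $G$, outputs a vertex cover of $G$ of size at most $\frac{11}{6}\cdot \mathsf{vc}(G)$, and whose running time is polynomial in the size of the given representation.
   Context: A graph $G$ is a string graph if it is the intersection graph of a family of connected vertex subsets of some planar graph. A representation of $G$ consists of a planar graph $P$ and a family $\mathcal S$ of non-empty connected vertex subsets of $P$, in one-to-one correspondence with $V(G)$, such that two distinct vertices of $G$ are adjacent if and only if their corresponding subsets intersect; its size is measured by $|V(P)|$ (together with the sets). A vertex cover of $G$ is a set $S\subseteq V(G)$ such that $G-S$ has no edges; $\mathsf{vc}(G)$ denotes the minimum size of a vertex cover of $G$. *)

theory Defs
  imports
    "HOL-Analysis.Analysis"
    "HOL-Computational_Algebra.Polynomial"
    "Graph_Theory.Graph_Theory"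
begin

section \<open>Planar graphs and string graphs\<close>

text \<open>
  A finite simple undirected graph is a \<^locale>\<open>pair_graph\<close>: a finite, loop-free digraph whose
  arc relation is symmetric.
\<close>

definition edges :: "'a pair_pre_digraph \<Rightarrow> 'a set set" where
  "edges G = {{u, v} | u v. (u, v) \<in> parcs G}"

definition plane_drawing ::
  "'a pair_pre_digraph \<Rightarrow> ('a \<Rightarrow> complex) \<Rightarrow> ('a set \<Rightarrow> real \<Rightarrow> complex) \<Rightarrow> bool" where
  "plane_drawing P \<phi> \<gamma> \<longleftrightarrow>
     inj_on \<phi> (pverts P) \<and>
     (\<forall>e \<in> edges P. arc (\<gamma> e) \<and>
        {pathstart (\<gamma> e), pathfinish (\<gamma> e)} = \<phi> ` e \<and>
        path_image (\<gamma> e) \<inter> \<phi> ` pverts P = \<phi> ` e) \<and>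
     (\<forall>e \<in> edges P. \<forall>f \<in> edges P. e \<noteq> f \<longrightarrow>
        path_image (\<gamma> e) \<inter> path_image (\<gamma> f) \<subseteq> \<phi> ` (e \<inter> f))"

definition planar_graph :: "'a pair_pre_digraph \<Rightarrow> bool" where
  "planar_graph P \<longleftrightarrow> pair_graph P \<and> (\<exists>\<phi> \<gamma>. plane_drawing P \<phi> \<gamma>)"

text \<open>
  The family of vertex subsets is indexed by the vertices of \<open>G\<close>; different vertices may have
  the same subset (they are then adjacent).
\<close>

definition string_representation ::
  "'a pair_pre_digraph \<Rightarrow> 'b pair_pre_digraph \<Rightarrow> ('a \<Rightarrow> 'b set) \<Rightarrow> bool" where
  "string_representation G P S \<longleftrightarrow>
     pair_graph G \<and> planar_graph P \<and>
     (\<forall>v \<in> pverts G. S v \<noteq> {} \<and> S v \<subseteq> pverts P \<and>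
        Digraph_Component.connected (with_proj P \<restriction> S v)) \<and>
     (\<forall>u \<in> pverts G. \<forall>v \<in> pverts G. u \<noteq> v \<longrightarrow>
        ((u, v) \<in> parcs G \<longleftrightarrow> S u \<inter> S v \<noteq> {}))"

text \<open>The vertices of a finite graph \<open>P\<close> may be assumed to be natural numbers.\<close>

definition string_graph :: "'a pair_pre_digraph \<Rightarrow> bool" where
  "string_graph G \<longleftrightarrow>
     (\<exists>(P :: nat pair_pre_digraph) S. string_representation G P S)"

definition representation_size ::
  "'a pair_pre_digraph \<Rightarrow> 'b pair_pre_digraph \<Rightarrow> ('a \<Rightarrow> 'b set) \<Rightarrow> nat" where
  "representation_size G P S = card (pverts P) + (\<Sum>v \<in> pverts G. card (S v))"


section \<open>Vertex covers\<close>

definition vertex_cover :: "'a pair_pre_digraph \<Rightarrow> 'a set \<Rightarrow> bool" where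
  "vertex_cover G C \<longleftrightarrow>
     C \<subseteq> pverts G \<and> arcs (with_proj G \<restriction> (pverts G - C)) = {}"

definition vc :: "'a pair_pre_digraph \<Rightarrow> nat" where
  "vc G = (LEAST k. \<exists>C. vertex_cover G C \<and> card C = k)"


section \<open>Model of computation\<close>

text \<open>
  Algorithms are programs of a random access machine with structured control flow. The memory
  consists of named arrays of natural numbers (a program mentions only finitely many names), an
  array cell is addressed by a computed index, and every assignment and every test takes one time
  unit; the size of the expressions involved is bounded by a constant depending only on the
  program. The only arithmetic operations are addition and (truncated) subtraction. As there is
  no multiplication, in \<open>t\<close> steps numbers grow by at most \<open>O(t)\<close> bits, and so polynomial time in
  this model is polynomial time on Turing machines.
\<close>

type_synonym store = "string \<Rightarrow> nat \<Rightarrow> nat"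

datatype aexp =
    Const nat
  | Read string aexp
  | Add aexp aexp
  | Sub aexp aexp

primrec aval :: "aexp \<Rightarrow> store \<Rightarrow> nat" where
  "aval (Const k) s = k"
| "aval (Read x a) s = s x (aval a s)"
| "aval (Add a b) s = aval a s + aval b s"
| "aval (Sub a b) s = aval a s - aval b s"

datatype bexp =
    Less aexp aexp
  | Neg bexp
  | Conj bexp bexp

primrec bval :: "bexp \<Rightarrow> store \<Rightarrow> bool" where
  "bval (Less a b) s = (aval a s < aval b s)"
| "bval (Neg b) s = (\<not> bval b s)"
| "bval (Conj b c) s = (bval b s \<and> bval c s)"

datatype com =
    Skip
  | Write string aexp aexp
  | Seq com com
  | Cond bexp com com
  | While bexp com

text \<open>\<open>exec c s t s'\<close>: program \<open>c\<close> started in \<open>s\<close> halts in \<open>s'\<close> after exactly \<open>t\<close> time units.\<close>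

inductive exec :: "com \<Rightarrow> store \<Rightarrow> nat \<Rightarrow> store \<Rightarrow> bool" where
  Skip: "exec Skip s 1 s"
| Write: "exec (Write x a b) s 1 (s(x := (s x)(aval a s := aval b s)))"
| Seq: "exec c s t s' \<Longrightarrow> exec d s' t' s'' \<Longrightarrow> exec (Seq c d) s (t + t') s''"
| CondTrue: "bval b s \<Longrightarrow> exec c s t s' \<Longrightarrow> exec (Cond b c d) s (1 + t) s'"
| CondFalse: "\<not> bval b s \<Longrightarrow> exec d s t s' \<Longrightarrow> exec (Cond b c d) s (1 + t) s'"
| WhileFalse: "\<not> bval b s \<Longrightarrow> exec (While b c) s 1 s"
| WhileTrue: "bval b s \<Longrightarrow> exec c s t s' \<Longrightarrow> exec (While b c) s' t' s'' \<Longrightarrow>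
    exec (While b c) s (1 + t + t') s''"

inductive_cases exec_SkipE: "exec Skip s t s'"
inductive_cases exec_WriteE: "exec (Write x a b) s t s'"
inductive_cases exec_SeqE: "exec (Seq c d) s t s'"
inductive_cases exec_CondE: "exec (Cond b c d) s t s'"
inductive_cases exec_WhileE: "exec (While b c) s t s'"

lemma exec_deterministic:
  "exec c s t s' \<Longrightarrow> exec c s u s'' \<Longrightarrow> t = u \<and> s' = s''"
proof (induction arbitrary: u s'' rule: exec.induct)
  case (Skip s)
  from Skip.prems show ?case by (rule exec_SkipE) simp
next
  case (Write x a b s)
  from Write.prems show ?case by (rule exec_WriteE) simp
next
  case (Seq c s t s' d t' s3)
  from Seq.prems show ?case
  proof (rule exec_SeqE)
    fix t1 s1 t2 assume u: "u = t1 + t2" and 1: "exec c s t1 s1" and 2: "exec d s1 t2 s''"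
    from Seq.IH(1)[OF 1] Seq.IH(2) 2 u show ?thesis by auto
  qed
next
  case (CondTrue b s c t s' d)
  from CondTrue.prems show ?case
  proof (rule exec_CondE)
    fix t1 assume u: "u = Suc t1" and 1: "exec c s t1 s''"
    from CondTrue.IH[OF 1] u show ?thesis by simp
  qed (simp add: CondTrue.hyps)
next
  case (CondFalse b s d t s' c)
  from CondFalse.prems show ?case
  proof (rule exec_CondE)
    fix t1 assume u: "u = Suc t1" and 1: "exec d s t1 s''"
    from CondFalse.IH[OF 1] u show ?thesis by simp
  qed (simp add: CondFalse.hyps)
next
  case (WhileFalse b s c)
  from WhileFalse.prems show ?case
    by (rule exec_WhileE) (simp_all add: WhileFalse.hyps)
next
  case (WhileTrue b s c t s' t' s3)
  from WhileTrue.prems show ?case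
  proof (rule exec_WhileE)
    fix t1 s1 t2 assume u: "u = Suc (t1 + t2)" and 1: "exec c s t1 s1"
      and 2: "exec (While b c) s1 t2 s''"
    from WhileTrue.IH(1)[OF 1] WhileTrue.IH(2) 2 u show ?thesis by auto
  qed (simp add: WhileTrue.hyps)
qed


section \<open>Input and output\<close>

text \<open>
  The vertices of an input graph are numbered from zero. Both graphs are given by their
  adjacency matrices and the family of sets by its incidence matrix, stored row by row.
  All cells not holding input are zero.
\<close>

definition numbered :: "nat pair_pre_digraph \<Rightarrow> bool" where
  "numbered G \<longleftrightarrow> pverts G = {..<card (pverts G)}"

definition input_store ::
  "nat pair_pre_digraph \<Rightarrow> nat pair_pre_digraph \<Rightarrow> (nat \<Rightarrow> nat set) \<Rightarrow> store" where
  "input_store G P S =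
     (let n = card (pverts G); m = card (pverts P) in
      (\<lambda>_ _. 0)
        (''n'' := (\<lambda>_. 0)(0 := n),
         ''m'' := (\<lambda>_. 0)(0 := m),
         ''G'' := (\<lambda>i. of_bool (i < n * n \<and> (i div n, i mod n) \<in> parcs G)),
         ''P'' := (\<lambda>i. of_bool (i < m * m \<and> (i div m, i mod m) \<in> parcs P)),
         ''S'' := (\<lambda>i. of_bool (i < n * m \<and> i mod m \<in> S (i div m)))))"

definition output_set :: "nat pair_pre_digraph \<Rightarrow> store \<Rightarrow> nat set" where
  "output_set G s = {v \<in> pverts G. s ''C'' v \<noteq> 0}"

end

(*
  An odd cycle of length l needs (l + 1) / 2 vertices in every vertex cover, so taking all vertices
  of disjoint odd cycles of length at most 11 costs at most 11/6 times the optimum. Next, a crown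
  reduction in the style of Nemhauser and Trotter leaves a set A such that every vertex cover
  contains at least half of A. It remains to find an independent set of size at least |A|/8 in the
  string graph of A, which has no odd cycle shorter than 13: then 7/8 |A| is at most 7/4 times the
  optimum within A.

  To this end, give the strings their breadth-first levels L and keep the larger parity class of
  levels. In the subgraph of the representation formed by these strings and by those parts of the
  others that are not covered from the level above, compute breadth-first levels M and again keep
  the larger parity class. The strings that survive and have the same L and M induce a bipartite graph:
  by the two breadth-first trees, each such string lies on a connected "wall" that leads from a
  connected inner region to a disjoint connected region near the root of M and reaches no further
  than two steps from the string. As these two regions are adjacent to each other, planarity
  orders disjoint walls from left to right, while two strings whose walls meet are joined by a short
  walk. Along an odd closed walk these data would label the pairs of positions in a way that contradicts
  a parity version of Sperner's lemma. A third parity choice picks one colour class.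
*)
theory Submission
  imports Defs
begin

text \<open>The bound 11 comes from the walls. A wall reaches two steps from its string, so two
  walls that meet join their strings by a walk of length at most 2 + 1 + 2 = 5. Moving both ends of
  such a walk by one step and comparing it with another one gives a closed walk of length at most 5
  + 1 + 5 + 1 = 12, whose parity is fixed once no odd closed walk is shorter than 13. The ratio pays
  for this: the independent set alone would cost only 7/4. One layering provides only one connected
  region, the inner one. A second region, connected, disjoint from the first, next to it and away
  from the strings considered, is made of the low levels of a second layering, whose nodes are
  thinned out so as to avoid the inner region. Thinning may split a string into pieces with
  different levels; this is why levels belong to pairs of a string and a point. Unordered pairs of
  positions on a closed walk form a Moebius band. Crossing its seam exchanges left and right and, as
  the walk is odd, also the two parities, so the labels are antipodal there, as in Tucker's
  lemma.\<close>

section \<open>Walls in plane graphs\<close>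

definition linked :: "('a \<times> 'a) set \<Rightarrow> 'a set \<Rightarrow> bool" where
  "linked E A \<longleftrightarrow> (\<forall>p\<in>A. \<forall>q\<in>A. (p, q) \<in> (E \<inter> A \<times> A)\<^sup>*)"

lemma linkedI_root:
  assumes "sym E" "\<And>q. q \<in> A \<Longrightarrow> (q, r) \<in> (E \<inter> A \<times> A)\<^sup>*"
  shows "linked E A"
proof -
  have "sym ((E \<inter> A \<times> A)\<^sup>*)"
    using assms(1) by (intro sym_rtrancl) (auto simp: sym_def)
  then show ?thesis
    unfolding linked_def using assms(2) by (meson rtrancl_trans symD)
qed

lemma linked_Un:
  assumes "linked E A" "linked E B" "A \<inter> B \<noteq> {}"
  shows "linked E (A \<union> B)"
proof -
  have A: "(p, q) \<in> (E \<inter> (A \<union> B) \<times> (A \<union> B))\<^sup>*" if "p \<in> A" "q \<in> A" for p q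
    using assms(1) that rtrancl_mono[of "E \<inter> A \<times> A" "E \<inter> (A \<union> B) \<times> (A \<union> B)"]
    unfolding linked_def by blast
  have B: "(p, q) \<in> (E \<inter> (A \<union> B) \<times> (A \<union> B))\<^sup>*" if "p \<in> B" "q \<in> B" for p q
    using assms(2) that rtrancl_mono[of "E \<inter> B \<times> B" "E \<inter> (A \<union> B) \<times> (A \<union> B)"]
    unfolding linked_def by blast
  obtain r where "r \<in> A" "r \<in> B"
    using assms(3) by blast
  then have "(p, r) \<in> (E \<inter> (A \<union> B) \<times> (A \<union> B))\<^sup>* \<and> (r, p) \<in> (E \<inter> (A \<union> B) \<times> (A \<union> B))\<^sup>*"
    if "p \<in> A \<union> B" for p
    using A[of p r] A[of r p] B[of p r] B[of r p] that by blast
  then show ?thesis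
    unfolding linked_def by (blast intro: rtrancl_trans)
qed

lemma linked_exit:
  assumes "linked E A" "p \<in> A" "p \<in> B" "q \<in> A" "q \<notin> B"
  obtains u v where "(u, v) \<in> E" "u \<in> A" "v \<in> A" "u \<in> B" "v \<notin> B"
proof -
  have "(p, q) \<in> (E \<inter> A \<times> A)\<^sup>*"
    using assms unfolding linked_def by blast
  then have "p \<in> B \<longrightarrow> q \<notin> B \<longrightarrow> (\<exists>u v. (u, v) \<in> E \<and> u \<in> A \<and> v \<in> A \<and> u \<in> B \<and> v \<notin> B)"
    by (induction rule: rtrancl_induct) blast+
  then show thesis
    using assms that by blast
qed

primrec climb :: "('a \<Rightarrow> 'a) \<Rightarrow> nat \<Rightarrow> 'a \<Rightarrow> 'a list" where
  "climb f 0 q = [q]"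
| "climb f (Suc n) q = q # climb f n (f q)"

lemma climb_not_Nil [simp]: "climb f n q \<noteq> []"
  by (cases n) auto

lemma hd_climb [simp]: "hd (climb f n q) = q"
  by (cases n) auto

text \<open>Parent pointers of a breadth-first tree rooted at \<open>r\<close>. The tail of a path
  is again the path chosen for its first vertex, so two paths stay together once they meet;
  \<open>merge_lists\<close> rests on this.\<close>

lemma tree_paths:
  assumes "linked E A" "r \<in> A"
  obtains \<pi> where
    "\<And>q. q \<in> A \<Longrightarrow> successively (\<lambda>u v. (u, v) \<in> E) (\<pi> q) \<and> distinct (\<pi> q) \<and> set (\<pi> q) \<subseteq> A
        \<and> \<pi> q \<noteq> [] \<and> hd (\<pi> q) = q \<and> last (\<pi> q) = r"
    "\<And>q xs y ys. q \<in> A \<Longrightarrow> \<pi> q = xs @ y # ys \<Longrightarrow> \<pi> y = y # ys"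
proof -
  let ?R = "E \<inter> A \<times> A"
  define d where "d q = (LEAST n. (q, r) \<in> ?R ^^ n)" for q
  have d: "(q, r) \<in> ?R ^^ d q" if "q \<in> A" for q
  proof -
    have "(q, r) \<in> ?R\<^sup>*"
      using assms that unfolding linked_def by blast
    then have "\<exists>n. (q, r) \<in> ?R ^^ n"
      by (simp add: rtrancl_power)
    then show ?thesis
      unfolding d_def by (rule LeastI_ex)
  qed
  have "\<exists>q'. (q, q') \<in> ?R \<and> d q' = n" if "q \<in> A" "d q = Suc n" for q n
  proof -
    have "(q, r) \<in> ?R ^^ Suc n"
      using d[OF that(1)] that(2) by simp
    then obtain q' where q': "(q, q') \<in> ?R" "(q', r) \<in> ?R ^^ n"
      by (meson relpow_Suc_D2)
    then have "d q' \<le> n"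
      unfolding d_def by (simp add: Least_le)
    moreover have "(q, r) \<in> ?R ^^ Suc (d q')"
      using relpow_Suc_I2[OF q'(1) d] q'(1) by blast
    then have "d q \<le> Suc (d q')"
      unfolding d_def[of q] by (simp add: Least_le)
    ultimately show ?thesis
      using q'(1) that by (intro exI[of _ q']) auto
  qed
  then have step: "\<exists>q'. (q, q') \<in> ?R \<and> d q' = d q - 1" if "q \<in> A" "d q > 0" for q
    using that by (metis Suc_pred' diff_Suc_1)
  define f where "f q = (SOME q'. (q, q') \<in> ?R \<and> d q' = d q - 1)" for q
  have f: "(q, f q) \<in> ?R \<and> d (f q) = n" if "q \<in> A" "d q = Suc n" for q n
    using someI_ex[OF step[of q]] that unfolding f_def by simp
  have below: "\<forall>y\<in>set (climb f n q). y \<in> A \<and> d y \<le> n" if "q \<in> A" "d q = n" for n q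
    using that
  proof (induction n arbitrary: q)
    case (Suc n)
    then show ?case
      using f[of q n] by fastforce
  qed simp
  have "successively (\<lambda>u v. (u, v) \<in> E) (climb f n q) \<and> distinct (climb f n q) \<and>
      last (climb f n q) = r" if "q \<in> A" "d q = n" for n q
    using that
  proof (induction n arbitrary: q)
    case 0
    then show ?case
      using d[of q] by simp
  next
    case (Suc n)
    then have f': "(q, f q) \<in> ?R" "d (f q) = n"
      using f[of q n] by auto
    then have "q \<notin> set (climb f n (f q))"
      using below[of "f q" n] Suc.prems by fastforce
    then show ?case
      using Suc f' by (auto simp: successively_Cons)
  qed
  then have 1: "successively (\<lambda>u v. (u, v) \<in> E) (climb f (d q) q) \<and> distinct (climb f (d q) q)
      \<and> set (climb f (d q) q) \<subseteq> A \<and> climb f (d q) q \<noteq> [] \<and> hd (climb f (d q) q) = q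
      \<and> last (climb f (d q) q) = r" if "q \<in> A" for q
    using that below by auto
  have 2: "climb f (d y) y = y # ys" if "q \<in> A" "d q = n" "climb f n q = xs @ y # ys" for n q xs y ys
    using that
  proof (induction n arbitrary: q xs)
    case 0
    then show ?case
      by (cases xs) auto
  next
    case (Suc n)
    then have f': "(q, f q) \<in> ?R" "d (f q) = n"
      using f[of q n] by auto
    show ?case
    proof (cases xs)
      case Nil
      then show ?thesis using Suc.prems by auto
    next
      case (Cons x xs')
      then show ?thesis
        using Suc.IH[of "f q" xs'] Suc.prems f' by auto
    qed
  qed
  show thesis
  proof (rule that[of "\<lambda>q. climb f (d q) q"])
    show "climb f (d y) y = y # ys" if "q \<in> A" "climb f (d q) q = xs @ y # ys" for q xs y ys
      using 2[OF that(1) refl that(2)] .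
  qed (rule 1)
qed

fun trail :: "'a list \<Rightarrow> 'a set set" where
  "trail (p # q # xs) = insert {p, q} (trail (q # xs))"
| "trail _ = {}"

lemma trail_append_Nil:
  "xs \<noteq> [] \<Longrightarrow> ys \<noteq> [] \<Longrightarrow> trail (xs @ ys) = trail xs \<union> insert {last xs, hd ys} (trail ys)"
  by (induction xs rule: trail.induct) (auto simp: neq_Nil_conv)

lemma Union_trail: "length xs \<ge> 2 \<Longrightarrow> \<Union> (trail xs) = set xs"
proof (induction xs rule: trail.induct)
  case (1 p q xs)
  then show ?case
    by (cases xs) auto
qed auto

lemma Union_trail_subset: "\<Union> (trail xs) \<subseteq> set xs"
  by (induction xs rule: trail.induct) auto

section \<open>Paths of a plane drawing as arcs\<close>

locale plane_graph =
  fixes P :: "'a pair_pre_digraph" and \<phi> :: "'a \<Rightarrow> complex" and \<gamma> :: "'a set \<Rightarrow> real \<Rightarrow> complex"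
  assumes pair_graph: "pair_graph P" and drawing: "plane_drawing P \<phi> \<gamma>"
begin

abbreviation adj :: "'a \<Rightarrow> 'a \<Rightarrow> bool" where
  "adj u v \<equiv> (u, v) \<in> parcs P"

abbreviation chain :: "'a list \<Rightarrow> bool" where
  "chain \<equiv> successively adj"

definition img :: "'a set set \<Rightarrow> complex set" where
  "img F = (\<Union>e\<in>F. path_image (\<gamma> e))"

lemma adj_sym: "adj u v \<Longrightarrow> adj v u"
proof -
  interpret pair_graph P by (rule pair_graph)
  show "adj u v \<Longrightarrow> adj v u"
    using arcs_symmetric by auto
qed

lemma sym_adj: "sym (parcs P)"
  using adj_sym by (auto simp: sym_def)

lemma adj_verts: "adj u v \<Longrightarrow> u \<in> pverts P \<and> v \<in> pverts P"
proof -
  interpret pair_graph P by (rule pair_graph)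
  show "adj u v \<Longrightarrow> u \<in> pverts P \<and> v \<in> pverts P"
    using in_arcsD1 in_arcsD2 by blast
qed

lemma adj_neq: "adj u v \<Longrightarrow> u \<noteq> v"
proof -
  interpret pair_graph P by (rule pair_graph)
  show "adj u v \<Longrightarrow> u \<noteq> v"
    using no_loops' by auto
qed

lemma finite_edges: "finite (edges P)"
proof -
  interpret pair_graph P by (rule pair_graph)
  have "edges P = (\<lambda>(u, v). {u, v}) ` parcs P"
    by (auto simp: edges_def)
  then show ?thesis
    using pair_finite_arcs by auto
qed

lemma edgesI: "adj u v \<Longrightarrow> {u, v} \<in> edges P"
  by (auto simp: edges_def)

lemma edge_subset: "e \<in> edges P \<Longrightarrow> e \<subseteq> pverts P"
  by (auto simp: edges_def dest: adj_verts)

lemma arc_edge: "e \<in> edges P \<Longrightarrow> arc (\<gamma> e)"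
  and ends_edge: "e \<in> edges P \<Longrightarrow> {pathstart (\<gamma> e), pathfinish (\<gamma> e)} = \<phi> ` e"
  and verts_edge: "e \<in> edges P \<Longrightarrow> path_image (\<gamma> e) \<inter> \<phi> ` pverts P = \<phi> ` e"
  and edges_Int: "e \<in> edges P \<Longrightarrow> f \<in> edges P \<Longrightarrow> e \<noteq> f \<Longrightarrow>
      path_image (\<gamma> e) \<inter> path_image (\<gamma> f) \<subseteq> \<phi> ` (e \<inter> f)"
  and inj_verts: "inj_on \<phi> (pverts P)"
  using drawing unfolding plane_drawing_def by blast+

lemma arc_oriented:
  assumes "adj u v"
  obtains g where "arc g" "pathstart g = \<phi> u" "pathfinish g = \<phi> v" "path_image g = path_image (\<gamma> {u, v})"
proof -
  have e: "{u, v} \<in> edges P"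
    using assms by (rule edgesI)
  have "\<phi> u \<noteq> \<phi> v"
    using adj_neq[OF assms] adj_verts[OF assms] inj_verts by (auto simp: inj_on_def)
  then consider "pathstart (\<gamma> {u, v}) = \<phi> u" "pathfinish (\<gamma> {u, v}) = \<phi> v"
    | "pathstart (\<gamma> {u, v}) = \<phi> v" "pathfinish (\<gamma> {u, v}) = \<phi> u"
    using ends_edge[OF e] by (auto simp: doubleton_eq_iff)
  then show thesis
    using that[of "\<gamma> {u, v}"] that[of "reversepath (\<gamma> {u, v})"] arc_edge[OF e]
    by cases (auto simp: arc_reversepath)
qed

lemma trail_edges: "chain xs \<Longrightarrow> trail xs \<subseteq> edges P"
  by (induction xs rule: trail.induct) (auto simp: edgesI)

lemma chain_verts: "chain xs \<Longrightarrow> length xs \<ge> 2 \<Longrightarrow> set xs \<subseteq> pverts P"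
  using trail_edges[of xs] Union_trail[of xs] edge_subset by fast

lemma img_insert [simp]: "img (insert e F) = path_image (\<gamma> e) \<union> img F"
  and img_empty [simp]: "img {} = {}"
  and img_Un: "img (F \<union> F') = img F \<union> img F'"
  by (auto simp: img_def)

lemma img_Int:
  assumes "F \<subseteq> edges P" "F' \<subseteq> edges P" "F \<inter> F' = {}"
  shows "img F \<inter> img F' \<subseteq> \<phi> ` (\<Union>F \<inter> \<Union>F')"
proof
  fix z assume "z \<in> img F \<inter> img F'"
  then obtain e f where ef: "e \<in> F" "f \<in> F'" "z \<in> path_image (\<gamma> e) \<inter> path_image (\<gamma> f)"
    by (auto simp: img_def)
  then have "z \<in> \<phi> ` (e \<inter> f)"
    using edges_Int[of e f] assms by blast
  then show "z \<in> \<phi> ` (\<Union>F \<inter> \<Union>F')"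
    using ef by auto
qed

lemma img_vert:
  assumes "F \<subseteq> edges P" "v \<in> pverts P"
  shows "\<phi> v \<in> img F \<longleftrightarrow> v \<in> \<Union>F"
proof -
  have "\<phi> v \<in> path_image (\<gamma> e) \<longleftrightarrow> v \<in> e" if "e \<in> F" for e
    using verts_edge[of e] edge_subset[of e] that assms inj_verts
    by (auto simp: inj_on_def image_iff set_eq_iff) blast
  then show ?thesis
    by (auto simp: img_def)
qed

lemma compact_img: "F \<subseteq> edges P \<Longrightarrow> compact (img F)"
  unfolding img_def using finite_edges finite_subset arc_edge
  by (intro compact_UN) (auto simp: arc_imp_path compact_path_image)

text \<open>The first vertex does not recur, so the first edge and the image of the rest share only
  the second vertex and can be joined to an arc.\<close>

lemma chain_arc:
  assumes "chain xs" "distinct xs" "length xs \<ge> 2"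
  shows "\<exists>g. arc g \<and> pathstart g = \<phi> (hd xs) \<and> pathfinish g = \<phi> (last xs) \<and> path_image g = img (trail xs)"
  using assms
proof (induction xs rule: trail.induct)
  case (1 p q xs)
  obtain g where g: "arc g" "pathstart g = \<phi> p" "pathfinish g = \<phi> q" "path_image g = path_image (\<gamma> {p, q})"
    using arc_oriented[of p q] 1(2) by auto
  show ?case
  proof (cases xs)
    case Nil
    then show ?thesis using g by auto
  next
    case (Cons r ys)
    then obtain h where h: "arc h" "pathstart h = \<phi> q" "pathfinish h = \<phi> (last (q # xs))"
        "path_image h = img (trail (q # xs))"
      using 1 by auto
    have "p \<notin> \<Union> (trail (q # xs))"
      using Union_trail_subset[of "q # xs"] 1(3) by auto
    then have "path_image (\<gamma> {p, q}) \<inter> img (trail (q # xs)) \<subseteq> \<phi> ` ({p, q} \<inter> \<Union> (trail (q # xs)))"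
      using 1(2) trail_edges[of "q # xs"] by (intro img_Int[of "{{p, q}}", simplified]) (auto simp: edgesI)
    also have "\<dots> \<subseteq> {\<phi> q}"
      using \<open>p \<notin> _\<close> by auto
    finally have "arc (g +++ h)"
      using g h by (intro arc_join) auto
    then show ?thesis
      using g h by (intro exI[of _ "g +++ h"]) (auto simp: path_image_join)
  qed
qed auto

text \<open>Each edge inside \<open>W\<close> has no end on an edge of \<open>F\<close>, hence its
  arc misses \<open>img F\<close>. This is how a whole wall is placed on one side of a closed
  curve.\<close>

lemma linked_img:
  assumes "linked (parcs P) W" "F \<subseteq> edges P" "W \<inter> \<Union>F = {}" "p \<in> W" "q \<in> W" "W \<subseteq> pverts P"
  shows "connected_component (- img F) (\<phi> p) (\<phi> q)"
proof -
  have "(p, q) \<in> (parcs P \<inter> W \<times> W)\<^sup>*"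
    using assms unfolding linked_def by blast
  then show ?thesis
  proof (induction rule: rtrancl_induct)
    case base
    then show ?case
      using img_vert[of F p] assms by auto
  next
    case (step u v)
    then have e: "{u, v} \<in> edges P" and "adj u v"
      by (auto intro: edgesI)
    have "img {{u, v}} \<inter> img F \<subseteq> \<phi> ` (\<Union>{{u, v}} \<inter> \<Union>F)"
      by (rule img_Int) (use e assms step in auto)
    then have "path_image (\<gamma> {u, v}) \<subseteq> - img F"
      using assms step by auto
    moreover have "topological_space_class.connected (path_image (\<gamma> {u, v}))"
      using arc_edge[OF e] by (simp add: arc_imp_path connected_path_image)
    moreover have "\<phi> u \<in> path_image (\<gamma> {u, v})" "\<phi> v \<in> path_image (\<gamma> {u, v})"
      using verts_edge[OF e] by auto
    ultimately have "connected_component (- img F) (\<phi> u) (\<phi> v)"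
      unfolding connected_component_def by (intro exI[of _ "path_image (\<gamma> {u, v})"] conjI)
    then show ?case
      using step connected_component_trans by metis
  qed
qed

end

section \<open>Jordan curves through a fixed edge\<close>

lemma Jordan_same_side:
  fixes c :: "real \<Rightarrow> complex"
  assumes "simple_path c" "pathfinish c = pathstart c"
    and "x \<notin> path_image c" "y \<notin> path_image c" "z \<notin> path_image c"
    and "\<not> connected_component (- path_image c) x y"
  shows "connected_component (- path_image c) x z \<or> connected_component (- path_image c) y z"
proof -
  note J = Jordan_inside_outside[OF assms(1,2)]
  have "connected_component (- path_image c) u v"
    if "u \<in> inside (path_image c) \<and> v \<in> inside (path_image c) \<or>
        u \<in> outside (path_image c) \<and> v \<in> outside (path_image c)" for u v
    using that J unfolding connected_component_def
    by (meson inside_no_overlap inside_subset outside_no_overlap disjoint_eq_subset_Compl inf_commute)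
  moreover have "u \<in> inside (path_image c) \<or> u \<in> outside (path_image c)"
    if "u \<notin> path_image c" for u
    using that J by blast
  ultimately show ?thesis
    using assms(3-) by meson
qed

text \<open>Either side of a Jordan curve determines the curve; \<open>theta_separation\<close> uses
  this to tell two loops apart.\<close>

lemma frontier_Jordan_component:
  fixes c :: "real \<Rightarrow> complex"
  assumes "simple_path c" "pathfinish c = pathstart c" "z \<notin> path_image c"
  shows "frontier (connected_component_set (- path_image c) z) = path_image c"
proof (rule Jordan_Brouwer_frontier)
  show "path_image c homeomorphic sphere (0::complex) 1"
    using assms by (intro homeomorphic_simple_path_image_circle) auto
  show "connected_component_set (- path_image c) z \<in> components (- path_image c)"
    using assms by (auto simp: components_def)
qed auto

context plane_graph
begin

text \<open>\<open>loop e xs\<close> is the closed curve formed by the edge \<open>e\<close> and a path \<open>xs\<close> between its ends.\<close>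

definition loop :: "'a set \<Rightarrow> 'a list \<Rightarrow> complex set" where
  "loop e xs = img (insert e (trail xs))"

text \<open>At least three vertices, so that the path is not the edge \<open>{u, v}\<close> itself
  and closes up with it to a Jordan curve.\<close>

definition bridge :: "'a \<Rightarrow> 'a \<Rightarrow> 'a list \<Rightarrow> bool" where
  "bridge u v xs \<longleftrightarrow> chain xs \<and> distinct xs \<and> length xs \<ge> 3 \<and> hd xs = u \<and> last xs = v"

lemma bridge_edge:
  assumes "bridge u v xs"
  shows "{u, v} \<notin> trail xs"
proof
  assume "{u, v} \<in> trail xs"
  moreover obtain x y z ys where xs: "xs = x # y # z # ys"
    using assms unfolding bridge_def by (metis Suc_le_length_iff numeral_3_eq_3)
  ultimately have "{u, v} = {x, y} \<or> {u, v} \<in> trail (y # z # ys)"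
    by auto
  moreover have "x = u" "v \<in> set (z # ys)" "x \<notin> set (y # z # ys)" "y \<notin> set (z # ys)"
    using assms last_in_set[of "z # ys"] unfolding bridge_def xs by auto
  ultimately show False
    using Union_trail_subset[of "y # z # ys"] by (auto simp: doubleton_eq_iff)
qed

lemma bridge_verts: "bridge u v xs \<Longrightarrow> \<Union> (trail xs) = set xs \<and> set xs \<subseteq> pverts P \<and> u \<in> set xs \<and> v \<in> set xs \<and> trail xs \<subseteq> edges P"
proof -
  assume "bridge u v xs"
  then have *: "chain xs" "length xs \<ge> 2" "xs \<noteq> []" "u = hd xs" "v = last xs"
    by (auto simp: bridge_def)
  then show ?thesis
    using Union_trail[OF *(2)] chain_verts[OF *(1,2)] trail_edges[OF *(1)] by simp
qed

lemma bridge_Int: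
  assumes "adj u v" "bridge u v xs"
  shows "path_image (\<gamma> {u, v}) \<inter> img (trail xs) = {\<phi> u, \<phi> v}"
proof -
  have "img {{u, v}} \<inter> img (trail xs) \<subseteq> \<phi> ` (\<Union>{{u, v}} \<inter> \<Union>(trail xs))"
    by (rule img_Int) (use assms bridge_edge bridge_verts edgesI in auto)
  moreover have "\<phi> w \<in> img {{u, v}} \<inter> img (trail xs)" if "w = u \<or> w = v" for w
    using that assms img_vert[of "trail xs" w] img_vert[of "{{u, v}}" w] bridge_verts[of u v xs]
      edgesI[of u v] by auto
  ultimately show ?thesis
    by auto
qed

lemma loop_Jordan:
  assumes "adj u v" "bridge u v xs"
  obtains c where "simple_path c" "pathfinish c = pathstart c" "path_image c = loop {u, v} xs"
proof -
  obtain g where g: "arc g" "pathstart g = \<phi> u" "pathfinish g = \<phi> v" "path_image g = img (trail xs)"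
    using chain_arc[of xs] assms(2) unfolding bridge_def by auto
  obtain h where h: "arc h" "pathstart h = \<phi> v" "pathfinish h = \<phi> u" "path_image h = path_image (\<gamma> {u, v})"
    using arc_oriented[of v u] adj_sym[OF assms(1)] by (metis insert_commute)
  have "simple_path (g +++ h)"
    using bridge_Int[OF assms] g h by (intro simple_path_join_loop) auto
  then show thesis
    using g h that[of "g +++ h"] by (auto simp: path_image_join loop_def)
qed

text \<open>The three arcs of a theta curve: if two faces were bounded by the same pair of arcs on
  both sides, then the faces at \<open>z'\<close> would coincide and have two different frontiers.\<close>

lemma theta_separation:
  assumes e: "adj u v" and xs: "bridge u v (\<alpha> @ \<sigma> @ \<beta>)" and ys: "bridge u v (\<alpha> @ \<tau> @ \<beta>)"
    and ne: "\<alpha> \<noteq> []" "\<beta> \<noteq> []" "p \<in> set \<sigma>" "q \<in> set \<tau>" and disj: "set \<sigma> \<inter> set \<tau> = {}"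
    and p: "connected_component (- loop {u, v} (\<alpha> @ \<tau> @ \<beta>)) z (\<phi> p)"
    and q: "connected_component (- loop {u, v} (\<alpha> @ \<sigma> @ \<beta>)) z (\<phi> q)"
    and z1: "\<not> connected_component (- loop {u, v} (\<alpha> @ \<tau> @ \<beta>)) z z'"
    and z2: "\<not> connected_component (- loop {u, v} (\<alpha> @ \<sigma> @ \<beta>)) z z'"
    and z': "z' \<notin> loop {u, v} (\<alpha> @ \<tau> @ \<beta>)" "z' \<notin> loop {u, v} (\<alpha> @ \<sigma> @ \<beta>)"
  shows False
proof -
  \<comment> \<open>The loops differ only in the stretches inside \<open>\<sigma>\<close> and
    \<open>\<tau>\<close>. The open arc \<open>?T\<close> through \<open>\<tau>\<close> is
    connected, avoids the first loop and contains \<open>q\<close>, which is on the side of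
    \<open>z\<close>. So the face \<open>?A\<close> of \<open>z'\<close> misses \<open>?T\<close>,
    hence also the second loop. By symmetry the two faces of \<open>z'\<close> coincide.\<close>
  have sub: "connected_component_set (- loop {u, v} (\<alpha> @ \<sigma> @ \<beta>)) z'
      \<subseteq> connected_component_set (- loop {u, v} (\<alpha> @ \<tau> @ \<beta>)) z'"
    if xs: "bridge u v (\<alpha> @ \<sigma> @ \<beta>)" and ys: "bridge u v (\<alpha> @ \<tau> @ \<beta>)"
      and q: "q \<in> set \<tau>" "connected_component (- loop {u, v} (\<alpha> @ \<sigma> @ \<beta>)) z (\<phi> q)"
      and disj: "set \<sigma> \<inter> set \<tau> = {}"
      and z: "\<not> connected_component (- loop {u, v} (\<alpha> @ \<sigma> @ \<beta>)) z z'" "z' \<notin> loop {u, v} (\<alpha> @ \<sigma> @ \<beta>)"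
    for \<sigma> \<tau> q
  proof -
    let ?A = "connected_component_set (- loop {u, v} (\<alpha> @ \<sigma> @ \<beta>)) z'"
    let ?a = "last \<alpha>" and ?b = "hd \<beta>"
    let ?t = "?a # \<tau> @ [?b]"
    have \<tau>: "\<tau> \<noteq> []"
      using q by auto
    have tr: "trail (\<alpha> @ \<tau> @ \<beta>) = trail \<alpha> \<union> trail ?t \<union> trail \<beta>"
    proof -
      have "trail (\<alpha> @ \<tau> @ \<beta>) = trail \<alpha> \<union> insert {?a, hd \<tau>} (trail \<tau> \<union> insert {last \<tau>, ?b} (trail \<beta>))"
        using ne \<tau> by (simp add: trail_append_Nil)
      moreover have "trail ?t = insert {?a, hd \<tau>} (trail \<tau> \<union> {{last \<tau>, ?b}})"
        using trail_append_Nil[of "[?a]" "\<tau> @ [?b]"] trail_append_Nil[of \<tau> "[?b]"] \<tau> by simp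
      ultimately show ?thesis by auto
    qed
    have tr': "trail \<alpha> \<union> trail \<beta> \<subseteq> trail (\<alpha> @ \<sigma> @ \<beta>)"
      using ne trail_append_Nil[of \<alpha> "\<sigma> @ \<beta>"] trail_append_Nil[of \<sigma> \<beta>] by (cases "\<sigma> = []") auto
    have dist: "distinct (\<alpha> @ \<tau> @ \<beta>)" and ch: "chain (\<alpha> @ \<tau> @ \<beta>)"
      using ys by (auto simp: bridge_def)
    have ab: "?a \<in> set \<alpha>" "?b \<in> set \<beta>"
      using ne by auto
    then have abn: "?a \<noteq> ?b" "?a \<notin> set \<tau>" "?b \<notin> set \<tau>"
      using dist by auto
    have "chain ?t"
      using ch ne \<tau> by (auto simp: successively_append_iff successively_Cons)
    moreover have "distinct ?t"
      using abn dist by auto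
    ultimately obtain g where g: "arc g" "pathstart g = \<phi> ?a" "pathfinish g = \<phi> ?b" "path_image g = img (trail ?t)"
      using chain_arc[of ?t] \<tau> by (auto simp: Suc_le_eq)
    have tt: "\<Union>(trail ?t) = set ?t" "trail ?t \<subseteq> edges P" "set ?t \<subseteq> pverts P"
      using Union_trail[of ?t] trail_edges[OF \<open>chain ?t\<close>] chain_verts[OF \<open>chain ?t\<close>] by auto
    let ?T = "img (trail ?t) - {\<phi> ?a, \<phi> ?b}"
    have conT: "topological_space_class.connected ?T"
      using connected_simple_path_endless[OF arc_imp_simple_path[OF g(1)]] g by simp
    have xs': "insert {u, v} (trail (\<alpha> @ \<sigma> @ \<beta>)) \<subseteq> edges P" "\<Union>(trail (\<alpha> @ \<sigma> @ \<beta>)) = set (\<alpha> @ \<sigma> @ \<beta>)"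
        "u \<in> set (\<alpha> @ \<sigma> @ \<beta>)" "v \<in> set (\<alpha> @ \<sigma> @ \<beta>)"
      using bridge_verts[OF xs] edgesI[OF e] by auto
    have uv: "u \<in> set \<alpha>" "v \<in> set \<beta>"
      using xs ne unfolding bridge_def by auto
    \<comment> \<open>Every edge of the arc has an end in \<open>\<tau>\<close>, so none belongs to
      the other loop, and the two images can meet only in images of common vertices.\<close>
    have mid: "f \<inter> set \<tau> \<noteq> {}" if "f \<in> trail ?t" for f
    proof -
      have "f \<in> insert {?a, hd \<tau>} (trail \<tau> \<union> {{last \<tau>, ?b}})"
        using that trail_append_Nil[of "[?a]" "\<tau> @ [?b]"] trail_append_Nil[of \<tau> "[?b]"] \<tau> by simp
      moreover have "f \<inter> set \<tau> \<noteq> {}" if "f \<in> trail \<tau>"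
      proof -
        have "f \<in> edges P"
          using that \<open>f \<in> trail ?t\<close> tt by auto
        then show ?thesis
          using Union_trail_subset[of \<tau>] that by (auto simp: edges_def)
      qed
      ultimately show ?thesis
        using \<tau> by auto
    qed
    have U: "\<Union>(insert {u, v} (trail (\<alpha> @ \<sigma> @ \<beta>))) = set (\<alpha> @ \<sigma> @ \<beta>)"
      using xs'(2-4) by blast
    have \<tau>_disj: "set (\<alpha> @ \<sigma> @ \<beta>) \<inter> set \<tau> = {}"
      using dist disj by fastforce
    have ndj: "trail ?t \<inter> insert {u, v} (trail (\<alpha> @ \<sigma> @ \<beta>)) = {}"
    proof (rule equals0I)
      fix f assume "f \<in> trail ?t \<inter> insert {u, v} (trail (\<alpha> @ \<sigma> @ \<beta>))"
      then have f: "f \<in> trail ?t" "f \<in> insert {u, v} (trail (\<alpha> @ \<sigma> @ \<beta>))"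
        by (rule IntD1, rule IntD2)
      have "f \<inter> set \<tau> \<noteq> {}" "f \<subseteq> set (\<alpha> @ \<sigma> @ \<beta>)"
        by (rule mid[OF f(1)]) (metis Union_upper U f(2))
      then show False
        using \<tau>_disj by blast
    qed
    have "img (trail ?t) \<inter> loop {u, v} (\<alpha> @ \<sigma> @ \<beta>) \<subseteq> \<phi> ` (set ?t \<inter> set (\<alpha> @ \<sigma> @ \<beta>))"
      using img_Int[OF tt(2) xs'(1) ndj] unfolding loop_def tt(1) U .
    also have "\<dots> \<subseteq> {\<phi> ?a, \<phi> ?b}"
      using dist disj by auto
    finally have T: "?T \<inter> loop {u, v} (\<alpha> @ \<sigma> @ \<beta>) = {}"
      by auto
    have qT: "\<phi> q \<in> ?T"
    proof -
      have "\<phi> q \<in> img (trail ?t)"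
        using img_vert[OF tt(2), of q] tt q by auto
      moreover have "\<phi> q \<noteq> \<phi> ?a" "\<phi> q \<noteq> \<phi> ?b"
        using inj_verts tt(3) q(1) abn by (auto simp: inj_on_def)
      ultimately show ?thesis by auto
    qed
    have "?A \<inter> ?T = {}"
    proof (rule ccontr)
      assume "?A \<inter> ?T \<noteq> {}"
      then obtain w where w: "connected_component (- loop {u, v} (\<alpha> @ \<sigma> @ \<beta>)) z' w" "w \<in> ?T"
        by auto
      have "connected_component (- loop {u, v} (\<alpha> @ \<sigma> @ \<beta>)) w (\<phi> q)"
        unfolding connected_component_def using conT w T qT by (intro exI[of _ ?T]) auto
      then show False
        using connected_component_trans[OF q(2) connected_component_sym] connected_component_trans
          connected_component_sym[OF w(1)] z(1) by blast
    qed
    have ends: "\<phi> ?a \<in> loop {u, v} (\<alpha> @ \<sigma> @ \<beta>)" "\<phi> ?b \<in> loop {u, v} (\<alpha> @ \<sigma> @ \<beta>)"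
      using img_vert[OF xs'(1)] xs' ab tt(3) unfolding loop_def by auto
    have "loop {u, v} (\<alpha> @ \<tau> @ \<beta>) \<subseteq> loop {u, v} (\<alpha> @ \<sigma> @ \<beta>) \<union> ?T"
      using tr tr' ends unfolding loop_def by (auto simp: img_def)
    moreover have "?A \<subseteq> - loop {u, v} (\<alpha> @ \<sigma> @ \<beta>)"
      by (rule connected_component_subset)
    ultimately have "?A \<subseteq> - loop {u, v} (\<alpha> @ \<tau> @ \<beta>)"
      using \<open>?A \<inter> ?T = {}\<close> by blast
    then show ?thesis
      using z(2) by (intro connected_component_maximal) auto
  qed
  have eq: "connected_component_set (- loop {u, v} (\<alpha> @ \<sigma> @ \<beta>)) z'
      = connected_component_set (- loop {u, v} (\<alpha> @ \<tau> @ \<beta>)) z'"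
    using sub[OF xs ys ne(4) q disj z2 z'(2)] sub[OF ys xs ne(3) p _ z1 z'(1)] disj by blast
  have fr: "frontier (connected_component_set (- loop {u, v} rs) z') = loop {u, v} rs"
    if "bridge u v rs" "z' \<notin> loop {u, v} rs" for rs
    using loop_Jordan[OF e that(1)] frontier_Jordan_component that(2) by metis
  \<comment> \<open>Equal faces have equal frontiers, which makes the two loops the same curve,
    although \<open>p\<close> lies on just one of them.\<close>
  have "loop {u, v} (\<alpha> @ \<sigma> @ \<beta>) = loop {u, v} (\<alpha> @ \<tau> @ \<beta>)"
    by (rule trans[OF fr[OF xs z'(2), symmetric] trans[OF arg_cong[OF eq, of frontier] fr[OF ys z'(1)]]])
  moreover have "\<phi> p \<in> loop {u, v} (\<alpha> @ \<sigma> @ \<beta>)"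
    using img_vert[of "trail (\<alpha> @ \<sigma> @ \<beta>)" p] bridge_verts[OF xs] ne(3) by (auto simp: loop_def)
  moreover have "\<phi> p \<notin> loop {u, v} (\<alpha> @ \<tau> @ \<beta>)"
    using connected_component_in[OF p] by auto
  ultimately show False
    by simp
qed

text \<open>A small disc around an inner point of the edge meets no other edge; two points of it on the
  two sides of one loop are on different sides of each loop.\<close>

lemma edge_sides:
  assumes e: "adj u v"
  obtains z z' where
    "\<And>xs. bridge u v xs \<Longrightarrow> z \<notin> loop {u, v} xs \<and> z' \<notin> loop {u, v} xs
        \<and> \<not> connected_component (- loop {u, v} xs) z z'"
proof (cases "\<exists>xs. bridge u v xs")
  case False
  then show thesis using that by blast
next
  case True
  then obtain xs where xs: "bridge u v xs" by blast
  let ?e = "{u, v}"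
  have eP: "?e \<in> edges P"
    using e by (rule edgesI)
  obtain g where g: "arc g" "pathstart g = \<phi> u" "pathfinish g = \<phi> v" "path_image g = path_image (\<gamma> {u, v})"
    using arc_oriented[OF e] .
  define z0 where "z0 = g (1/2)"
  have z0: "z0 \<in> path_image (\<gamma> ?e)" "z0 \<noteq> \<phi> u" "z0 \<noteq> \<phi> v"
  proof -
    have "inj_on g {0..1}"
      using g by (simp add: arc_def)
    then show "z0 \<noteq> \<phi> u" "z0 \<noteq> \<phi> v"
      using g inj_onD[of g "{0..1}" "1/2" 0] inj_onD[of g "{0..1}" "1/2" 1]
      unfolding z0_def pathstart_def pathfinish_def by auto
    show "z0 \<in> path_image (\<gamma> ?e)"
      unfolding z0_def g(4)[symmetric] by (auto simp: path_image_def)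
  qed
  let ?U = "img (edges P - {?e})"
  have "img {?e} \<inter> ?U \<subseteq> \<phi> ` (\<Union>{?e} \<inter> \<Union>(edges P - {?e}))"
    using eP by (intro img_Int) auto
  then have "z0 \<notin> ?U"
    using z0 by auto
  moreover have "closed ?U"
    by (intro compact_imp_closed compact_img) auto
  ultimately obtain r where r: "r > 0" "ball z0 r \<inter> ?U = {}"
    by (metis Compl_iff closed_def disjoint_eq_subset_Compl open_contains_ball)
  let ?D = "ball z0 r"
  obtain c where c: "simple_path c" "pathfinish c = pathstart c" "path_image c = loop ?e xs"
    using loop_Jordan[OF e xs] .
  have sub: "trail ys \<subseteq> edges P - {?e}" if "bridge u v ys" for ys
    using bridge_edge[OF that] bridge_verts[OF that] by auto
  have D: "?D \<inter> img (trail ys) = {}" if "bridge u v ys" for ys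
    using r(2) sub[OF that] by (auto simp: img_def)
  have "z0 \<in> loop ?e xs"
    using z0 by (auto simp: loop_def)
  note J = Jordan_inside_outside[OF c(1,2), unfolded c(3)]
  have "z0 \<in> closure (inside (loop ?e xs))" "z0 \<in> closure (outside (loop ?e xs))"
    using J \<open>z0 \<in> loop ?e xs\<close> unfolding frontier_def by blast+
  then obtain z z' where zz: "z \<in> inside (loop ?e xs)" "z' \<in> outside (loop ?e xs)" "z \<in> ?D" "z' \<in> ?D"
    using r(1) unfolding closure_approachable by (metis dist_commute mem_ball)
  then have nz: "z \<notin> loop ?e xs" "z' \<notin> loop ?e xs"
    using inside_no_overlap outside_no_overlap by blast+
  have sep: "\<not> connected_component (- loop ?e xs) z z'"
    using zz(1,2) inside_same_component[of "loop ?e xs" z z'] J by blast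
  have loopD: "w \<notin> loop ?e ys" if "bridge u v ys" "w \<in> {z, z'}" for w ys
    using D[OF that(1)] zz(3,4) nz that(2) by (auto simp: loop_def)
  have "\<not> connected_component (- loop ?e ys) z z'" if ys: "bridge u v ys" for ys
  proof
    assume *: "connected_component (- loop ?e ys) z z'"
    have in_edges: "insert ?e (trail ys) \<subseteq> edges P" "trail xs \<union> trail ys \<subseteq> edges P"
      using sub[OF xs] sub[OF ys] eP by auto
    have conn: "topological_space_class.connected (img (trail ys))"
    proof -
      obtain g where "arc g" "path_image g = img (trail ys)"
        using chain_arc[of ys] ys unfolding bridge_def by auto
      then show ?thesis
        by (metis arc_imp_path connected_path_image)
    qed
    \<comment> \<open>Janiszewski's theorem: these two sets meet in the connected path
      \<open>ys\<close>. If neither separates \<open>z\<close> from \<open>z'\<close>, then neither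
      does their union, which contains the loop of \<open>xs\<close>. The union of the paths does
      not separate them because the disc avoids it.\<close>
    have "loop ?e ys \<inter> img (trail xs \<union> trail ys) = img (trail ys)"
      using bridge_Int[OF e xs] bridge_Int[OF e ys] by (auto simp: loop_def img_Un)
    then have "connected_component (- (loop ?e ys \<union> img (trail xs \<union> trail ys))) z z'"
    proof (intro Janiszewski)
      show "compact (loop ?e ys)"
        unfolding loop_def by (intro compact_img in_edges)
      show "closed (img (trail xs \<union> trail ys))"
        by (intro compact_imp_closed compact_img in_edges)
      show "connected_component (- img (trail xs \<union> trail ys)) z z'"
        unfolding connected_component_def using zz(3,4) D[OF xs] D[OF ys]
        by (intro exI[of _ ?D]) (auto simp: img_Un)
    qed (use conn * in auto)
    moreover have "- (loop ?e ys \<union> img (trail xs \<union> trail ys)) \<subseteq> - loop ?e xs"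
      by (auto simp: loop_def img_Un)
    ultimately show False
      using sep connected_component_of_subset by blast
  qed
  then show thesis
    using that[of z z'] loopD by blast
qed

end

section \<open>Walls and their order from left to right\<close>

context plane_graph
begin

text \<open>A connected set that touches two given regions from outside. With an edge between the
  regions it gives a closed curve, and so a left and a right of the wall.\<close>

definition wall :: "'a set \<Rightarrow> 'a set \<Rightarrow> 'a set \<Rightarrow> bool" where
  "wall A B W \<longleftrightarrow> linked (parcs P) W \<and> W \<inter> A = {} \<and> W \<inter> B = {} \<and>
     (\<exists>p\<in>W. \<exists>q\<in>A. adj p q) \<and> (\<exists>p\<in>W. \<exists>q\<in>B. adj p q)"

text \<open>A path through the wall is extended to \<open>u\<close> and \<open>v\<close> along two
  trees, one in \<open>A\<close> and one in \<open>B\<close>, that are the same for all walls. Thus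
  the paths of two walls agree near both ends.\<close>

lemma wall_bridge:
  assumes A: "linked (parcs P) A" "u \<in> A" and B: "linked (parcs P) B" "v \<in> B" and disj: "A \<inter> B = {}"
  obtains fa fb where
    "\<And>W. wall A B W \<Longrightarrow> \<exists>q\<in>A. \<exists>r\<in>B. \<exists>\<sigma>. \<sigma> \<noteq> [] \<and> set \<sigma> \<subseteq> W \<and> bridge u v (rev (fa q) @ \<sigma> @ fb r)"
    "\<And>q. q \<in> A \<Longrightarrow> set (fa q) \<subseteq> A \<and> last (fa q) = u \<and> hd (fa q) = q \<and> fa q \<noteq> []"
    "\<And>q. q \<in> B \<Longrightarrow> set (fb q) \<subseteq> B \<and> last (fb q) = v \<and> hd (fb q) = q \<and> fb q \<noteq> []"
    "\<And>q xs y ys. q \<in> A \<Longrightarrow> fa q = xs @ y # ys \<Longrightarrow> fa y = y # ys"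
    "\<And>q xs y ys. q \<in> B \<Longrightarrow> fb q = xs @ y # ys \<Longrightarrow> fb y = y # ys"
proof -
  obtain fa where fa:
    "\<And>q. q \<in> A \<Longrightarrow> chain (fa q) \<and> distinct (fa q) \<and> set (fa q) \<subseteq> A \<and> fa q \<noteq> [] \<and> hd (fa q) = q \<and> last (fa q) = u"
    "\<And>q xs y ys. q \<in> A \<Longrightarrow> fa q = xs @ y # ys \<Longrightarrow> fa y = y # ys"
    using tree_paths[OF A] by blast
  obtain fb where fb:
    "\<And>q. q \<in> B \<Longrightarrow> chain (fb q) \<and> distinct (fb q) \<and> set (fb q) \<subseteq> B \<and> fb q \<noteq> [] \<and> hd (fb q) = q \<and> last (fb q) = v"
    "\<And>q xs y ys. q \<in> B \<Longrightarrow> fb q = xs @ y # ys \<Longrightarrow> fb y = y # ys"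
    using tree_paths[OF B] by blast
  show thesis
  proof (rule that[of fa fb])
    fix W assume "wall A B W"
    then obtain p q p' r where W: "linked (parcs P) W" "W \<inter> A = {}" "W \<inter> B = {}"
      and p: "p \<in> W" "q \<in> A" "adj p q" "p' \<in> W" "r \<in> B" "adj p' r"
      unfolding wall_def by blast
    obtain \<pi> where \<pi>: "chain (\<pi> p)" "distinct (\<pi> p)" "set (\<pi> p) \<subseteq> W" "\<pi> p \<noteq> []" "hd (\<pi> p) = p" "last (\<pi> p) = p'"
      using tree_paths[OF W(1) p(4)] p(1) by metis
    have "chain (rev (fa q))"
      using fa(1)[OF p(2)] adj_sym by (auto simp: successively_rev elim: successively_mono)
    moreover have "last (rev (fa q)) = q" "hd (rev (fa q)) = u"
      using fa(1)[OF p(2)] by (simp_all add: last_rev hd_rev)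
    ultimately have "chain (rev (fa q) @ \<pi> p @ fb r)"
      using \<pi> fb(1)[OF p(5)] p(3,6) adj_sym by (auto simp: successively_append_iff)
    moreover have "distinct (rev (fa q) @ \<pi> p @ fb r)"
      using fa(1)[OF p(2)] fb(1)[OF p(5)] \<pi> W disj by auto
    moreover have "length (rev (fa q) @ \<pi> p @ fb r) \<ge> 3"
    proof -
      have "length (fa q) \<ge> 1" "length (\<pi> p) \<ge> 1" "length (fb r) \<ge> 1"
        using fa(1)[OF p(2)] fb(1)[OF p(5)] \<pi>(4) by (simp_all add: Suc_le_eq)
      then show ?thesis by simp
    qed
    moreover have "hd (rev (fa q) @ \<pi> p @ fb r) = u" "last (rev (fa q) @ \<pi> p @ fb r) = v"
      using fa(1)[OF p(2)] fb(1)[OF p(5)] by (simp_all add: hd_append hd_rev)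
    ultimately have "bridge u v (rev (fa q) @ \<pi> p @ fb r)"
      unfolding bridge_def by blast
    then show "\<exists>q\<in>A. \<exists>r\<in>B. \<exists>\<sigma>. \<sigma> \<noteq> [] \<and> set \<sigma> \<subseteq> W \<and> bridge u v (rev (fa q) @ \<sigma> @ fb r)"
      using p \<pi> by blast
  next
    show "fa y = y # ys" if "q \<in> A" "fa q = xs @ y # ys" for q xs y ys
      by (rule fa(2)[OF that])
    show "fb y = y # ys" if "q \<in> B" "fb q = xs @ y # ys" for q xs y ys
      by (rule fb(2)[OF that])
    show "set (fa q) \<subseteq> A \<and> last (fa q) = u \<and> hd (fa q) = q \<and> fa q \<noteq> []" if "q \<in> A" for q
      using fa(1)[OF that] by simp
    show "set (fb q) \<subseteq> B \<and> last (fb q) = v \<and> hd (fb q) = q \<and> fb q \<noteq> []" if "q \<in> B" for q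
      using fb(1)[OF that] by simp
  qed
qed

text \<open>Let \<open>y\<close> be the first entry of \<open>f q\<close> that occurs in
  \<open>f r\<close>. From there on both lists equal \<open>f y\<close>.\<close>

lemma merge_lists:
  assumes "\<And>xs y ys. f q = xs @ y # ys \<Longrightarrow> f y = y # ys" "\<And>xs y ys. f r = xs @ y # ys \<Longrightarrow> f y = y # ys"
    and "f q \<noteq> []" "f r \<noteq> []" "last (f q) = last (f r)"
  obtains xs ys zs where "f q = xs @ zs" "f r = ys @ zs" "zs \<noteq> []" "set xs \<inter> set ys = {}"
proof -
  have "\<exists>x\<in>set (f q). x \<in> set (f r)"
    using assms(3-5) last_in_set by metis
  then obtain xs y zs where q: "f q = xs @ y # zs" "y \<in> set (f r)" "\<forall>x\<in>set xs. x \<notin> set (f r)"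
    using split_list_first_prop[of "f q" "\<lambda>x. x \<in> set (f r)"] by blast
  then obtain ys zs' where r: "f r = ys @ y # zs'"
    by (meson split_list)
  then have "f r = ys @ y # zs"
    using assms(1)[OF q(1)] assms(2)[OF r] by simp
  then show thesis
    using that[of xs "y # zs" ys] q by auto
qed

text \<open>\<open>lab V W\<close> tells whether \<open>V\<close> lies on the \<open>z\<close>-side
  of the loop through \<open>W\<close>. By \<open>theta_separation\<close>, two disjoint walls are
  not both on the \<open>z\<close>-side, nor both on the \<open>z'\<close>-side, of each other's
  loops; this makes the label antisymmetric. Walls that meet form one linked set off the third loop,
  hence lie on the same side of it.\<close>

theorem wall_labels:
  assumes A: "linked (parcs P) A" "u \<in> A" and B: "linked (parcs P) B" "v \<in> B" and disj: "A \<inter> B = {}"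
    and uv: "adj u v"
  obtains lab :: "'a set \<Rightarrow> 'a set \<Rightarrow> bool" where
    "\<And>V W. wall A B V \<Longrightarrow> wall A B W \<Longrightarrow> V \<inter> W = {} \<Longrightarrow> lab V W \<noteq> lab W V"
    "\<And>V V' W. wall A B V \<Longrightarrow> wall A B V' \<Longrightarrow> wall A B W \<Longrightarrow> V \<inter> W = {} \<Longrightarrow> V' \<inter> W = {} \<Longrightarrow> V \<inter> V' \<noteq> {}
      \<Longrightarrow> lab V W = lab V' W"
proof -
  obtain fa fb where
    br: "\<And>W. wall A B W \<Longrightarrow> \<exists>q\<in>A. \<exists>r\<in>B. \<exists>\<sigma>. \<sigma> \<noteq> [] \<and> set \<sigma> \<subseteq> W \<and> bridge u v (rev (fa q) @ \<sigma> @ fb r)"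
    and fa: "\<And>q. q \<in> A \<Longrightarrow> set (fa q) \<subseteq> A \<and> last (fa q) = u \<and> hd (fa q) = q \<and> fa q \<noteq> []"
    and fb: "\<And>q. q \<in> B \<Longrightarrow> set (fb q) \<subseteq> B \<and> last (fb q) = v \<and> hd (fb q) = q \<and> fb q \<noteq> []"
    and fa': "\<And>q xs y ys. q \<in> A \<Longrightarrow> fa q = xs @ y # ys \<Longrightarrow> fa y = y # ys"
    and fb': "\<And>q xs y ys. q \<in> B \<Longrightarrow> fb q = xs @ y # ys \<Longrightarrow> fb y = y # ys"
    by (rule wall_bridge[OF A B disj]) (rule that; assumption)
  obtain qa qb \<sigma> where q: "\<And>W. wall A B W \<Longrightarrow> qa W \<in> A \<and> qb W \<in> B \<and> \<sigma> W \<noteq> [] \<and> set (\<sigma> W) \<subseteq> W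
      \<and> bridge u v (rev (fa (qa W)) @ \<sigma> W @ fb (qb W))"
    using br by metis
  define path where "path W = rev (fa (qa W)) @ \<sigma> W @ fb (qb W)" for W
  obtain z z' where z: "\<And>xs. bridge u v xs \<Longrightarrow> z \<notin> loop {u, v} xs \<and> z' \<notin> loop {u, v} xs
      \<and> \<not> connected_component (- loop {u, v} xs) z z'"
    using edge_sides[OF uv] by blast
  define lab where "lab V W = connected_component (- loop {u, v} (path W)) z (\<phi> (hd (\<sigma> V)))" for V W
  have path: "bridge u v (path W)" "set (path W) \<subseteq> A \<union> W \<union> B" if "wall A B W" for W
  proof -
    note Q = q[OF that]
    show "bridge u v (path W)"
      using Q unfolding path_def by simp
    have "set (fa (qa W)) \<subseteq> A" "set (\<sigma> W) \<subseteq> W" "set (fb (qb W)) \<subseteq> B"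
      using Q fa[of "qa W"] fb[of "qb W"] by simp_all
    then show "set (path W) \<subseteq> A \<union> W \<union> B"
      unfolding path_def by auto
  qed
  have wallP: "W \<subseteq> pverts P" if "wall A B W" for W
  proof
    fix p assume p: "p \<in> W"
    obtain p' q' where "p' \<in> W" "adj p' q'" "(p', p) \<in> (parcs P \<inter> W \<times> W)\<^sup>*"
      using p \<open>wall A B W\<close> unfolding wall_def linked_def by blast
    then show "p \<in> pverts P"
      by (metis IntD1 adj_verts rtranclE)
  qed
  have same: "connected_component (- loop {u, v} (path W)) (\<phi> p) (\<phi> p')"
    if "wall A B W" "linked (parcs P) V" "p \<in> V" "p' \<in> V" "V \<inter> (A \<union> W \<union> B) = {}" "V \<subseteq> pverts P" for V W p p'
    unfolding loop_def
  proof (rule linked_img[OF that(2) _ _ that(3,4,6)])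
    show "insert {u, v} (trail (path W)) \<subseteq> edges P"
      using bridge_verts[OF path(1)[OF that(1)]] edgesI[OF uv] by auto
    show "V \<inter> \<Union> (insert {u, v} (trail (path W))) = {}"
      using bridge_verts[OF path(1)[OF that(1)]] path(2)[OF that(1)] that(5) by auto
  qed
  have 2: "lab V W = lab V' W"
    if "wall A B V" "wall A B V'" "wall A B W" "V \<inter> W = {}" "V' \<inter> W = {}" "V \<inter> V' \<noteq> {}" for V V' W
  proof -
    have "connected_component (- loop {u, v} (path W)) (\<phi> (hd (\<sigma> V))) (\<phi> (hd (\<sigma> V')))"
    proof (rule same[OF that(3), of "V \<union> V'"])
      show "linked (parcs P) (V \<union> V')"
        using that by (intro linked_Un) (auto simp: wall_def)
      show "hd (\<sigma> V) \<in> V \<union> V'" "hd (\<sigma> V') \<in> V \<union> V'"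
        using q[OF that(1)] q[OF that(2)] hd_in_set by blast+
      show "(V \<union> V') \<inter> (A \<union> W \<union> B) = {}"
        using that by (auto simp: wall_def)
      show "V \<union> V' \<subseteq> pverts P"
        using wallP that by auto
    qed
    then show ?thesis
      unfolding lab_def using connected_component_trans connected_component_sym by metis
  qed
  have 1: "lab V W \<noteq> lab W V" if V: "wall A B V" and W: "wall A B W" and VW: "V \<inter> W = {}" for V W
  proof
    assume eq: "lab V W = lab W V"
    obtain xs ys zs where a: "fa (qa V) = xs @ zs" "fa (qa W) = ys @ zs" "zs \<noteq> []" "set xs \<inter> set ys = {}"
      using merge_lists[of fa "qa V" "qa W"] fa fa' q[OF V] q[OF W] by metis
    obtain xs' ys' zs' where b: "fb (qb V) = xs' @ zs'" "fb (qb W) = ys' @ zs'" "zs' \<noteq> []" "set xs' \<inter> set ys' = {}"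
      using merge_lists[of fb "qb V" "qb W"] fb fb' q[OF V] q[OF W] by metis
    \<comment> \<open>Between the two places where the tree paths merge, the bridges are disjoint.
      With the edge from \<open>u\<close> to \<open>v\<close> they form a theta curve.\<close>
    let ?s = "rev xs @ \<sigma> V @ xs'" and ?t = "rev ys @ \<sigma> W @ ys'"
    have pV: "path V = rev zs @ ?s @ zs'" and pW: "path W = rev zs @ ?t @ zs'"
      unfolding path_def a b by simp_all
    have in_s: "hd (\<sigma> V) \<in> set ?s" "hd (\<sigma> W) \<in> set ?t"
      using q[OF V] q[OF W] by simp_all
    have "set ?s \<inter> set ?t = {}"
    proof -
      have "set xs \<subseteq> A" "set ys \<subseteq> A" "set xs' \<subseteq> B" "set ys' \<subseteq> B" "set (\<sigma> V) \<subseteq> V" "set (\<sigma> W) \<subseteq> W"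
        using fa[of "qa V"] fa[of "qa W"] fb[of "qb V"] fb[of "qb W"] q[OF V] q[OF W] a b by auto
      moreover have "V \<inter> A = {}" "V \<inter> B = {}" "W \<inter> A = {}" "W \<inter> B = {}"
        using V W unfolding wall_def by auto
      ultimately show ?thesis
        using disj VW a(4) b(4) by (auto 0 4)
    qed
    note theta = theta_separation[OF uv, of "rev zs" ?s zs' ?t "hd (\<sigma> V)" "hd (\<sigma> W)",
        folded pV pW, OF path(1)[OF V] path(1)[OF W] _ b(3) in_s this]
    have off: "\<phi> (hd (\<sigma> V)) \<notin> loop {u, v} (path W)" "\<phi> (hd (\<sigma> W)) \<notin> loop {u, v} (path V)"
    proof -
      have "connected_component (- loop {u, v} (path W)) (\<phi> (hd (\<sigma> V))) (\<phi> (hd (\<sigma> V)))"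
        using q[OF V] V VW wallP[OF V] by (intro same[OF W, of V]) (auto simp: wall_def)
      then show "\<phi> (hd (\<sigma> V)) \<notin> loop {u, v} (path W)"
        using connected_component_in(1) by fastforce
      have "connected_component (- loop {u, v} (path V)) (\<phi> (hd (\<sigma> W))) (\<phi> (hd (\<sigma> W)))"
        using q[OF W] W VW wallP[OF W] by (intro same[OF V, of W]) (auto simp: wall_def)
      then show "\<phi> (hd (\<sigma> W)) \<notin> loop {u, v} (path V)"
        using connected_component_in(1) by fastforce
    qed
    have side: "connected_component (- loop {u, v} xs) z w \<or> connected_component (- loop {u, v} xs) z' w"
      if "bridge u v xs" "w \<notin> loop {u, v} xs" for xs w
      using loop_Jordan[OF uv that(1)] Jordan_same_side z[OF that(1)] that(2) by metis
    show False
    proof (cases "lab V W")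
      case True
      then show False
        using theta[of z z'] eq z[OF path(1)[OF V]] z[OF path(1)[OF W]] a(3) unfolding lab_def by simp
    next
      \<comment> \<open>There are only two sides, so each wall is on the \<open>z'\<close>-side of
        the other's loop, and the previous argument applies with \<open>z\<close> and
        \<open>z'\<close> exchanged.\<close>
      case False
      then have "connected_component (- loop {u, v} (path W)) z' (\<phi> (hd (\<sigma> V)))"
          "connected_component (- loop {u, v} (path V)) z' (\<phi> (hd (\<sigma> W)))"
        using side[OF path(1)[OF W] off(1)] side[OF path(1)[OF V] off(2)] eq unfolding lab_def by auto
      then show False
        using theta[of z' z] z[OF path(1)[OF V]] z[OF path(1)[OF W]] a(3)
          connected_component_sym[of _ z' z] by auto
    qed
  qed
  show thesis
    using that[of lab] 1 2 by blast
qed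

end

section \<open>Breadth-first levels of strings\<close>

text \<open>A node is a string together with one of its points. Moves along a string and changes of
  string at a point are kept apart because only the latter count as steps between strings. In a
  smaller node set \<open>X\<close> a string may fall into several fragments.\<close>

definition same_string :: "('p \<times> 'p) set \<Rightarrow> ('v \<times> 'p) set \<Rightarrow> (('v \<times> 'p) \<times> ('v \<times> 'p)) set" where
  "same_string E X = {((v, p), (v, q)) | v p q. (v, p) \<in> X \<and> (v, q) \<in> X \<and> (p, q) \<in> E}"

definition same_point :: "('v \<times> 'p) set \<Rightarrow> (('v \<times> 'p) \<times> ('v \<times> 'p)) set" where
  "same_point X = {((u, p), (v, p)) | u v p. (u, p) \<in> X \<and> (v, p) \<in> X \<and> u \<noteq> v}"

abbreviation joined :: "('p \<times> 'p) set \<Rightarrow> ('v \<times> 'p) set \<Rightarrow> (('v \<times> 'p) \<times> ('v \<times> 'p)) set" where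
  "joined E X \<equiv> (same_string E X \<union> same_point X)\<^sup>*"

text \<open>Breadth-first distance levels, for every component starting with one fragment at level 1;
  moving within a fragment is free.\<close>

definition layering :: "('p \<times> 'p) set \<Rightarrow> ('v \<times> 'p) set \<Rightarrow> ('v \<times> 'p \<Rightarrow> nat) \<Rightarrow> bool" where
  "layering E X d \<longleftrightarrow>
     (\<forall>x\<in>X. 1 \<le> d x) \<and>
     (\<forall>x y. (x, y) \<in> same_string E X \<longrightarrow> d x = d y) \<and>
     (\<forall>x y. (x, y) \<in> same_point X \<longrightarrow> d x \<le> d y + 1) \<and>
     (\<forall>x\<in>X. 1 < d x \<longrightarrow>
        (\<exists>x' y. (x, x') \<in> (same_string E X)\<^sup>* \<and> (x', y) \<in> same_point X \<and> d x = d y + 1)) \<and>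
     (\<forall>x\<in>X. \<forall>y\<in>X. d x = 1 \<longrightarrow> d y = 1 \<longrightarrow> (x, y) \<in> joined E X \<longrightarrow> (x, y) \<in> (same_string E X)\<^sup>*)"

lemma sym_same_string: "sym E \<Longrightarrow> sym (same_string E X)"
  by (auto simp: sym_def same_string_def)

lemma sym_same_point: "sym (same_point X)"
  by (auto simp: sym_def same_point_def)

lemma sym_joined: "sym E \<Longrightarrow> sym (joined E X)"
  by (intro sym_rtrancl sym_Un sym_same_string sym_same_point)

lemma same_string_in: "(x, y) \<in> same_string E X \<Longrightarrow> x \<in> X \<and> y \<in> X"
  by (auto simp: same_string_def)

lemma same_point_in: "(x, y) \<in> same_point X \<Longrightarrow> x \<in> X \<and> y \<in> X"
  by (auto simp: same_point_def)

lemma same_string_rtrancl: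
  assumes "(x, y) \<in> (same_string E X)\<^sup>*" "x \<in> X"
  shows "y \<in> X \<and> fst y = fst x"
  using assms by (induction rule: rtrancl_induct) (auto simp: same_string_def)

lemma joined_in: "(x, y) \<in> joined E X \<Longrightarrow> x \<in> X \<Longrightarrow> y \<in> X"
  by (induction rule: rtrancl_induct) (auto simp: same_string_def same_point_def)

lemma same_string_joined: "(x, y) \<in> (same_string E X)\<^sup>* \<Longrightarrow> (x, y) \<in> joined E X"
  using rtrancl_mono[of "same_string E X" "same_string E X \<union> same_point X"] by blast

lemma joined_sym: "sym E \<Longrightarrow> (x, y) \<in> joined E X \<Longrightarrow> (y, x) \<in> joined E X"
  using sym_joined[of E X] by (rule symD)

lemma joined_string: "(x, y) \<in> joined E X \<Longrightarrow> (y, z) \<in> (same_string E X)\<^sup>* \<Longrightarrow> (x, z) \<in> joined E X"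
  by (rule rtrancl_trans[OF _ same_string_joined])

lemma joined_point: "(x, y) \<in> joined E X \<Longrightarrow> (y, z) \<in> same_point X \<Longrightarrow> (x, z) \<in> joined E X"
  by (erule rtrancl_into_rtrancl) (rule UnI2)

lemma joined_induct [consumes 2, case_names base string point]:
  assumes "(x, y) \<in> joined E X" "x \<in> X" "Q x"
    and "\<And>y z. (x, y) \<in> joined E X \<Longrightarrow> Q y \<Longrightarrow> (y, z) \<in> same_string E X \<Longrightarrow> Q z"
    and "\<And>y z. (x, y) \<in> joined E X \<Longrightarrow> Q y \<Longrightarrow> (y, z) \<in> same_point X \<Longrightarrow> Q z"
  shows "Q y"
  using assms(1) by (induction rule: rtrancl_induct) (use assms in blast)+

definition fragment :: "('p \<times> 'p) set \<Rightarrow> ('v \<times> 'p) set \<Rightarrow> 'v \<times> 'p \<Rightarrow> 'p set" where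
  "fragment E X x = {p. (x, (fst x, p)) \<in> (same_string E X)\<^sup>*}"

lemma fragment_self: "snd x \<in> fragment E X x"
  by (simp add: fragment_def)

lemma same_string_fragment:
  assumes "(x, y) \<in> (same_string E X)\<^sup>*" "x \<in> X"
  shows "snd y \<in> fragment E X x \<and> y = (fst x, snd y)"
  using assms same_string_rtrancl[OF assms] by (metis (mono_tags, lifting) fragment_def mem_Collect_eq prod.collapse)

lemma linked_fragment:
  assumes "sym E" "x \<in> X"
  shows "linked E (fragment E X x)"
proof (rule linkedI_root[OF assms(1)])
  fix q assume "q \<in> fragment E X x"
  then have "(x, (fst x, q)) \<in> (same_string E X)\<^sup>*"
    by (simp add: fragment_def)
  then have "snd (fst x, q) \<in> fragment E X x \<and> (snd x, snd (fst x, q)) \<in> (E \<inter> fragment E X x \<times> fragment E X x)\<^sup>*"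
  proof (induction rule: rtrancl_induct)
    case base
    then show ?case by (simp add: fragment_self)
  next
    case (step y z)
    then have "(x, z) \<in> (same_string E X)\<^sup>*"
      by auto
    then have "snd z \<in> fragment E X x"
      using same_string_fragment assms(2) by metis
    moreover have "(snd y, snd z) \<in> E"
      using step by (auto simp: same_string_def)
    ultimately show ?case
      using step by (auto intro: rtrancl_into_rtrancl)
  qed
  then have "(snd x, q) \<in> (E \<inter> fragment E X x \<times> fragment E X x)\<^sup>*"
    by simp
  moreover have "sym ((E \<inter> fragment E X x \<times> fragment E X x)\<^sup>*)"
    using assms(1) by (intro sym_rtrancl) (auto simp: sym_def)
  ultimately show "(q, snd x) \<in> (E \<inter> fragment E X x \<times> fragment E X x)\<^sup>*"
    by (metis symD)
qed

locale layered =
  fixes E :: "('p \<times> 'p) set" and X :: "('v \<times> 'p) set" and d :: "'v \<times> 'p \<Rightarrow> nat"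
  assumes sym_E: "sym E" and layering: "layering E X d"
begin

lemma level_pos: "x \<in> X \<Longrightarrow> 1 \<le> d x"
  and level_string: "(x, y) \<in> same_string E X \<Longrightarrow> d x = d y"
  and level_point: "(x, y) \<in> same_point X \<Longrightarrow> d x \<le> d y + 1"
  and level_down: "x \<in> X \<Longrightarrow> 1 < d x \<Longrightarrow>
      \<exists>x' y. (x, x') \<in> (same_string E X)\<^sup>* \<and> (x', y) \<in> same_point X \<and> d x = d y + 1"
  and level_root: "x \<in> X \<Longrightarrow> y \<in> X \<Longrightarrow> d x = 1 \<Longrightarrow> d y = 1 \<Longrightarrow> (x, y) \<in> joined E X \<Longrightarrow>
      (x, y) \<in> (same_string E X)\<^sup>*"
  using layering unfolding layering_def by blast+

lemma level_point': "(x, y) \<in> same_point X \<Longrightarrow> d y \<le> d x + 1"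
  using level_point sym_same_point by (metis symD)

lemma level_strings: "(x, y) \<in> (same_string E X)\<^sup>* \<Longrightarrow> d x = d y"
  by (induction rule: rtrancl_induct) (auto dest: level_string)

lemma level_fragment:
  assumes "x \<in> X" "p \<in> fragment E X x"
  shows "(fst x, p) \<in> X \<and> d (fst x, p) = d x"
proof -
  have "(x, (fst x, p)) \<in> (same_string E X)\<^sup>*"
    using assms(2) by (simp add: fragment_def)
  then show ?thesis
    using level_strings same_string_rtrancl assms(1) by metis
qed

lemma level_down_joined:
  assumes "(x0, x) \<in> joined E X" "x \<in> X" "1 < d x"
  obtains x' y where "(x, x') \<in> (same_string E X)\<^sup>*" "(x', y) \<in> same_point X" "d x = d y + 1"
    "(x0, y) \<in> joined E X" "x' \<in> X" "y \<in> X" "fst x' = fst x" "snd x' = snd y" "d x' = d x"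
proof -
  obtain x' y where y: "(x, x') \<in> (same_string E X)\<^sup>*" "(x', y) \<in> same_point X" "d x = d y + 1"
    using level_down[OF assms(2,3)] by blast
  moreover have "snd x' = snd y"
    using y(2) by (auto simp: same_point_def)
  ultimately show thesis
    using that[OF y joined_point[OF joined_string[OF assms(1) y(1)] y(2)]] same_point_in[OF y(2)]
      same_string_rtrancl[OF y(1) assms(2)] level_strings[OF y(1)] by simp
qed

lemma level_induct [consumes 2, case_names root down]:
  assumes "(x0, x) \<in> joined E X" "x \<in> X"
    and root: "\<And>x. (x0, x) \<in> joined E X \<Longrightarrow> x \<in> X \<Longrightarrow> d x = 1 \<Longrightarrow> Q x"
    and down: "\<And>x x' y. (x0, x) \<in> joined E X \<Longrightarrow> x \<in> X \<Longrightarrow> (x, x') \<in> (same_string E X)\<^sup>* \<Longrightarrow>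
      (x', y) \<in> same_point X \<Longrightarrow> d x = d y + 1 \<Longrightarrow> fst x' = fst x \<Longrightarrow> snd x' = snd y \<Longrightarrow> (x0, y) \<in> joined E X \<Longrightarrow>
      y \<in> X \<Longrightarrow> Q y \<Longrightarrow> Q x"
  shows "Q x"
  using assms(1,2)
proof (induction "d x" arbitrary: x rule: less_induct)
  case less
  show ?case
  proof (cases "d x = 1")
    case True
    then show ?thesis
      using root less.prems by blast
  next
    case False
    then have "1 < d x"
      using level_pos[OF less.prems(2)] by simp
    then obtain x' y where y: "(x, x') \<in> (same_string E X)\<^sup>*" "(x', y) \<in> same_point X" "d x = d y + 1"
      "(x0, y) \<in> joined E X" "x' \<in> X" "y \<in> X" "fst x' = fst x" "snd x' = snd y" "d x' = d x"
      using level_down_joined[OF less.prems] by blast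
    then show ?thesis
      using down[OF less.prems y(1,2,3,7,8,4,6)] less.hyps[of y] by simp
  qed
qed

text \<open>From every node one can descend, without ever rising, to a fragment of level 1, and a
  component has only one such fragment. This provides the connected regions needed for
  walls.\<close>

lemma levels_linked:
  "linked E (snd ` {x \<in> X. d x \<le> k \<and> (x0, x) \<in> joined E X})"
proof -
  let ?Y = "{x \<in> X. d x \<le> k \<and> (x0, x) \<in> joined E X}"
  let ?P = "snd ` ?Y"
  let ?R = "(E \<inter> ?P \<times> ?P)\<^sup>*"
  have string: "(snd x, snd y) \<in> ?R" if x: "x \<in> X" "d x \<le> k" "(x0, x) \<in> joined E X"
    and "(x, y) \<in> (same_string E X)\<^sup>*" for x y
    using that(4)
  proof (induction rule: rtrancl_induct)
    case (step y z)
    have "w \<in> ?Y" if "(x, w) \<in> (same_string E X)\<^sup>*" for w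
      using x level_strings[OF that] joined_string[OF x(3) that] same_string_rtrancl[OF that x(1)] by simp
    then have "y \<in> ?Y" "z \<in> ?Y"
      using step(1) rtrancl_into_rtrancl[OF step(1,2)] by blast+
    moreover have "(snd y, snd z) \<in> E"
      using step(2) by (auto simp: same_string_def)
    ultimately have "(snd y, snd z) \<in> E \<inter> ?P \<times> ?P"
      by blast
    with step.IH show ?case
      by (rule rtrancl_into_rtrancl)
  qed simp
  have down: "\<exists>r\<in>X. d r = 1 \<and> (x0, r) \<in> joined E X \<and> (d x \<le> k \<longrightarrow> (snd x, snd r) \<in> ?R)"
    if "(x0, x) \<in> joined E X" "x \<in> X" for x
    using that
  proof (induction rule: level_induct)
    case (root x)
    then show ?case by blast
  next
    case (down x x' y)
    then obtain r where "r \<in> X" "d r = 1" "(x0, r) \<in> joined E X" "d y \<le> k \<longrightarrow> (snd y, snd r) \<in> ?R"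
      by blast
    moreover have "(snd x, snd y) \<in> ?R" if "d x \<le> k"
      using string[OF down(2) that down(1,3)] down(7) by simp
    ultimately show ?case
      using down(5) rtrancl_trans[of "snd x" "snd y"] by (intro bexI[of _ r]) auto
  qed
  have "(p, q) \<in> ?R" if "p \<in> ?P" "q \<in> ?P" for p q
  proof -
    obtain x y where xy: "x \<in> X" "d x \<le> k" "(x0, x) \<in> joined E X" "p = snd x"
        "y \<in> X" "d y \<le> k" "(x0, y) \<in> joined E X" "q = snd y"
      using \<open>p \<in> ?P\<close> \<open>q \<in> ?P\<close> by blast
    obtain r s where r: "r \<in> X" "d r = 1" "(x0, r) \<in> joined E X" "(p, snd r) \<in> ?R"
      and s: "s \<in> X" "d s = 1" "(x0, s) \<in> joined E X" "(q, snd s) \<in> ?R"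
      using down[OF xy(3,1)] down[OF xy(7,5)] xy by blast
    have "(r, s) \<in> (same_string E X)\<^sup>*"
      by (rule level_root[OF r(1) s(1) r(2) s(2) rtrancl_trans[OF joined_sym[OF sym_E r(3)] s(3)]])
    moreover have "d r \<le> k"
      using r(2) xy level_pos[of x] by simp
    ultimately have rs: "(snd r, snd s) \<in> ?R"
      using string[OF r(1) _ r(3)] by blast
    have "sym ?R"
      using sym_E by (intro sym_rtrancl) (auto simp: sym_def)
    then have "(snd s, q) \<in> ?R"
      using s(4) by (rule symD)
    then show ?thesis
      using r(4) rs by (meson rtrancl_trans)
  qed
  then show ?thesis
    unfolding linked_def by blast
qed

text \<open>Only a change of string uses a step of \<open>R\<close>, and each of the chosen changes
  lowers the level by one.\<close>

lemma descent:
  assumes "\<And>x y. (x, y) \<in> same_point X \<Longrightarrow> (fst x, fst y) \<in> R" "x \<in> X"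
  shows "\<exists>y\<in>X. d y = 1 \<and> (fst x, fst y) \<in> R ^^ (d x - 1) \<and> (x, y) \<in> joined E X"
  using rtrancl_refl[of x] assms(2)
proof (induction rule: level_induct)
  case (root y)
  then show ?case by (intro bexI[of _ y]) auto
next
  case (down y y' z)
  then obtain w where w: "w \<in> X" "d w = 1" "(fst z, fst w) \<in> R ^^ (d z - 1)" "(z, w) \<in> joined E X"
    by blast
  have "(fst y, fst z) \<in> R"
    using assms(1)[OF down(4)] down(6) by simp
  then have "(fst y, fst w) \<in> R ^^ Suc (d z - 1)"
    using w(3) by (rule relpow_Suc_I2)
  moreover have "Suc (d z - 1) = d y - 1"
    using down(5) level_pos[OF down(9)] by simp
  moreover have "(y, w) \<in> joined E X"
    by (rule rtrancl_trans[OF joined_point[OF same_string_joined[OF down(3)] down(4)] w(4)])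
  ultimately show ?case
    using w(1,2) by (metis (no_types, lifting))
qed

lemma relpow_sym: "sym R \<Longrightarrow> (x, y) \<in> R ^^ n \<Longrightarrow> (y, x) \<in> R ^^ n"
proof (induction n arbitrary: x)
  case (Suc n)
  then show ?case
    by (metis relpow_Suc_D2 relpow_Suc_I symD)
qed simp

text \<open>Descend from both ends to the common root string, \<open>d x - 1\<close> steps each, and
  cross the edge. Without short odd closed walks, an edge inside a level therefore puts this level
  far from the root.\<close>

lemma level_edge_odd_walk:
  assumes R: "\<And>x y. (x, y) \<in> same_point X \<Longrightarrow> (fst x, fst y) \<in> R" and "sym R"
    and "x \<in> X" "y \<in> X" "(x, y) \<in> joined E X" "d x = d y" "(fst x, fst y) \<in> R"
  shows "(fst x, fst x) \<in> R ^^ (2 * d x - 1)"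
proof -
  obtain x' where x': "x' \<in> X" "d x' = 1" "(fst x, fst x') \<in> R ^^ (d x - 1)" "(x, x') \<in> joined E X"
    using descent[of R x] R assms(3) by blast
  obtain y' where y': "y' \<in> X" "d y' = 1" "(fst y, fst y') \<in> R ^^ (d y - 1)" "(y, y') \<in> joined E X"
    using descent[of R y] R assms(4) by blast
  have "(x', y') \<in> joined E X"
    by (rule rtrancl_trans[OF joined_sym[OF sym_E x'(4)] rtrancl_trans[OF assms(5) y'(4)]])
  then have "fst x' = fst y'"
    using level_root[OF x'(1) y'(1) x'(2) y'(2)] same_string_rtrancl x'(1) by metis
  moreover have "(fst y', fst y) \<in> R ^^ (d y - 1)"
    by (rule relpow_sym[OF \<open>sym R\<close> y'(3)])
  ultimately have "(fst x, fst y) \<in> R ^^ (d x - 1 + (d y - 1))"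
    using x'(3) by (auto simp: relpow_add)
  moreover have "(fst y, fst x) \<in> R"
    using assms(7) \<open>sym R\<close> by (metis symD)
  ultimately have "(fst x, fst x) \<in> R ^^ Suc (d x - 1 + (d y - 1))"
    by (rule relpow_Suc_I)
  moreover have "Suc (d x - 1 + (d y - 1)) = 2 * d x - 1"
    using assms(6) level_pos[OF assms(3)] by simp
  ultimately show ?thesis
    by (rule back_subst[of "\<lambda>n. (fst x, fst x) \<in> R ^^ n"])
qed

end

section \<open>Two nested layerings of a string representation\<close>

definition nodes :: "'v set \<Rightarrow> ('v \<Rightarrow> 'p set) \<Rightarrow> ('v \<times> 'p) set" where
  "nodes A S = {(v, p). v \<in> A \<and> p \<in> S v}"

definition conflict :: "'v set \<Rightarrow> ('v \<Rightarrow> 'p set) \<Rightarrow> ('v \<times> 'v) set" where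
  "conflict A S = {(u, v). u \<in> A \<and> v \<in> A \<and> u \<noteq> v \<and> S u \<inter> S v \<noteq> {}}"

text \<open>All strings of the levels of the given parity, together with the parts of the other strings
  outside the strings of the level above (that is, closer to the root).\<close>

definition exposed :: "('v \<times> 'p) set \<Rightarrow> ('v \<times> 'p \<Rightarrow> nat) \<Rightarrow> bool \<Rightarrow> ('v \<times> 'p) set" where
  "exposed X L a = {x \<in> X. odd (L x) = a \<or> (\<forall>u. (u, snd x) \<in> X \<longrightarrow> L (u, snd x) + 1 \<noteq> L x)}"

lemma sym_conflict: "sym (conflict A S)"
  by (auto simp: sym_def conflict_def)

lemma same_point_conflict:
  "X \<subseteq> nodes A S \<Longrightarrow> (x, y) \<in> same_point X \<Longrightarrow> (fst x, fst y) \<in> conflict A S"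
  by (fastforce simp: same_point_def nodes_def conflict_def)

lemma same_string_mono: "X \<subseteq> Y \<Longrightarrow> same_string E X \<subseteq> same_string E Y"
  by (auto simp: same_string_def)

lemma same_point_mono: "X \<subseteq> Y \<Longrightarrow> same_point X \<subseteq> same_point Y"
  by (auto simp: same_point_def)

lemma joined_mono: "X \<subseteq> Y \<Longrightarrow> joined E X \<subseteq> joined E Y"
  by (intro rtrancl_mono Un_mono same_string_mono same_point_mono)

lemma whole_string:
  assumes "linked E (S v)" "\<And>q. q \<in> S v \<Longrightarrow> (v, q) \<in> X" "p \<in> S v" "q \<in> S v"
  shows "((v, p), (v, q)) \<in> (same_string E X)\<^sup>*"
proof -
  have "(p, q) \<in> (E \<inter> S v \<times> S v)\<^sup>*"
    using assms unfolding linked_def by blast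
  then show ?thesis
  proof (induction rule: rtrancl_induct)
    case (step y z)
    then have "((v, y), (v, z)) \<in> same_string E X"
      using assms(2) by (auto simp: same_string_def)
    with step.IH show ?case
      by (rule rtrancl_into_rtrancl)
  qed simp
qed

locale string_plane = plane_graph P \<phi> \<gamma>
  for P :: "'p pair_pre_digraph" and \<phi> :: "'p \<Rightarrow> complex" and \<gamma> :: "'p set \<Rightarrow> real \<Rightarrow> complex" +
  fixes A :: "'v set" and S :: "'v \<Rightarrow> 'p set" and L M :: "'v \<times> 'p \<Rightarrow> nat" and a :: bool
  assumes linked_S: "v \<in> A \<Longrightarrow> linked (parcs P) (S v)"
    and no_short: "odd l \<Longrightarrow> l \<le> 11 \<Longrightarrow> (v, v) \<notin> conflict A S ^^ l"
    and layering_L: "layering (parcs P) (nodes A S) L"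
    and layering_M: "layering (parcs P) (exposed (nodes A S) L a) M"
begin

abbreviation "E \<equiv> parcs P"
abbreviation "X1 \<equiv> nodes A S"
abbreviation "X2 \<equiv> exposed X1 L a"
abbreviation "R \<equiv> conflict A S"

sublocale l1: layered E X1 L
  using layering_L sym_adj by unfold_locales

sublocale l2: layered E X2 M
  using layering_M sym_adj by unfold_locales

lemma X2_X1: "x \<in> X2 \<Longrightarrow> x \<in> X1"
  by (auto simp: exposed_def)

lemma X2_sub: "X2 \<subseteq> X1"
  by (auto simp: exposed_def)

lemma L_string: "(v, p) \<in> X1 \<Longrightarrow> (v, q) \<in> X1 \<Longrightarrow> L (v, p) = L (v, q)"
  by (rule l1.level_strings, rule whole_string) (auto simp: nodes_def linked_S)

lemma string_X2:
  assumes "(v, p) \<in> X1" "odd (L (v, p)) = a" "q \<in> S v"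
  shows "(v, q) \<in> X2"
proof -
  have "(v, q) \<in> X1"
    using assms by (auto simp: nodes_def)
  then show ?thesis
    using L_string[of v q p] assms by (auto simp: exposed_def)
qed

end

text \<open>The base node \<open>b\<close> selects one component of the exposed nodes.
  \<open>3 \<le> i\<close> leaves levels up to \<open>i - 2\<close> for the inner region;
  \<open>5 \<le> j\<close> leaves a level \<open>j - 4\<close>, where the contact of the two regions
  is found.\<close>

locale string_component = string_plane P \<phi> \<gamma> A S L M a
  for P :: "'p pair_pre_digraph" and \<phi> :: "'p \<Rightarrow> complex" and \<gamma> :: "'p set \<Rightarrow> real \<Rightarrow> complex"
    and A :: "'v set" and S :: "'v \<Rightarrow> 'p set" and L M :: "'v \<times> 'p \<Rightarrow> nat" and a :: bool +
  fixes b :: "'v \<times> 'p" and i j :: nat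
  assumes b: "b \<in> X2" "L b = i" "odd i = a" and i: "3 \<le> i" and j: "5 \<le> j"
begin

definition inner :: "'p set" where
  "inner = snd ` {x \<in> X1. L x \<le> i - 2 \<and> (b, x) \<in> joined E X1}"

text \<open>A wall of a string at level \<open>j\<close> descends through level \<open>j - 1\<close>
  and part of level \<open>j - 2\<close>; it ends next to a node of level
  \<open>j - 3\<close>.\<close>

definition near_root :: "'p set" where
  "near_root = snd ` {x \<in> X2. M x \<le> j - 3 \<and> (b, x) \<in> joined E X2}"

definition comp :: "('v \<times> 'p) set" where
  "comp = {x. (b, x) \<in> joined E X2}"

lemma comp_X2: "x \<in> comp \<Longrightarrow> x \<in> X2"
  unfolding comp_def by (rule joined_in[OF _ b(1)]) simp

lemma comp_X1: "x \<in> comp \<Longrightarrow> x \<in> X1 \<and> (b, x) \<in> joined E X1"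
  using comp_X2[of x] X2_X1[of x] joined_mono[OF X2_sub] unfolding comp_def by blast

lemma comp_string: "x \<in> comp \<Longrightarrow> (x, y) \<in> (same_string E X2)\<^sup>* \<Longrightarrow> y \<in> comp"
  unfolding comp_def using joined_string by blast

lemma comp_point: "x \<in> comp \<Longrightarrow> (x, y) \<in> same_point X2 \<Longrightarrow> y \<in> comp"
  unfolding comp_def using joined_point by blast

text \<open>A node of level \<open>i + 1\<close> has the wrong parity, and one that shares its point
  with level \<open>i\<close> is not exposed; so the component cannot enter level
  \<open>i + 1\<close>. It cannot reach level \<open>i - 2\<close> either, as that would cover the
  exposed node of level \<open>i - 1\<close> from which it came.\<close>

lemma comp_level:
  assumes "x \<in> comp"
  shows "L x = i \<or> L x + 1 = i \<and> (\<forall>u. (u, snd x) \<in> X1 \<longrightarrow> L (u, snd x) + 1 \<noteq> L x)"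
proof -
  have "(b, x) \<in> joined E X2"
    using assms by (simp add: comp_def)
  then show ?thesis
  proof (induction rule: joined_induct[OF _ b(1), consumes 1, case_names base string point])
    case base
    then show ?case by (simp add: b)
  next
    case (string y z)
    have "z \<in> X2" "(y, z) \<in> same_string E X1"
      using string.hyps(2) same_string_in same_string_mono[OF X2_sub] by blast+
    then have "L z = L y"
      using l1.level_string by metis
    moreover have "odd (L z) \<noteq> a \<Longrightarrow> \<forall>u. (u, snd z) \<in> X1 \<longrightarrow> L (u, snd z) + 1 \<noteq> L z"
      using \<open>z \<in> X2\<close> by (auto simp: exposed_def)
    moreover have "L y + 1 = i \<Longrightarrow> odd (L y) \<noteq> odd i"
      by auto
    ultimately show ?case
      using string.IH b(3) by metis
  next
    case (point y z)
    have z: "z \<in> X2" "y \<in> X2" "(y, z) \<in> same_point X1"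
      using point.hyps(2) same_point_in same_point_mono[OF X2_sub] by blast+
    then have le: "L z \<le> L y + 1" "L y \<le> L z + 1"
      using l1.level_point l1.level_point' by blast+
    have yz: "(fst y, snd z) \<in> X1" "(fst z, snd y) \<in> X1" "(fst y, snd z) = y" "(fst z, snd y) = z"
      using z(3) by (auto simp: same_point_def)
    have "odd (L z) \<noteq> a \<Longrightarrow> \<forall>u. (u, snd z) \<in> X1 \<longrightarrow> L (u, snd z) + 1 \<noteq> L z"
      using \<open>z \<in> X2\<close> by (auto simp: exposed_def)
    then have "odd (L z) \<noteq> a \<Longrightarrow> L y + 1 \<noteq> L z \<and> (\<forall>u. (u, snd z) \<in> X1 \<longrightarrow> L (u, snd z) + 1 \<noteq> L z)"
      using yz by metis
    moreover have "L y = i \<or> L y + 1 = i \<and> L z + 1 \<noteq> L y"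
      using point.IH yz by metis
    moreover have "L z = L y \<or> L z = L y + 1 \<or> L y = L z + 1"
      using le by linarith
    ultimately show ?case
      using b(3) by (elim disjE) auto
  qed
qed

text \<open>Levels at one point differ by at most one, which settles level \<open>i\<close>; an
  exposed node of level \<open>i - 1\<close> has no node of level \<open>i - 2\<close> at its
  point.\<close>

lemma comp_not_inner:
  assumes "x \<in> comp"
  shows "snd x \<notin> inner"
proof
  assume "snd x \<in> inner"
  then obtain z where z: "z \<in> X1" "L z \<le> i - 2" "snd z = snd x"
    by (auto simp: inner_def)
  have x: "x \<in> X1" "L x = i \<or> L x + 1 = i \<and> (\<forall>u. (u, snd x) \<in> X1 \<longrightarrow> L (u, snd x) + 1 \<noteq> L x)"
    using comp_X1 comp_level assms by blast+
  then have "z \<noteq> x"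
    using z i by auto
  then have "(x, z) \<in> same_point X1"
    using x(1) z by (cases x; cases z) (auto simp: same_point_def)
  then have "L x \<le> L z + 1"
    by (rule l1.level_point)
  moreover have "(fst z, snd x) = z"
    using z(3) by (metis prod.collapse)
  then have "(fst z, snd x) \<in> X1" "L (fst z, snd x) = L z"
    using z(1) by simp_all
  then have "L x + 1 = i \<Longrightarrow> L z + 1 \<noteq> L x"
    using x(2) by force
  ultimately show False
    using x(2) z(2) i by linarith
qed

lemma fragment_comp: "x \<in> comp \<Longrightarrow> p \<in> fragment E X2 x \<Longrightarrow> (fst x, p) \<in> comp"
  unfolding fragment_def using comp_string by blast

text \<open>Again levels at one point differ by at most one, so level \<open>j - 1\<close> is just
  high enough to avoid all points of levels up to \<open>j - 3\<close>.\<close>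

lemma comp_not_near_root:
  assumes "x \<in> comp" "j \<le> M x + 1"
  shows "snd x \<notin> near_root"
proof
  assume "snd x \<in> near_root"
  then obtain z where z: "z \<in> X2" "M z \<le> j - 3" "snd z = snd x"
    by (auto simp: near_root_def)
  then have "z \<noteq> x"
    using assms(2) j by auto
  then have "(x, z) \<in> same_point X2"
    using comp_X2[OF assms(1)] z by (cases x; cases z) (auto simp: same_point_def)
  then have "M x \<le> M z + 1"
    by (rule l2.level_point)
  then show False
    using z(2) assms(2) j by auto
qed

text \<open>The string of \<open>x\<close> has a point in the inner region. On the way there along
  the string, the first point outside the fragment is not exposed, so it is covered from level
  \<open>i - 2\<close> and already lies in the inner region.\<close>

lemma fragment_inner:
  assumes x: "x \<in> comp" "L x + 1 = i"
  shows "\<exists>p\<in>fragment E X2 x. \<exists>q\<in>inner. adj p q"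
proof -
  have xX: "x \<in> X1" "(b, x) \<in> joined E X1" "x \<in> X2"
    using comp_X1 comp_X2 x by blast+
  obtain x' y where y: "(x', y) \<in> same_point X1" "L x = L y + 1" "(b, y) \<in> joined E X1" "x' \<in> X1"
      "y \<in> X1" "fst x' = fst x" "snd x' = snd y"
  proof -
    have "1 < L x"
      using x i by simp
    then show thesis
      using l1.level_down_joined[OF xX(2,1)] that by metis
  qed
  let ?S = "S (fst x)" and ?F = "fragment E X2 x"
  have "snd y \<in> inner"
    using y x unfolding inner_def by force
  then have "snd y \<notin> ?F"
    using fragment_comp[OF x(1)] comp_not_inner by fastforce
  moreover have S: "snd x \<in> ?S" "snd y \<in> ?S" "fst x \<in> A"
    using xX y by (auto simp: nodes_def)
  ultimately obtain p q where pq: "(p, q) \<in> E" "p \<in> ?S" "q \<in> ?S" "p \<in> ?F" "q \<notin> ?F"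
    using linked_exit[OF linked_S, of "fst x" "snd x" ?F "snd y"] fragment_self by metis
  have "(fst x, p) \<in> X2"
    using fragment_comp[OF x(1) pq(4)] by (rule comp_X2)
  have qX: "(fst x, q) \<in> X1"
    using pq S by (simp add: nodes_def)
  have "(fst x, q) \<notin> X2"
  proof
    assume "(fst x, q) \<in> X2"
    then have "((fst x, p), (fst x, q)) \<in> same_string E X2"
      using pq \<open>(fst x, p) \<in> X2\<close> by (simp add: same_string_def)
    then show False
      using pq(4,5) unfolding fragment_def by (simp add: rtrancl_into_rtrancl)
  qed
  then obtain u where u: "(u, q) \<in> X1" "L (u, q) + 1 = L (fst x, q)"
    using qX by (auto simp: exposed_def)
  have "L (fst x, q) = L x"
    using L_string[of "fst x" q "snd x"] qX xX by simp
  moreover have "(b, (u, q)) \<in> joined E X1"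
  proof (rule joined_point[OF joined_string[OF xX(2)]])
    show "(x, (fst x, q)) \<in> (same_string E X1)\<^sup>*"
      using whole_string[of E S "fst x" X1 "snd x" q] S pq linked_S by (auto simp: nodes_def)
    show "((fst x, q), (u, q)) \<in> same_point X1"
      using u qX by (auto simp: same_point_def)
  qed
  ultimately have "q \<in> inner"
    using u x i unfolding inner_def by force
  then show ?thesis
    using pq by blast
qed

text \<open>The predecessor of \<open>x\<close> in \<open>L\<close> is exposed: a string of level
  \<open>i - 2\<close> at its point would meet the string of level \<open>i\<close> there. Hence the
  step down stays in the component.\<close>

lemma lower_neighbour:
  assumes "x \<in> comp" "L x = i"
  shows "\<exists>p y. (x, (fst x, p)) \<in> (same_string E X2)\<^sup>* \<and> ((fst x, p), y) \<in> same_point X2 \<and> y \<in> comp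
    \<and> L y + 1 = i \<and> snd y = p \<and> p \<in> S (fst x) \<and> (fst x, fst y) \<in> R"
proof -
  have xX: "x \<in> X1" "(b, x) \<in> joined E X1" "x \<in> X2"
    using comp_X1 comp_X2 assms by blast+
  obtain x' y where y: "(x', y) \<in> same_point X1" "L x = L y + 1" "x' \<in> X1" "y \<in> X1" "fst x' = fst x"
      "snd x' = snd y" "L x' = L x"
  proof -
    have "1 < L x"
      using assms i by simp
    then show thesis
      using l1.level_down_joined[OF xX(2,1)] that by metis
  qed
  let ?p = "snd y"
  have x': "x' = (fst x, ?p)"
    using y by (metis prod.collapse)
  have S: "snd x \<in> S (fst x)" "?p \<in> S (fst x)" "fst x \<in> A"
    using xX y x' by (auto simp: nodes_def)
  have all: "(fst x, q) \<in> X2" if "q \<in> S (fst x)" for q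
    using string_X2[of "fst x" "snd x" q] xX assms b(3) that by simp
  have str: "(x, (fst x, ?p)) \<in> (same_string E X2)\<^sup>*"
    using whole_string[of E S "fst x" X2 "snd x" ?p] all S linked_S by simp
  moreover have "y \<in> X2"
  proof -
    have "L (u, ?p) + 1 \<noteq> L y" if u: "(u, ?p) \<in> X1" for u
    proof
      assume *: "L (u, ?p) + 1 = L y"
      then have "u \<noteq> fst x"
        using y(2,7) x' by auto
      then have "(x', (u, ?p)) \<in> same_point X1"
        using u y(3) x' by (auto simp: same_point_def)
      then have "L x' \<le> L (u, ?p) + 1"
        by (rule l1.level_point)
      then show False
        using * y by simp
    qed
    then show ?thesis
      using y by (auto simp: exposed_def)
  qed
  then have pt: "((fst x, ?p), y) \<in> same_point X2"
    using y(1) all S x' by (auto simp: same_point_def)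
  moreover have "(fst x, fst y) \<in> R"
    using same_point_conflict[OF order.refl y(1)] y(5) by simp
  ultimately show ?thesis
    using str pt comp_point[OF comp_string[OF assms(1) str] pt] assms(2) y(2) S(2)
    by (intro exI[of _ ?p] exI[of _ y]) simp
qed

text \<open>Descending in \<open>M\<close> reaches level \<open>j - 4\<close>. The node found there,
  or else its lower neighbour, has \<open>L\<close>-level \<open>i - 1\<close> and
  \<open>M\<close>-level at most \<open>j - 3\<close>, and its fragment touches the inner
  region.\<close>

lemma near_root_adj_inner: 
  assumes "x \<in> comp" "M x = j"
  obtains u v where "u \<in> inner" "v \<in> near_root" "adj u v"
proof -
  have down: "\<exists>z\<in>comp. M z = k" if "1 \<le> k" "k \<le> j" for k
    using that(2,1)
  proof (induction rule: inc_induct)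
    case base
    then show ?case using assms by blast
  next
    case (step n)
    then obtain z where z: "z \<in> comp" "M z = Suc n"
      by force
    have "(b, z) \<in> joined E X2"
      using z by (simp add: comp_def)
    then obtain y where "M z = M y + 1" "(b, y) \<in> joined E X2"
      using l2.level_down_joined[OF _ comp_X2[OF z(1)]] z(2) step by (metis less_Suc_eq_le One_nat_def)
    then show ?case
      using z(2) by (intro bexI[of _ y]) (simp_all add: comp_def)
  qed
  have "1 \<le> j - 4" "j - 4 \<le> j"
    using j by simp_all
  then obtain z where z: "z \<in> comp" "M z = j - 4"
    using down by blast
  obtain y where y: "y \<in> comp" "M y \<le> j - 3" "L y + 1 = i"
  proof (cases "L z = i")
    case True
    then obtain p y where y: "(z, (fst z, p)) \<in> (same_string E X2)\<^sup>*" "((fst z, p), y) \<in> same_point X2"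
        "y \<in> comp" "L y + 1 = i"
      using lower_neighbour[OF z(1)] by blast
    have "M y \<le> M z + 1"
      using l2.level_strings[OF y(1)] l2.level_point'[OF y(2)] by simp
    then show ?thesis
      using that[of y] y z j by simp
  next
    case False
    then show ?thesis
      using that[of z] z comp_level[OF z(1)] j by simp
  qed
  then obtain p q where pq: "p \<in> fragment E X2 y" "q \<in> inner" "adj p q"
    using fragment_inner by blast
  have "(fst y, p) \<in> comp" "M (fst y, p) = M y"
    using fragment_comp[OF y(1) pq(1)] l2.level_fragment[OF comp_X2[OF y(1)] pq(1)] by auto
  then have "p \<in> near_root"
    using y(2) comp_X2 unfolding near_root_def comp_def by force
  then show thesis
    using that pq adj_sym by blast
qed

text \<open>The wall is made of the string, a fragment \<open>w\<close> below it in
  \<open>L\<close>, which touches the inner region, and pieces of the next two fragments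
  \<open>y\<close> and \<open>z\<close> below it in \<open>M\<close>, which lead to
  \<open>near_root\<close>. The strings of \<open>w\<close> and \<open>y\<close> are one step away,
  that of \<open>z\<close> two.\<close>

lemma wall_exists:
  assumes x: "x \<in> comp" "L x = i" "\<And>p. p \<in> S (fst x) \<Longrightarrow> M (fst x, p) = j"
  obtains W where "wall inner near_root W" "S (fst x) \<subseteq> W"
    "\<And>p. p \<in> W \<Longrightarrow> \<exists>u k. k \<le> 2 \<and> (fst x, u) \<in> R ^^ k \<and> u \<in> A \<and> p \<in> S u"
proof -
  let ?v = "fst x"
  have xX: "x \<in> X1" "x \<in> X2"
    using comp_X1 comp_X2 x by blast+
  then have S: "snd x \<in> S ?v" "?v \<in> A" "x = (?v, snd x)"
    by (auto simp: nodes_def)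
  have Mx: "M x = j"
    using x(3)[OF S(1)] S(3) by simp
  have xq: "(x, (?v, q)) \<in> (same_string E X2)\<^sup>*" if "q \<in> S ?v" for q
  proof -
    have "((?v, snd x), (?v, q)) \<in> (same_string E X2)\<^sup>*"
      using string_X2[of ?v "snd x"] xX x(2) b(3) that S linked_S by (intro whole_string) auto
    then show ?thesis by simp
  qed
  obtain p1 w where w: "((?v, p1), w) \<in> same_point X2" "w \<in> comp" "L w + 1 = i" "snd w = p1" "p1 \<in> S ?v"
      "(?v, fst w) \<in> R"
    using lower_neighbour[OF x(1,2)] by blast
  have Mw: "j \<le> M w + 1"
    using l2.level_point[OF w(1)] x(3)[OF w(5)] by simp
  have jx: "(b, x) \<in> joined E X2"
    using x(1) by (simp add: comp_def)
  obtain x' y where y: "(x', y) \<in> same_point X2" "M x = M y + 1" "(b, y) \<in> joined E X2" "x' \<in> X2" "y \<in> X2"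
      "fst x' = ?v" "snd x' = snd y"
  proof -
    have "1 < M x"
      using Mx j by simp
    then show thesis
      using l2.level_down_joined[OF jx xX(2)] that by metis
  qed
  obtain y' z where z: "(y, y') \<in> (same_string E X2)\<^sup>*" "(y', z) \<in> same_point X2" "M y = M z + 1"
      "(b, z) \<in> joined E X2" "y' \<in> X2" "z \<in> X2" "fst y' = fst y" "snd y' = snd z" "M y' = M y"
  proof -
    have "1 < M y"
      using y(2) Mx j by simp
    then show thesis
      using l2.level_down_joined[OF y(3,5)] that by metis
  qed
  obtain z' t where t: "(z, z') \<in> (same_string E X2)\<^sup>*" "(z', t) \<in> same_point X2" "M z = M t + 1"
      "(b, t) \<in> joined E X2" "t \<in> X2" "fst z' = fst z" "snd z' = snd t"
  proof -
    have "1 < M z"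
      using z(3) y(2) Mx j by simp
    then show thesis
      using l2.level_down_joined[OF z(4,6)] that by metis
  qed
  have yz: "y \<in> comp" "z \<in> comp" "t \<in> comp"
    using y z t by (auto simp: comp_def)
  let ?Fz = "fragment E X2 z - near_root"
  \<comment> \<open>The fragment of \<open>z\<close> has level \<open>j - 2\<close> and may share
    points with \<open>near_root\<close>. Only its part reachable from \<open>snd z\<close> outside
    \<open>near_root\<close> is used; where the fragment leaves this part, it enters
    \<open>near_root\<close>.\<close>
  define Q where "Q = {p. (snd z, p) \<in> (E \<inter> ?Fz \<times> ?Fz)\<^sup>*}"
  have zQ: "snd z \<in> ?Fz"
  proof -
    have "snd y' \<notin> near_root"
      using comp_not_near_root[OF comp_string[OF yz(1) z(1)]] z(9) y(2) Mx by simp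
    then show ?thesis
      using z(8) fragment_self[of z] by simp
  qed
  have Qsub: "p \<in> ?Fz" if "p \<in> Q" for p
  proof -
    have "(snd z, p) \<in> (E \<inter> ?Fz \<times> ?Fz)\<^sup>*"
      using that by (simp add: Q_def)
    then show ?thesis
      by (induction rule: rtrancl_induct) (use zQ in auto)
  qed
  have linked_Q: "linked E Q"
  proof (rule linkedI_root[OF sym_adj])
    fix q assume "q \<in> Q"
    then have "(snd z, q) \<in> (E \<inter> ?Fz \<times> ?Fz)\<^sup>*"
      by (simp add: Q_def)
    then have "(snd z, q) \<in> (E \<inter> Q \<times> Q)\<^sup>*"
    proof (induction rule: rtrancl_induct)
      case (step p q)
      then have "p \<in> Q" "q \<in> Q"
        unfolding Q_def by (auto intro: rtrancl_into_rtrancl)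
      then show ?case
        using step by (auto intro: rtrancl_into_rtrancl)
    qed simp
    moreover have "sym ((E \<inter> Q \<times> Q)\<^sup>*)"
      using sym_adj by (intro sym_rtrancl) (auto simp: sym_def)
    ultimately show "(q, snd z) \<in> (E \<inter> Q \<times> Q)\<^sup>*"
      by (metis symD)
  qed
  have tQ: "\<exists>p\<in>Q. \<exists>q\<in>near_root. adj p q"
  proof -
    have "snd t \<in> near_root"
      using t z y Mx unfolding near_root_def by force
    moreover have "snd t \<in> fragment E X2 z"
      using same_string_fragment[OF t(1) z(6)] t(7) by simp
    moreover have "snd z \<in> fragment E X2 z" "snd z \<in> Q"
      using fragment_self[of z] by (simp_all add: Q_def)
    ultimately obtain p q where pq: "(p, q) \<in> E" "p \<in> fragment E X2 z" "q \<in> fragment E X2 z" "p \<in> Q" "q \<notin> Q"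
      using linked_exit[OF linked_fragment[OF sym_adj z(6)]] Qsub by (metis DiffD2)
    have "q \<in> near_root"
    proof (rule ccontr)
      assume "q \<notin> near_root"
      then have "(p, q) \<in> E \<inter> ?Fz \<times> ?Fz"
        using pq Qsub by blast
      then have "q \<in> Q"
        using pq(4) unfolding Q_def by (auto intro: rtrancl_into_rtrancl)
      then show False
        using pq by simp
    qed
    then show ?thesis
      using pq by blast
  qed
  let ?Fw = "fragment E X2 w" and ?Fy = "fragment E X2 y"
  let ?W = "S ?v \<union> ?Fw \<union> ?Fy \<union> Q"
  have parts: "\<exists>u\<in>comp. snd u = p \<and> (p \<notin> near_root) \<and> (\<exists>k\<le>2. (?v, fst u) \<in> R ^^ k)" if "p \<in> ?W" for p
  proof -
    consider "p \<in> S ?v" | "p \<in> ?Fw" | "p \<in> ?Fy" | "p \<in> Q"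
      using \<open>p \<in> ?W\<close> by blast
    then show ?thesis
    proof cases
      case 1
      then have "(?v, p) \<in> comp"
        using comp_string[OF x(1) xq] by simp
      moreover from this have "p \<notin> near_root"
        using comp_not_near_root[of "(?v, p)"] x(3)[OF 1] by simp
      moreover have "(?v, ?v) \<in> R ^^ 0" by simp
      ultimately show ?thesis
        by (intro bexI[of _ "(?v, p)"]) (auto simp del: relpow.simps)
    next
      case 2
      then have "(fst w, p) \<in> comp" "M (fst w, p) = M w"
        using fragment_comp[OF w(2)] l2.level_fragment[OF comp_X2[OF w(2)]] by auto
      moreover from this have "p \<notin> near_root"
        using comp_not_near_root[of "(fst w, p)"] Mw by simp
      moreover have "(?v, fst w) \<in> R ^^ 1"
        using w(6) by simp
      ultimately show ?thesis
        by (intro bexI[of _ "(fst w, p)"] conjI exI[of _ 1]) auto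
    next
      case 3
      then have "(fst y, p) \<in> comp" "M (fst y, p) = M y"
        using fragment_comp[OF yz(1)] l2.level_fragment[OF comp_X2[OF yz(1)]] by auto
      moreover from this have "p \<notin> near_root"
        using comp_not_near_root[of "(fst y, p)"] y(2) Mx by simp
      moreover have "(?v, fst y) \<in> R ^^ 1"
        using same_point_conflict[OF X2_sub y(1)] y(6) by simp
      ultimately show ?thesis
        by (intro bexI[of _ "(fst y, p)"] conjI exI[of _ 1]) auto
    next
      case 4
      then have "p \<in> fragment E X2 z" "p \<notin> near_root"
        using Qsub by auto
      then have "(fst z, p) \<in> comp"
        using fragment_comp[OF yz(2)] by auto
      moreover have "(?v, fst y) \<in> R" "(fst y, fst z) \<in> R"
        using same_point_conflict[OF X2_sub y(1)] y(6) same_point_conflict[OF X2_sub z(2)] z(7) by simp_all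
      then have "(?v, fst z) \<in> R ^^ 2"
        by (auto simp: numeral_2_eq_2)
      ultimately show ?thesis
        using \<open>p \<notin> near_root\<close> by (intro bexI[of _ "(fst z, p)"] conjI exI[of _ 2]) auto
    qed
  qed
  have "linked E ?W"
  proof (intro linked_Un)
    show "linked E (S ?v)"
      using S linked_S by blast
    show "linked E ?Fw" "linked E ?Fy"
      using linked_fragment[OF sym_adj] comp_X2 w(2) yz(1) by blast+
    show "linked E Q"
      by (rule linked_Q)
    show "S ?v \<inter> ?Fw \<noteq> {}"
      using w(4,5) fragment_self[of w] by blast
    have "snd y \<in> S ?v"
      using y(4,6,7) X2_X1 by (cases x') (auto simp: nodes_def)
    then show "(S ?v \<union> ?Fw) \<inter> ?Fy \<noteq> {}"
      using fragment_self[of y] by blast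
    have "snd z \<in> ?Fy"
      using same_string_fragment[OF z(1) y(5)] z(8) by simp
    then show "(S ?v \<union> ?Fw \<union> ?Fy) \<inter> Q \<noteq> {}"
      unfolding Q_def by blast
  qed
  moreover have "?W \<inter> inner = {}" "?W \<inter> near_root = {}"
    using parts comp_not_inner by (blast, blast)
  moreover have "\<exists>p\<in>?W. \<exists>q\<in>inner. adj p q"
    using fragment_inner[OF w(2,3)] by blast
  moreover have "\<exists>p\<in>?W. \<exists>q\<in>near_root. adj p q"
    using tQ by blast
  ultimately have "wall inner near_root ?W"
    unfolding wall_def by blast
  moreover have "\<exists>u k. k \<le> 2 \<and> (?v, u) \<in> R ^^ k \<and> u \<in> A \<and> p \<in> S u" if "p \<in> ?W" for p
  proof -
    obtain u k where u: "u \<in> comp" "snd u = p" "k \<le> 2" "(?v, fst u) \<in> R ^^ k"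
      using parts[OF \<open>p \<in> ?W\<close>] by blast
    then have "fst u \<in> A" "p \<in> S (fst u)"
      using comp_X1[OF u(1)] by (auto simp: nodes_def)
    then show ?thesis
      using u by blast
  qed
  ultimately show thesis
    using that by blast
qed

lemma linked_inner: "linked E inner"
  unfolding inner_def by (rule l1.levels_linked)

lemma linked_near_root: "linked E near_root"
  unfolding near_root_def by (rule l2.levels_linked)

lemma inner_near_root: "inner \<inter> near_root = {}"
  using comp_not_inner unfolding near_root_def comp_def by blast

end

section \<open>Odd closed walks within a level\<close>

text \<open>A parity version of Sperner's lemma. A label is a pair of truth values; two labels differing in
  both components are opposite. Changes of the first component along edges without second
  component are counted modulo 2 over the triangle \<open>0 \<le> i \<le> j \<le> n\<close>.\<close>

definition flip :: "bool \<times> bool \<Rightarrow> bool \<times> bool \<Rightarrow> nat" where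
  "flip x y = of_bool (fst x \<noteq> fst y \<and> \<not> snd x \<and> \<not> snd y)"

definition opposite :: "bool \<times> bool \<Rightarrow> bool \<times> bool \<Rightarrow> bool" where
  "opposite x y \<longleftrightarrow> fst x \<noteq> fst y \<and> snd x \<noteq> snd y"

text \<open>A diagonal may still carry opposite labels with unequal components. Then the two other
  corners have equal components and, by the last assumptions, the same label, so the four sides
  cancel in pairs.\<close>

lemma flip_square:
  assumes "\<not> opposite x y" "\<not> opposite y z" "\<not> opposite x w" "\<not> opposite w z"
    and "\<And>c. x = (c, c) \<Longrightarrow> z \<noteq> (\<not> c, \<not> c)" "\<And>c. y = (c, c) \<Longrightarrow> w \<noteq> (\<not> c, \<not> c)"
  shows "even (flip x y + flip y z + flip x w + flip w z)"
  using assms(1-4) assms(5)[of "fst x"] assms(6)[of "fst y"]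
  by (cases x; cases y; cases z; cases w) (simp add: flip_def opposite_def; argo)

text \<open>Tucker's lemma: with the constant diagonal contracted, the triangle is a disc with
  antipodal labels on its boundary, and the four labels form two antipodal pairs. Squares contribute
  evenly, so the boundary count is even; pairing each boundary edge with its antipode shows that it
  is odd.\<close>

lemma sperner_antipodal:
  fixes lam :: "nat \<Rightarrow> nat \<Rightarrow> bool \<times> bool"
  assumes diag: "\<And>i. i \<le> n \<Longrightarrow> lam i i = (False, False)"
    and corner: "lam 0 n = (True, True)"
    and antipode: "\<And>i. i \<le> n \<Longrightarrow> lam i n = (\<not> fst (lam 0 i), \<not> snd (lam 0 i))"
    and row: "\<And>i j. i \<le> j \<Longrightarrow> j < n \<Longrightarrow> \<not> opposite (lam i j) (lam i (Suc j))"
    and col: "\<And>i j. i < j \<Longrightarrow> j \<le> n \<Longrightarrow> \<not> opposite (lam i j) (lam (Suc i) j)"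
    and cross: "\<And>i j c. i < j \<Longrightarrow> j < n \<Longrightarrow> lam i j = (c, c) \<Longrightarrow> lam (Suc i) (Suc j) \<noteq> (\<not> c, \<not> c)"
    and cross': "\<And>i j c. i < j \<Longrightarrow> j < n \<Longrightarrow> lam i (Suc j) = (c, c) \<Longrightarrow> lam (Suc i) j \<noteq> (\<not> c, \<not> c)"
  shows False
proof -
  \<comment> \<open>The count over the legs of the triangle with corner \<open>(k, n)\<close>; the
    third side is the diagonal, where nothing flips.\<close>
  define r where "r k = (\<Sum>j=k..<n. flip (lam k j) (lam k (Suc j))) + (\<Sum>i=k..<n. flip (lam i n) (lam (Suc i) n))" for k
  have "even (r k + r (Suc k))" if k: "k < n" for k
  proof -
    have strip: "even ((\<Sum>j=Suc k..<m. flip (lam k j) (lam k (Suc j))) + (\<Sum>j=Suc k..<m. flip (lam (Suc k) j) (lam (Suc k) (Suc j)))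
        + flip (lam k (Suc k)) (lam (Suc k) (Suc k)) + flip (lam k m) (lam (Suc k) m))"
      if "Suc k \<le> m" "m \<le> n" for m
      using that
    proof (induction m rule: dec_induct)
      case base
      then show ?case by simp
    next
      case (step m)
      have "even (flip (lam k m) (lam k (Suc m)) + flip (lam k (Suc m)) (lam (Suc k) (Suc m))
          + flip (lam k m) (lam (Suc k) m) + flip (lam (Suc k) m) (lam (Suc k) (Suc m)))"
        using step row[of k m] col[of k "Suc m"] col[of k m] row[of "Suc k" m] cross[of k m] cross'[of k m]
        by (intro flip_square) simp_all
      then show ?case
        using step by simp argo
    qed
    have "(\<Sum>j=k..<n. flip (lam k j) (lam k (Suc j))) = flip (lam k k) (lam k (Suc k)) + (\<Sum>j=Suc k..<n. flip (lam k j) (lam k (Suc j)))"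
      "(\<Sum>i=k..<n. flip (lam i n) (lam (Suc i) n)) = flip (lam k n) (lam (Suc k) n) + (\<Sum>i=Suc k..<n. flip (lam i n) (lam (Suc i) n))"
      by (rule sum.atLeast_Suc_lessThan[OF k])+
    moreover have "flip (lam k k) (lam k (Suc k)) = flip (lam k (Suc k)) (lam (Suc k) (Suc k))"
      using diag[of k] diag[of "Suc k"] k by (auto simp: flip_def)
    ultimately show ?thesis
      using strip[of n] k unfolding r_def by simp argo
  qed
  then have "even (r (n - k))" if "k \<le> n" for k
    using that
  proof (induction k)
    case 0
    then show ?case by (simp add: r_def)
  next
    case (Suc k)
    then show ?case
      using Suc.prems Suc.IH \<open>\<And>k. k < n \<Longrightarrow> even (r k + r (Suc k))\<close>[of "n - Suc k"] by (simp add: Suc_diff_Suc)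
  qed
  then have "even (r 0)"
    by (metis diff_self_eq_0 order_refl)
  moreover have "odd (r 0)"
  proof -
    \<comment> \<open>If the first components of two labels that are not opposite differ, then their
      second components agree, so exactly one of the edge and its antipode is counted. The sum thus
      telescopes.\<close>
    have "odd ((\<Sum>j<m. flip (lam 0 j) (lam 0 (Suc j))) + (\<Sum>i<m. flip (lam i n) (lam (Suc i) n))) \<longleftrightarrow> fst (lam 0 m)"
      if "m \<le> n" for m
      using that
    proof (induction m)
      case 0
      then show ?case using diag[of 0] by simp
    next
      case (Suc m)
      have "odd (flip (lam 0 m) (lam 0 (Suc m)) + flip (lam m n) (lam (Suc m) n)) \<longleftrightarrow> fst (lam 0 m) \<noteq> fst (lam 0 (Suc m))"
        using row[of 0 m] antipode[of m] antipode[of "Suc m"] Suc.prems by (auto simp: flip_def opposite_def)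
      then show ?case
        using Suc by simp argo
    qed
    from this[of n] show ?thesis
      using corner by (simp add: r_def atLeast0LessThan)
  qed
  ultimately show False by simp
qed

section \<open>Strings with equal levels induce a bipartite graph\<close>

context string_plane
begin

text \<open>All strings of the walk lie in one component and have walls between the same two
  regions. Parities of short walks and the left-right order of walls then label the pairs of
  positions against \<open>sperner_antipodal\<close>.\<close>

lemma no_odd_closed:
  assumes K: "K \<subseteq> A" "\<And>v p. v \<in> K \<Longrightarrow> p \<in> S v \<Longrightarrow> L (v, p) = i \<and> M (v, p) = j" and a: "odd i = a" and n: "odd n"
  shows "(v, v) \<notin> (R \<inter> K \<times> K) ^^ n"
proof
  assume walk: "(v, v) \<in> (R \<inter> K \<times> K) ^^ n"
  then obtain f where f: "f 0 = v" "f n = v" "\<And>k. k < n \<Longrightarrow> (f k, f (Suc k)) \<in> R \<inter> K \<times> K"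
    unfolding relpow_fun_conv by blast
  have n0: "0 < n"
    using n by (cases n) auto
  have XK: "(u, p) \<in> X2 \<and> (u, p) \<in> X1" if "u \<in> K" "p \<in> S u" for u p
    using that K(1) K(2)[OF that] a by (auto simp: exposed_def nodes_def)
  have step: "((f k, p), (f (Suc k), p)) \<in> same_point X2 \<and> ((f k, p), (f (Suc k), p)) \<in> same_point X1"
    if "k < n" "p \<in> S (f k)" "p \<in> S (f (Suc k))" for k p
    using f(3)[OF that(1)] that XK by (auto simp: same_point_def conflict_def)
  have common: "\<exists>p. p \<in> S (f k) \<and> p \<in> S (f (Suc k))" if "k < n" for k
    using f(3)[OF that] by (auto simp: conflict_def)
  obtain p0 where p0: "p0 \<in> S (f 0)" "p0 \<in> S (f 1)"
    using common[OF n0] by auto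
  have fK: "f k \<in> K" if "k \<le> n" for k
    using f(3)[of k] f(3)[of "k - 1"] n0 that by (cases "k = n") auto
  have R01: "(f 0, f 1) \<in> R" "f 0 \<in> K" "f 1 \<in> K"
    using f(3)[OF n0] by auto
  have "(f 0, f 0) \<in> R ^^ (2 * i - 1)"
  proof -
    have "(fst (f 0, p0), fst (f 0, p0)) \<in> R ^^ (2 * L (f 0, p0) - 1)"
    proof (rule l1.level_edge_odd_walk[OF same_point_conflict[OF order.refl] sym_conflict])
      show "((f 0, p0), (f 1, p0)) \<in> joined E X1"
        using step[OF n0] p0 by auto
    qed (use R01 XK p0 K in auto)
    then show ?thesis
      using K(2) R01 p0 by simp
  qed
  \<comment> \<open>The first edge of the walk lies inside level \<open>i\<close>, so
    \<open>2 * i - 1\<close> is the length of an odd closed walk and exceeds 11. The same applies to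
    \<open>j\<close>.\<close>
  then have i7: "7 \<le> i"
    using no_short[of "2 * i - 1" "f 0"] l1.level_pos[of "(f 0, p0)"] XK K(2) R01 p0 by fastforce
  have "(f 0, f 0) \<in> R ^^ (2 * j - 1)"
  proof -
    have "(fst (f 0, p0), fst (f 0, p0)) \<in> R ^^ (2 * M (f 0, p0) - 1)"
    proof (rule l2.level_edge_odd_walk[OF same_point_conflict[OF X2_sub] sym_conflict])
      show "((f 0, p0), (f 1, p0)) \<in> joined E X2"
        using step[OF n0] p0 by auto
    qed (use R01 XK p0 K in auto)
    then show ?thesis
      using K(2) R01 p0 by simp
  qed
  then have j7: "7 \<le> j"
    using no_short[of "2 * j - 1" "f 0"] l2.level_pos[of "(f 0, p0)"] XK K(2) R01 p0 by fastforce
  interpret c: string_component P \<phi> \<gamma> A S L M a "(f 0, p0)" i j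
    using XK R01 p0 K(2) a i7 j7 by unfold_locales auto
  have string: "((f k, p), (f k, q)) \<in> (same_string E X2)\<^sup>*" if "k \<le> n" "p \<in> S (f k)" "q \<in> S (f k)" for k p q
    using whole_string[of E S "f k" X2] linked_S K(1) fK[OF that(1)] XK that by blast
  have comp: "(f k, p) \<in> c.comp" if "k \<le> n" "p \<in> S (f k)" for k p
    using that
  proof (induction k arbitrary: p)
    case 0
    have "(f 0, p0) \<in> c.comp"
      by (simp add: c.comp_def)
    then show ?case
      using c.comp_string string[OF _ p0(1)] 0 by blast
  next
    case (Suc k)
    obtain q where q: "q \<in> S (f k)" "q \<in> S (f (Suc k))"
      using common[of k] Suc by auto
    then have "(f (Suc k), q) \<in> c.comp"
      using c.comp_point[OF Suc.IH] step[of k q] Suc by auto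
    then show ?case
      using c.comp_string string[OF _ q(2)] Suc by blast
  qed
  have "\<exists>W. wall c.inner c.near_root W \<and> S u \<subseteq> W \<and> (\<forall>p\<in>W. \<exists>w k. k \<le> 2 \<and> (u, w) \<in> R ^^ k \<and> w \<in> A \<and> p \<in> S w)"
    if u: "\<exists>k\<le>n. u = f k" for u
  proof -
    obtain k where k: "k \<le> n" "u = f k"
      using u by blast
    obtain p where p: "p \<in> S (f k)"
    proof (cases "k = n")
      case True
      then show ?thesis using that f p0 by auto
    next
      case False
      then show ?thesis using that common[of k] k by auto
    qed
    show ?thesis
      using c.wall_exists[OF comp[OF k(1) p]] K(2) fK[OF k(1)] p k(2) by (metis fst_conv)
  qed
  then obtain W where W: "\<And>k. k \<le> n \<Longrightarrow> wall c.inner c.near_root (W (f k)) \<and> S (f k) \<subseteq> W (f k) \<and>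
      (\<forall>p\<in>W (f k). \<exists>w l. l \<le> 2 \<and> (f k, w) \<in> R ^^ l \<and> w \<in> A \<and> p \<in> S w)"
    by metis
  have M0: "M (f 0, p0) = j"
    using K(2) R01 p0 by simp
  obtain u0 v0 where uv: "u0 \<in> c.inner" "v0 \<in> c.near_root" "adj u0 v0"
    using c.near_root_adj_inner[OF comp[OF _ p0(1)] M0] by blast
  obtain lab :: "'p set \<Rightarrow> 'p set \<Rightarrow> bool" where
    lab1: "\<And>V W. wall c.inner c.near_root V \<Longrightarrow> wall c.inner c.near_root W \<Longrightarrow> V \<inter> W = {} \<Longrightarrow> lab V W \<noteq> lab W V" and
    lab2: "\<And>V V' W. wall c.inner c.near_root V \<Longrightarrow> wall c.inner c.near_root V' \<Longrightarrow> wall c.inner c.near_root W \<Longrightarrow>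
      V \<inter> W = {} \<Longrightarrow> V' \<inter> W = {} \<Longrightarrow> V \<inter> V' \<noteq> {} \<Longrightarrow> lab V W = lab V' W"
    by (rule wall_labels[OF c.linked_inner uv(1) c.linked_near_root uv(2) c.inner_near_root uv(3)]) (rule that; assumption)
  text \<open>Two walls that meet give a walk of length at most 5, whose parity is well defined as there are
    no short odd closed walks; of two disjoint walls, the label says which one is on the left.\<close>
  define near where "near k l = (W (f k) \<inter> W (f l) \<noteq> {})" for k l
  define c where "c k l = (\<exists>m\<le>5. (f k, f l) \<in> R ^^ m \<and> odd (m + k + l))" for k l
  define lam where "lam k l = (if near k l then (c k l, c k l) else (lab (W (f k)) (W (f l)), \<not> lab (W (f k)) (W (f l))))" for k l
  have rev: "(x, y) \<in> R ^^ m \<Longrightarrow> (y, x) \<in> R ^^ m" for x y m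
    by (rule l1.relpow_sym[OF sym_conflict])
  have near_walk: "\<exists>m\<le>5. (f k, f l) \<in> R ^^ m" if kl: "near k l" "k \<le> n" "l \<le> n" for k l
  proof -
    obtain p where "p \<in> W (f k)" "p \<in> W (f l)"
      using kl(1) by (auto simp: near_def)
    then obtain w x m1 m2 where w: "m1 \<le> 2" "(f k, w) \<in> R ^^ m1" "w \<in> A" "p \<in> S w"
      and x: "m2 \<le> 2" "(f l, x) \<in> R ^^ m2" "x \<in> A" "p \<in> S x"
      using W[OF kl(2)] W[OF kl(3)] by meson
    have "(w, x) \<in> R ^^ 0 \<or> (w, x) \<in> R ^^ 1"
      using w x by (auto simp: conflict_def)
    then obtain m3 where m3: "m3 \<le> 1" "(w, x) \<in> R ^^ m3"
      by (metis le_refl zero_le_one)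
    then have "(f k, f l) \<in> R ^^ (m1 + m3 + m2)"
      using w(2) rev[OF x(2)] by (auto simp: relpow_add)
    then show ?thesis
      using w x m3 by (intro exI[of _ "m1 + m3 + m2"]) auto
  qed
  \<comment> \<open>12 is the length of the longest closed walk compared below: two short walks of
    length at most 5 and one step at either end. An odd length up to 12 is at most 11.\<close>
  have closed: "even (m1 + m2)" if "(x, y) \<in> R ^^ m1" "(y, x) \<in> R ^^ m2" "m1 + m2 \<le> 12" for x y m1 m2
  proof (rule ccontr)
    assume o: "odd (m1 + m2)"
    then have "m1 + m2 \<le> 11"
      using that(3) by (cases "m1 + m2 = 12") auto
    moreover have "(x, x) \<in> R ^^ (m1 + m2)"
      using that by (auto simp: relpow_add)
    ultimately show False
      using no_short o by blast
  qed
  have c_eq: "c k l \<longleftrightarrow> odd (m + k + l)" if "m \<le> 5" "(f k, f l) \<in> R ^^ m" for k l m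
  proof -
    have "even (m + m')" if "m' \<le> 5" "(f k, f l) \<in> R ^^ m'" for m'
      using closed[OF \<open>(f k, f l) \<in> R ^^ m\<close> rev[OF that(2)]] that \<open>m \<le> 5\<close> by simp
    then show ?thesis
      using that unfolding c_def by (metis even_add)
  qed
  have R1: "(f k, f (Suc k)) \<in> R ^^ 1" if "k < n" for k
    using f(3)[OF that] by simp
  have meet: "W (f k) \<inter> W (f (Suc k)) \<noteq> {}" if "k < n" for k
    using common[OF that] W[of k] W[of "Suc k"] that by fastforce
  have lab2': "lab (W (f l)) V = lab (W (f l)) V'" if "l \<le> n" "wall c.inner c.near_root V" "wall c.inner c.near_root V'"
      "W (f l) \<inter> V = {}" "W (f l) \<inter> V' = {}" "V \<inter> V' \<noteq> {}" for l V V'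
  proof -
    have "lab V (W (f l)) = lab V' (W (f l))"
      using lab2[OF that(2,3)] W[OF that(1)] that(4-6) by (simp add: Int_commute)
    then show ?thesis
      using lab1[of V "W (f l)"] lab1[of V' "W (f l)"] W[OF that(1)] that(2-5) by (auto simp: Int_commute)
  qed
  show False
  proof (rule sperner_antipodal[of n lam])
    have self: "near k k" if "k \<le> n" for k
    proof -
      have "W (f k) \<noteq> {}"
        using meet[of k] meet[of "k - 1"] that n0 by (cases "k = n") auto
      then show ?thesis
        by (simp add: near_def)
    qed
    show "lam k k = (False, False)" if "k \<le> n" for k
      using self[OF that] c_eq[of 0 k k] by (simp add: lam_def)
    \<comment> \<open>Since \<open>f 0 = f n\<close>, the empty walk is compared with the whole
      closed walk, which is odd.\<close>
    show "lam 0 n = (True, True)"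
      using self[of 0] c_eq[of 0 0 n] n f by (simp add: lam_def near_def)
    \<comment> \<open>Measuring from position \<open>n\<close> in place of 0 changes the parity
      because \<open>n\<close> is odd; for disjoint walls the arguments of \<open>lab\<close> change
      places.\<close>
    show "lam k n = (\<not> fst (lam 0 k), \<not> snd (lam 0 k))" if k: "k \<le> n" for k
    proof (cases "near 0 k")
      case True
      then obtain m where m: "m \<le> 5" "(f 0, f k) \<in> R ^^ m"
        using near_walk k by blast
      then have "c 0 k = odd (m + 0 + k)" "c k n = odd (m + k + n)"
        using c_eq[OF m] c_eq[of m k n] rev[OF m(2)] f by simp_all
      moreover have "near k n"
        using True f by (auto simp: near_def)
      ultimately show ?thesis
        using True n by (simp add: lam_def)
    next
      case False
      then have "\<not> near k n"
        using f by (auto simp: near_def)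
      moreover have "lab (W (f 0)) (W (f k)) \<noteq> lab (W (f k)) (W (f n))"
        using lab1[of "W (f 0)" "W (f k)"] W[of 0] W[OF k] False f by (simp add: near_def)
      ultimately show ?thesis
        using False by (simp add: lam_def)
    qed
    show "\<not> opposite (lam k l) (lam k (Suc l))" if kl: "k \<le> l" "l < n" for k l
    proof -
      consider "near k l" "near k (Suc l)" | "\<not> near k l" "\<not> near k (Suc l)" | "near k l \<noteq> near k (Suc l)"
        by blast
      then show ?thesis
      proof cases
        case 1
        then obtain m m' where m: "m \<le> 5" "(f k, f l) \<in> R ^^ m" "m' \<le> 5" "(f k, f (Suc l)) \<in> R ^^ m'"
          using near_walk[of k l] near_walk[of k "Suc l"] kl by auto
        have "(f k, f (Suc l)) \<in> R ^^ (m + 1)"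
          using m(2) R1[OF kl(2)] by auto
        then have "even (m + 1 + m')"
          by (rule closed[OF _ rev[OF m(4)]]) (use m(1,3) in linarith)
        then have "c k l = c k (Suc l)"
          using c_eq[OF m(1,2)] c_eq[OF m(3,4)] by auto
        then show ?thesis
          using 1 by (simp add: lam_def opposite_def)
      next
        case 2
        then have "lab (W (f k)) (W (f l)) = lab (W (f k)) (W (f (Suc l)))"
          using lab2'[of k "W (f l)" "W (f (Suc l))"] W[of l] W[of "Suc l"] kl meet[OF kl(2)] by (auto simp: near_def)
        then show ?thesis
          using 2 by (simp add: lam_def opposite_def)
      \<comment> \<open>If just one of the two pairs is near, one label has equal components and the
        other unequal ones; such labels are not opposite.\<close>
      qed (auto simp: lam_def opposite_def)
    qed
    show "\<not> opposite (lam k l) (lam (Suc k) l)" if kl: "k < l" "l \<le> n" for k l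
    proof -
      consider "near k l" "near (Suc k) l" | "\<not> near k l" "\<not> near (Suc k) l" | "near k l \<noteq> near (Suc k) l"
        by blast
      then show ?thesis
      proof cases
        case 1
        then obtain m m' where m: "m \<le> 5" "(f k, f l) \<in> R ^^ m" "m' \<le> 5" "(f (Suc k), f l) \<in> R ^^ m'"
          using near_walk[of k l] near_walk[of "Suc k" l] kl by auto
        have "(f k, f (Suc k)) \<in> R ^^ 1"
          using R1 kl by simp
        then have "(f k, f l) \<in> R ^^ (1 + m')"
          using m(4) unfolding relpow_add by blast
        then have "even (1 + m' + m)"
          by (rule closed[OF _ rev[OF m(2)]]) (use m(1,3) in linarith)
        then have "c k l = c (Suc k) l"
          using c_eq[OF m(1,2)] c_eq[OF m(3,4)] by auto
        then show ?thesis
          using 1 by (simp add: lam_def opposite_def)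
      next
        case 2
        then have "lab (W (f k)) (W (f l)) = lab (W (f (Suc k))) (W (f l))"
          using lab2[of "W (f k)" "W (f (Suc k))" "W (f l)"] W[of k] W[of "Suc k"] W[of l] kl meet[of k] by (auto simp: near_def)
        then show ?thesis
          using 2 by (simp add: lam_def opposite_def)
      qed (auto simp: lam_def opposite_def)
    qed
    show "lam (Suc k) (Suc l) \<noteq> (\<not> q, \<not> q)" if kl: "k < l" "l < n" and q: "lam k l = (q, q)" for k l q
    proof
      assume *: "lam (Suc k) (Suc l) = (\<not> q, \<not> q)"
      then have near: "near k l" "near (Suc k) (Suc l)"
        using q by (auto simp: lam_def split: if_splits)
      then obtain m m' where m: "m \<le> 5" "(f k, f l) \<in> R ^^ m" "m' \<le> 5" "(f (Suc k), f (Suc l)) \<in> R ^^ m'"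
        using near_walk[of k l] near_walk[of "Suc k" "Suc l"] kl by auto
      have "(f k, f (Suc k)) \<in> R ^^ 1"
        using R1 kl by simp
      then have "(f k, f (Suc l)) \<in> R ^^ (1 + m')"
        using m(4) unfolding relpow_add by blast
      moreover have "(f (Suc l), f l) \<in> R ^^ 1"
        using rev[OF R1[OF kl(2)]] .
      ultimately have "(f k, f l) \<in> R ^^ (1 + m' + 1)"
        unfolding relpow_add by blast
      then have "even (1 + m' + 1 + m)"
        by (rule closed[OF _ rev[OF m(2)]]) (use m(1,3) in linarith)
      then have "c k l = c (Suc k) (Suc l)"
        using c_eq[OF m(1,2)] c_eq[OF m(3,4)] by auto
      then show False
        using q * near by (simp add: lam_def)
    qed
    show "lam (Suc k) l \<noteq> (\<not> q, \<not> q)" if kl: "k < l" "l < n" and q: "lam k (Suc l) = (q, q)" for k l q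
    proof
      assume *: "lam (Suc k) l = (\<not> q, \<not> q)"
      then have near: "near k (Suc l)" "near (Suc k) l"
        using q by (auto simp: lam_def split: if_splits)
      then obtain m m' where m: "m \<le> 5" "(f k, f (Suc l)) \<in> R ^^ m" "m' \<le> 5" "(f (Suc k), f l) \<in> R ^^ m'"
        using near_walk[of k "Suc l"] near_walk[of "Suc k" l] kl by auto
      have "(f k, f (Suc k)) \<in> R ^^ 1"
        using R1 kl by simp
      then have "(f k, f l) \<in> R ^^ (1 + m')"
        using m(4) unfolding relpow_add by blast
      moreover have "(f l, f (Suc l)) \<in> R ^^ 1"
        using R1[OF kl(2)] .
      ultimately have "(f k, f (Suc l)) \<in> R ^^ (1 + m' + 1)"
        unfolding relpow_add by blast
      then have "even (1 + m' + 1 + m)"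
        by (rule closed[OF _ rev[OF m(2)]]) (use m(1,3) in linarith)
      then have "c k (Suc l) = c (Suc k) l"
        using c_eq[OF m(1,2)] c_eq[OF m(3,4)] by auto
      then show False
        using q * near by (simp add: lam_def)
    qed
  qed
qed

end

section \<open>The third layering as a proper colouring\<close>

lemma level_whole_string:
  assumes "sym E" "layering E X d" "linked E (S v)" "\<And>q. q \<in> S v \<Longrightarrow> (v, q) \<in> X" "p \<in> S v" "q \<in> S v"
  shows "d (v, p) = d (v, q)"
proof -
  interpret layered E X d
    using assms(1,2) by unfold_locales
  show ?thesis
    using assms(3-6) by (intro level_strings whole_string)
qed

text \<open>Strings of \<open>T\<close> that meet have equal \<open>L\<close> and \<open>M\<close>,
  as levels at a point differ by at most one and the parities agree. Likewise equal parity of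
  \<open>N\<close> would mean equal \<open>N\<close>, and thus an odd closed walk within one class
  of \<open>L\<close> and \<open>M\<close>.\<close>

lemma (in string_plane) final_levels_differ:
  assumes T: "T \<subseteq> A" "\<And>v p. v \<in> T \<Longrightarrow> p \<in> S v \<Longrightarrow> odd (L (v, p)) = a \<and> odd (M (v, p)) = b"
    and N: "layering E (nodes T S) N"
    and p: "u \<in> T" "v \<in> T" "u \<noteq> v" "p \<in> S u" "p \<in> S v"
  shows "odd (N (u, p)) \<noteq> odd (N (v, p))"
proof
  assume parity: "odd (N (u, p)) = odd (N (v, p))"
  interpret l3: layered E "nodes T S" N
    using sym_adj N by unfold_locales
  have X1: "(w, q) \<in> X1" and X2: "(w, q) \<in> X2" if "w \<in> T" "q \<in> S w" for w q
    using that T by (auto simp: nodes_def exposed_def)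
  define lev where "lev w = (SOME k. \<exists>q\<in>S w. k = (L (w, q), M (w, q)))" for w
  have lev: "(L (w, q), M (w, q)) = lev w" if "w \<in> T" "q \<in> S w" for w q
  proof -
    have "\<exists>q\<in>S w. lev w = (L (w, q), M (w, q))"
      unfolding lev_def by (rule someI[where x = "(L (w, q), M (w, q))"]) (use that in blast)
    then obtain r where r: "r \<in> S w" "lev w = (L (w, r), M (w, r))"
      by blast
    have "linked E (S w)"
      using that T(1) linked_S by blast
    then have "M (w, q) = M (w, r)"
      using sym_adj layering_M X2 that r(1) level_whole_string[of E X2 M S w q r] by blast
    moreover have "L (w, q) = L (w, r)"
      using X1 that r(1) by (intro L_string)
    ultimately show ?thesis
      using r(2) by simp
  qed
  \<comment> \<open>Equality of the levels is built into the step relation, so that the odd closed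
    walk obtained from \<open>N\<close> stays in the class \<open>K\<close> of
    \<open>u\<close>.\<close>
  define Q where "Q = {(w, z). (w, z) \<in> R \<and> w \<in> T \<and> z \<in> T \<and> lev w = lev z}"
  have Q: "(w, z) \<in> Q" if wz: "w \<in> T" "z \<in> T" "w \<noteq> z" "q \<in> S w" "q \<in> S z" for w z q
  proof -
    have sp: "((w, q), (z, q)) \<in> same_point X1" "((w, q), (z, q)) \<in> same_point X2"
      using wz X1 X2 by (auto simp: same_point_def)
    have "L (w, q) = L (z, q)"
      using l1.level_point[OF sp(1)] l1.level_point'[OF sp(1)] T(2)[OF wz(1,4)] T(2)[OF wz(2,5)]
      by (metis Suc_eq_plus1 even_Suc le_SucE le_antisym)
    moreover have "M (w, q) = M (z, q)"
      using l2.level_point[OF sp(2)] l2.level_point'[OF sp(2)] T(2)[OF wz(1,4)] T(2)[OF wz(2,5)]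
      by (metis Suc_eq_plus1 even_Suc le_SucE le_antisym)
    ultimately have "lev w = lev z"
      using lev wz by metis
    then show ?thesis
      using wz T(1) by (auto simp: Q_def conflict_def)
  qed
  have point: "((u, p), (v, p)) \<in> same_point (nodes T S)"
    using p by (auto simp: same_point_def nodes_def)
  have "N (u, p) = N (v, p)"
    using l3.level_point[OF point] l3.level_point'[OF point] parity
    by (metis Suc_eq_plus1 even_Suc le_SucE le_antisym)
  then have "(fst (u, p), fst (u, p)) \<in> Q ^^ (2 * N (u, p) - 1)"
  proof (rule l3.level_edge_odd_walk[rotated 5])
    show "(fst x, fst y) \<in> Q" if "(x, y) \<in> same_point (nodes T S)" for x y
      using that Q by (fastforce simp: same_point_def nodes_def)
    show "sym Q"
      using sym_conflict[of A S] by (auto simp: Q_def sym_def)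
    show "(fst (u, p), fst (v, p)) \<in> Q"
      using Q[OF p] by simp
    show "((u, p), (v, p)) \<in> joined E (nodes T S)"
      using point by blast
  qed (use p in \<open>auto simp: nodes_def\<close>)
  then have "(u, u) \<in> Q ^^ (2 * N (u, p) - 1)"
    by simp
  define K where "K = {w \<in> T. lev w = lev u}"
  have walk: "(w, z) \<in> (R \<inter> K \<times> K) ^^ k \<and> z \<in> K" if "(w, z) \<in> Q ^^ k" "w \<in> K" for w z k
    using that
  proof (induction k arbitrary: z)
    case (Suc k)
    then obtain y where "(w, y) \<in> Q ^^ k" "(y, z) \<in> Q"
      by auto
    moreover from this have "(w, y) \<in> (R \<inter> K \<times> K) ^^ k" "y \<in> K"
      using Suc by auto
    ultimately show ?case
      by (auto simp: Q_def K_def)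
  qed simp
  have "u \<in> K"
    using p by (simp add: K_def)
  with \<open>(u, u) \<in> Q ^^ (2 * N (u, p) - 1)\<close> have "(u, u) \<in> (R \<inter> K \<times> K) ^^ (2 * N (u, p) - 1)"
    using walk by blast
  moreover have "odd (2 * N (u, p) - 1)"
    using l3.level_pos[of "(u, p)"] p by (auto simp: nodes_def)
  moreover have "K \<subseteq> A"
    using T(1) by (auto simp: K_def)
  moreover have "L (w, q) = fst (lev u) \<and> M (w, q) = snd (lev u)" if "w \<in> K" "q \<in> S w" for w q
    using lev[of w q, symmetric] that by (simp add: K_def)
  moreover have "odd (fst (lev u)) = a"
    using lev[of u p, symmetric] T(2)[of u p] p by simp
  ultimately show False
    using no_odd_closed by blast
qed

section \<open>Loop programs\<close>

text \<open>Programs whose only loops are counting loops; the bound of a loop is the first cell of an array.\<close>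

datatype prog =
    Nop
  | Assign string aexp aexp
  | Then prog prog (infixr ";;" 60)
  | If bexp prog prog
  | For string string prog

definition set_cell :: "string \<Rightarrow> nat \<Rightarrow> nat \<Rightarrow> store \<Rightarrow> store" where
  "set_cell x i k s = s(x := (s x)(i := k))"

lemma set_cell_same [simp]: "set_cell x i k s x = (s x)(i := k)"
  and set_cell_other [simp]: "y \<noteq> x \<Longrightarrow> set_cell x i k s y = s y"
  by (simp_all add: set_cell_def)

lemma exec_Write: "exec (Write x a b) s 1 (set_cell x (aval a s) (aval b s) s)"
  unfolding set_cell_def by (rule exec.Write)

text \<open>The counter is left at the bound and set anew in every round, exactly as in the compiled
  loop, so that \<open>compile_exec\<close> can relate equal stores.\<close>

primrec den :: "prog \<Rightarrow> store \<Rightarrow> store" where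
  "den Nop s = s"
| "den (Assign x a b) s = set_cell x (aval a s) (aval b s) s"
| "den (p ;; q) s = den q (den p s)"
| "den (If b p q) s = (if bval b s then den p s else den q s)"
| "den (For x N p) s =
     set_cell x 0 (s N 0) (fold (\<lambda>i s. den p (set_cell x 0 i s)) [0..<s N 0] s)"

abbreviation cell :: "string \<Rightarrow> aexp" where
  "cell x \<equiv> Read x (Const 0)"

primrec compile :: "prog \<Rightarrow> com" where
  "compile Nop = Skip"
| "compile (Assign x a b) = Write x a b"
| "compile (p ;; q) = Seq (compile p) (compile q)"
| "compile (If b p q) = Cond b (compile p) (compile q)"
| "compile (For x N p) = Seq (Write x (Const 0) (Const 0))
     (While (Less (cell x) (cell N)) (Seq (compile p) (Write x (Const 0) (Add (cell x) (Const 1)))))"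

primrec writes :: "prog \<Rightarrow> string set" where
  "writes Nop = {}"
| "writes (Assign x a b) = {x}"
| "writes (p ;; q) = writes p \<union> writes q"
| "writes (If b p q) = writes p \<union> writes q"
| "writes (For x N p) = insert x (writes p)"

primrec bounds :: "prog \<Rightarrow> string set" where
  "bounds Nop = {}"
| "bounds (Assign x a b) = {}"
| "bounds (p ;; q) = bounds p \<union> bounds q"
| "bounds (If b p q) = bounds p \<union> bounds q"
| "bounds (For x N p) = insert N (bounds p)"

primrec proper :: "prog \<Rightarrow> bool" where
  "proper Nop \<longleftrightarrow> True"
| "proper (Assign x a b) \<longleftrightarrow> True"
| "proper (p ;; q) \<longleftrightarrow> proper p \<and> proper q"
| "proper (If b p q) \<longleftrightarrow> proper p \<and> proper q"
| "proper (For x N p) \<longleftrightarrow> x \<notin> writes p \<and> proper p"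

text \<open>The indeterminate stands for a common upper bound of all loop limits.\<close>

primrec time_bound :: "prog \<Rightarrow> nat poly" where
  "time_bound Nop = 1"
| "time_bound (Assign x a b) = 1"
| "time_bound (p ;; q) = time_bound p + time_bound q"
| "time_bound (If b p q) = 1 + time_bound p + time_bound q"
| "time_bound (For x N p) = 2 + [:0, 1:] * (2 + time_bound p)"

lemma den_frame: "x \<notin> writes p \<Longrightarrow> den p s x = s x"
proof (induction p arbitrary: s)
  case (For y N p)
  have "fold (\<lambda>i s. den p (set_cell y 0 i s)) is s x = s x" for "is" s
    by (induction "is" arbitrary: s) (use For in auto)
  then show ?case
    using For by simp
qed auto

text \<open>The frame condition on arrays not written by the body is supplied to both premises, so
  that invariants need to mention only what changes.\<close>

lemma For_rule:
  assumes "I 0 s"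
    and "\<And>i t. i < s N 0 \<Longrightarrow> I i t \<Longrightarrow> (\<And>y. y \<noteq> x \<Longrightarrow> y \<notin> writes p \<Longrightarrow> t y = s y) \<Longrightarrow>
      I (Suc i) (den p (set_cell x 0 i t))"
    and "\<And>t. I (s N 0) t \<Longrightarrow> (\<And>y. y \<noteq> x \<Longrightarrow> y \<notin> writes p \<Longrightarrow> t y = s y) \<Longrightarrow> Q (set_cell x 0 (s N 0) t)"
  shows "Q (den (For x N p) s)"
proof -
  let ?t = "\<lambda>k. fold (\<lambda>i s. den p (set_cell x 0 i s)) [0..<k] s"
  have "I k (?t k) \<and> (\<forall>y. y \<noteq> x \<longrightarrow> y \<notin> writes p \<longrightarrow> ?t k y = s y)" if "k \<le> s N 0" for k
    using that
  proof (induction k)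
    case 0
    then show ?case using assms(1) by simp
  next
    case (Suc k)
    then show ?case
      using assms(2)[of k "?t k"] den_frame[of _ p "set_cell x 0 k (?t k)"] by simp
  qed
  then show ?thesis
    using assms(3) by simp
qed

lemma For_rule_bound:
  assumes "s N 0 = k" "I 0 s"
    and "\<And>i t. i < k \<Longrightarrow> I i t \<Longrightarrow> (\<And>y. y \<noteq> x \<Longrightarrow> y \<notin> writes p \<Longrightarrow> t y = s y) \<Longrightarrow>
      I (Suc i) (den p (set_cell x 0 i t))"
    and "\<And>t. I k t \<Longrightarrow> (\<And>y. y \<noteq> x \<Longrightarrow> y \<notin> writes p \<Longrightarrow> t y = s y) \<Longrightarrow> Q (set_cell x 0 k t)"
  shows "Q (den (For x N p) s)"
  using For_rule[where I = I and Q = Q and s = s and N = N] assms by metis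

text \<open>Loop limits are cells that the program never writes. They keep their initial values, at
  most \<open>B\<close>, at every nesting depth, and the nesting alone yields the
  polynomial.\<close>

lemma compile_exec:
  assumes "proper p" "bounds p \<inter> writes p = {}" "\<And>N. N \<in> bounds p \<Longrightarrow> s N 0 \<le> B"
  shows "\<exists>t \<le> poly (time_bound p) B. exec (compile p) s t (den p s)"
  using assms
proof (induction p arbitrary: s)
  case Nop
  then show ?case using exec.Skip by auto
next
  case (Assign x a b)
  then show ?case using exec_Write[of x a b s] by auto
next
  case (Then p q)
  obtain t where t: "t \<le> poly (time_bound p) B" "exec (compile p) s t (den p s)"
    using Then.IH(1)[of s] Then.prems by auto
  have "den p s N = s N" if "N \<in> bounds q" for N
    using den_frame[of N p s] that Then.prems by auto
  then obtain u where "u \<le> poly (time_bound q) B" "exec (compile q) (den p s) u (den q (den p s))"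
    using Then.IH(2)[of "den p s"] Then.prems by auto
  then show ?case
    using t exec.Seq by (intro exI[of _ "t + u"]) auto
next
  case (If b p q)
  show ?case
  proof (cases "bval b s")
    case True
    obtain t where "t \<le> poly (time_bound p) B" "exec (compile p) s t (den p s)"
      using If.IH(1)[of s] If.prems by auto
    then show ?thesis
      using True exec.CondTrue[of b s "compile p" t] by (intro exI[of _ "1 + t"]) auto
  next
    case False
    obtain t where "t \<le> poly (time_bound q) B" "exec (compile q) s t (den q s)"
      using If.IH(2)[of s] If.prems by auto
    then show ?thesis
      using False exec.CondFalse[of b s "compile q" t] by (intro exI[of _ "1 + t"]) auto
  qed
next
  case (For x N p)
  let ?f = "\<lambda>i s. den p (set_cell x 0 i s)" and ?T = "poly (time_bound p) B" and ?n = "s N 0"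
  let ?w = "While (Less (cell x) (cell N)) (Seq (compile p) (Write x (Const 0) (Add (cell x) (Const 1))))"
  have xN: "x \<noteq> N" "N \<notin> writes p" "x \<notin> writes p"
    using For.prems by auto
  \<comment> \<open>Each round costs a test, the body and an increment; the leading 1 is the final
    failing test.\<close>
  have "\<exists>t \<le> 1 + (?n - i) * (2 + ?T). exec ?w (set_cell x 0 i u) t (set_cell x 0 ?n (fold ?f [i..<?n] u))"
    if "i \<le> ?n" "\<And>M. M \<in> bounds p \<union> {N} \<Longrightarrow> u M = s M" "u N = s N" for i u
    using that
  proof (induction "?n - i" arbitrary: i u)
    case 0
    then have "i = ?n" by simp
    then show ?case
      using 0 xN exec.WhileFalse[of "Less (cell x) (cell N)" "set_cell x 0 i u"]
      by (intro exI[of _ 1]) simp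
  next
    case (Suc k)
    then have i: "i < ?n" by simp
    have bx: "M \<noteq> x" "M \<notin> writes p" if "M \<in> bounds p \<union> {N}" for M
      using that For.prems(1,2) xN by auto
    have "set_cell x 0 i u M 0 \<le> B" if "M \<in> bounds p" for M
      using Suc.prems(2)[of M] For.prems(3)[of M] bx[of M] that by simp
    then obtain t where t: "t \<le> ?T" "exec (compile p) (set_cell x 0 i u) t (?f i u)"
      using For.IH[of "set_cell x 0 i u"] For.prems by auto
    have x: "?f i u x 0 = i"
      using den_frame[OF xN(3)] by simp
    have fr: "?f i u M = s M" if "M \<in> bounds p \<union> {N}" for M
      using den_frame[OF bx(2)[OF that]] Suc.prems(2)[OF that] bx(1)[OF that] by simp
    have "k = ?n - Suc i" "Suc i \<le> ?n"
      using Suc.hyps(2) by simp_all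
    then obtain t' where t': "t' \<le> 1 + (?n - Suc i) * (2 + ?T)"
      "exec ?w (set_cell x 0 (Suc i) (?f i u)) t' (set_cell x 0 ?n (fold ?f [Suc i..<?n] (?f i u)))"
      using Suc.hyps(1)[of "Suc i" "?f i u"] fr by blast
    have "exec (Write x (Const 0) (Add (cell x) (Const 1))) (?f i u) 1 (set_cell x 0 (Suc i) (?f i u))"
      using exec_Write[of x "Const 0" "Add (cell x) (Const 1)" "?f i u"] x by simp
    then have "exec (Seq (compile p) (Write x (Const 0) (Add (cell x) (Const 1)))) (set_cell x 0 i u)
        (t + 1) (set_cell x 0 (Suc i) (?f i u))"
      using t(2) exec.Seq by blast
    moreover have "bval (Less (cell x) (cell N)) (set_cell x 0 i u)"
      using i xN Suc.prems(3) by simp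
    ultimately have "exec ?w (set_cell x 0 i u) (1 + (t + 1) + t') (set_cell x 0 ?n (fold ?f [Suc i..<?n] (?f i u)))"
      using t'(2) exec.WhileTrue by blast
    moreover have "fold ?f [Suc i..<?n] (?f i u) = fold ?f [i..<?n] u"
      using i by (simp add: upt_conv_Cons)
    moreover have "1 + (t + 1) + t' \<le> 1 + (?n - i) * (2 + ?T)"
    proof -
      have "?n - i = Suc (?n - Suc i)"
        using i by simp
      then show ?thesis
        using t(1) t'(1) by simp
    qed
    ultimately show ?case
      by (intro exI[of _ "1 + (t + 1) + t'"]) simp
  qed
  from this[of 0 s] obtain t where t: "t \<le> 1 + ?n * (2 + ?T)" "exec ?w (set_cell x 0 0 s) t (den (For x N p) s)"
    by auto
  have "exec (Write x (Const 0) (Const 0)) s 1 (set_cell x 0 0 s)"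
    using exec_Write[of x "Const 0" "Const 0" s] by simp
  then have "exec (compile (For x N p)) s (1 + t) (den (For x N p) s)"
    using t(2) exec.Seq by (metis compile.simps(5))
  moreover have "?n * (2 + ?T) \<le> B * (2 + ?T)"
    using For.prems(3)[of N] by (intro mult_right_mono) auto
  then have "1 + t \<le> poly (time_bound (For x N p)) B"
    using t(1) by (simp add: algebra_simps)
  ultimately show ?case
    by blast
qed

declare den.simps(5) [simp del]

section \<open>Removing short odd cycles\<close>

abbreviation true :: "aexp \<Rightarrow> bexp" where
  "true a \<equiv> Less (Const 0) a"

definition eq :: "aexp \<Rightarrow> aexp \<Rightarrow> bexp" where
  "eq a b = Conj (Neg (Less a b)) (Neg (Less b a))"

lemma bval_eq [simp]: "bval (eq a b) s \<longleftrightarrow> aval a s = aval b s"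
  by (auto simp: eq_def)

definition conjs :: "bexp list \<Rightarrow> bexp" where
  "conjs bs = foldr Conj bs (true (Const 1))"

lemma bval_conjs [simp]: "bval (conjs bs) s \<longleftrightarrow> (\<forall>b\<in>set bs. bval b s)"
  by (induction bs) (auto simp: conjs_def)

definition seqs :: "prog list \<Rightarrow> prog" where
  "seqs ps = foldr (;;) ps Nop"

lemma seqs_simps [simp]: "seqs [] = Nop" "seqs (p # ps) = p ;; seqs ps"
  by (simp_all add: seqs_def)

abbreviation G_at :: "aexp \<Rightarrow> aexp \<Rightarrow> aexp" where
  "G_at u v \<equiv> Read ''G'' (Add (Read ''vn'' u) v)"

abbreviation node_at :: "string \<Rightarrow> aexp \<Rightarrow> aexp \<Rightarrow> aexp" where
  "node_at x v p \<equiv> Read x (Add (Read ''vm'' v) p)"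

abbreviation P_at :: "aexp \<Rightarrow> aexp \<Rightarrow> aexp" where
  "P_at p q \<equiv> Read ''P'' (Add (Read ''pm'' p) q)"

abbreviation put :: "string \<Rightarrow> aexp \<Rightarrow> prog" where
  "put x \<equiv> Assign x (Const 0)"

text \<open>Covers the existential searches of the program. The value of the test must not depend on
  the flag, which earlier rounds may have set.\<close>

lemma den_flag_loop:
  assumes "t N 0 = k" "x \<noteq> f"
    and "\<And>i t'. i < k \<Longrightarrow> (\<And>y. y \<noteq> x \<Longrightarrow> y \<noteq> f \<Longrightarrow> t' y = t y) \<Longrightarrow> bval c (set_cell x 0 i t') \<longleftrightarrow> Q i"
  shows "den (For x N (If c (put f (Const b)) Nop)) t f 0 = (if \<exists>i<k. Q i then b else t f 0)"
proof (rule For_rule_bound[where I = "\<lambda>i t'. t' f 0 = (if \<exists>j<i. Q j then b else t f 0)" and k = k])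
  fix i t' assume i: "i < k" and I: "t' f 0 = (if \<exists>j<i. Q j then b else t f 0)"
    and "\<And>y. y \<noteq> x \<Longrightarrow> y \<notin> writes (If c (put f (Const b)) Nop) \<Longrightarrow> t' y = t y"
  then have c: "bval c (set_cell x 0 i t') \<longleftrightarrow> Q i"
    using assms(3) by simp
  show "den (If c (put f (Const b)) Nop) (set_cell x 0 i t') f 0 = (if \<exists>j<Suc i. Q j then b else t f 0)"
    using c I assms(2) by (auto simp: less_Suc_eq)
qed (use assms in simp_all)

definition static :: "string set" where
  "static = {''n'', ''m'', ''vn'', ''vm'', ''pm'', ''G'', ''S'', ''P''}"

text \<open>There is no multiplication, so the row offsets of the matrices are tabulated.\<close>

definition row_offsets :: prog where
  "row_offsets = For ''v'' ''n''
       (Assign ''A'' (cell ''v'') (Const 1) ;;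
        Assign ''vn'' (Add (cell ''v'') (Const 1)) (Add (Read ''vn'' (cell ''v'')) (cell ''n'')) ;;
        Assign ''vm'' (Add (cell ''v'') (Const 1)) (Add (Read ''vm'' (cell ''v'')) (cell ''m''))) ;;
     For ''p'' ''m''
       (Assign ''pm'' (Add (cell ''p'') (Const 1)) (Add (Read ''pm'' (cell ''p'')) (cell ''m'')))"

locale input =
  fixes n m :: nat and gE :: "(nat \<times> nat) set" and S :: "nat \<Rightarrow> nat set" and pE :: "(nat \<times> nat) set"
  assumes gE: "gE \<subseteq> {..<n} \<times> {..<n}" "sym gE" "irrefl gE"
    and pE: "pE \<subseteq> {..<m} \<times> {..<m}"
    and S: "\<And>v. v < n \<Longrightarrow> S v \<subseteq> {..<m} \<and> S v \<noteq> {}"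
begin

definition env :: "store \<Rightarrow> bool" where
  "env s \<longleftrightarrow> s ''n'' 0 = n \<and> s ''m'' 0 = m \<and> (\<forall>v<n. s ''vn'' v = v * n \<and> s ''vm'' v = v * m) \<and>
     (\<forall>p<m. s ''pm'' p = p * m) \<and>
     (\<forall>u<n. \<forall>v<n. 0 < s ''G'' (u * n + v) \<longleftrightarrow> (u, v) \<in> gE) \<and>
     (\<forall>v<n. \<forall>p<m. 0 < s ''S'' (v * m + p) \<longleftrightarrow> p \<in> S v) \<and>
     (\<forall>p<m. \<forall>q<m. 0 < s ''P'' (p * m + q) \<longleftrightarrow> (p, q) \<in> pE)"

lemma env_cong: "env s \<Longrightarrow> (\<And>x. x \<in> static \<Longrightarrow> t x = s x) \<Longrightarrow> env t"
  unfolding env_def static_def by simp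

lemma env_den: "env s \<Longrightarrow> writes p \<inter> static = {} \<Longrightarrow> env (den p s)"
  by (erule env_cong) (auto intro: den_frame)

lemma env_set_cell: "env s \<Longrightarrow> x \<notin> static \<Longrightarrow> env (set_cell x i k s)"
  by (erule env_cong) (auto intro: set_cell_other)

lemma env_loop:
  assumes "env s" "\<And>y. y \<noteq> x \<Longrightarrow> y \<notin> W \<Longrightarrow> t y = s y" "insert x W \<inter> static = {}"
  shows "env (set_cell x 0 i t)"
proof (rule env_cong[OF assms(1)])
  fix y assume "y \<in> static"
  then have "y \<noteq> x" "y \<notin> W"
    using assms(3) by auto
  then show "set_cell x 0 i t y = s y"
    using assms(2) by simp
qed

lemma env_simps [simp]:
  assumes "env s"
  shows "s ''n'' 0 = n" "s ''m'' 0 = m" "v < n \<Longrightarrow> s ''vn'' v = v * n" "v < n \<Longrightarrow> s ''vm'' v = v * m"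
    "p < m \<Longrightarrow> s ''pm'' p = p * m"
    "u < n \<Longrightarrow> v < n \<Longrightarrow> 0 < s ''G'' (u * n + v) \<longleftrightarrow> (u, v) \<in> gE"
    "v < n \<Longrightarrow> p < m \<Longrightarrow> 0 < s ''S'' (v * m + p) \<longleftrightarrow> p \<in> S v"
    "p < m \<Longrightarrow> q < m \<Longrightarrow> 0 < s ''P'' (p * m + q) \<longleftrightarrow> (p, q) \<in> pE"
  using assms unfolding env_def by blast+

definition marked :: "store \<Rightarrow> string \<Rightarrow> nat set" where
  "marked t x = {v. v < n \<and> 0 < t x v}"

lemma marked_subset: "marked t x \<subseteq> {..<n}" and finite_marked [simp]: "finite (marked t x)"
  by (auto simp: marked_def)

lemma marked_cong: "t x = s x \<Longrightarrow> marked t x = marked s x"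
  by (simp add: marked_def)

lemma den_row_offsets:
  assumes "s ''n'' 0 = n" "s ''m'' 0 = m" "s ''vn'' 0 = 0" "s ''vm'' 0 = 0" "s ''pm'' 0 = 0"
    "\<And>u v. u < n \<Longrightarrow> v < n \<Longrightarrow> 0 < s ''G'' (u * n + v) \<longleftrightarrow> (u, v) \<in> gE"
    "\<And>v p. v < n \<Longrightarrow> p < m \<Longrightarrow> 0 < s ''S'' (v * m + p) \<longleftrightarrow> p \<in> S v"
    "\<And>p q. p < m \<Longrightarrow> q < m \<Longrightarrow> 0 < s ''P'' (p * m + q) \<longleftrightarrow> (p, q) \<in> pE"
  shows "env (den row_offsets s)" "marked (den row_offsets s) ''A'' = {..<n}"
proof -
  let ?b = "Assign ''A'' (cell ''v'') (Const 1) ;;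
        Assign ''vn'' (Add (cell ''v'') (Const 1)) (Add (Read ''vn'' (cell ''v'')) (cell ''n'')) ;;
        Assign ''vm'' (Add (cell ''v'') (Const 1)) (Add (Read ''vm'' (cell ''v'')) (cell ''m''))"
  define t where "t = den (For ''v'' ''n'' ?b) s"
  have t: "(\<forall>v\<le>n. t ''vn'' v = v * n \<and> t ''vm'' v = v * m) \<and> (\<forall>v<n. t ''A'' v = 1)"
    unfolding t_def
    by (rule For_rule[where I = "\<lambda>i t. (\<forall>v\<le>i. t ''vn'' v = v * n \<and> t ''vm'' v = v * m) \<and> (\<forall>v<i. t ''A'' v = 1)"])
       (use assms in \<open>auto simp: le_Suc_eq less_Suc_eq\<close>)
  have fr: "t x = s x" if "x \<notin> {''v'', ''A'', ''vn'', ''vm''}" for x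
    unfolding t_def using that by (intro den_frame) simp
  let ?c = "Assign ''pm'' (Add (cell ''p'') (Const 1)) (Add (Read ''pm'' (cell ''p'')) (cell ''m''))"
  define r where "r = den (For ''p'' ''m'' ?c) t"
  have r: "\<forall>p\<le>m. r ''pm'' p = p * m"
    unfolding r_def
    by (rule For_rule[where I = "\<lambda>i t. \<forall>p\<le>i. t ''pm'' p = p * m"])
       (use assms fr in \<open>auto simp: le_Suc_eq\<close>)
  have fr': "r x = t x" if "x \<notin> {''p'', ''pm''}" for x
    unfolding r_def using that by (intro den_frame) simp
  have "den row_offsets s = r"
    by (simp add: row_offsets_def r_def t_def)
  show "env (den row_offsets s)" "marked (den row_offsets s) ''A'' = {..<n}"
  proof -
    have "r x = s x" if "x \<in> {''n'', ''m'', ''G'', ''S'', ''P''}" for x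
      using fr[of x] fr'[of x] that by auto
    then have "r ''n'' = s ''n''" "r ''m'' = s ''m''" "r ''G'' = s ''G''" "r ''S'' = s ''S''" "r ''P'' = s ''P''"
      by simp_all
    moreover have "r ''vn'' = t ''vn''" "r ''vm'' = t ''vm''" "r ''A'' = t ''A''"
      by (simp_all add: fr')
    ultimately have "env r" "\<forall>v<n. 0 < r ''A'' v"
      using t r assms unfolding env_def by simp_all
    then show "env (den row_offsets s)" "marked (den row_offsets s) ''A'' = {..<n}"
      unfolding \<open>den row_offsets s = r\<close> marked_def by auto
  qed
qed

end

text \<open>Counters for a loop nest of variable depth. Strings of the letter i alone clash with no
  other array name of the program.\<close>

definition tup :: "nat \<Rightarrow> string" where
  "tup i = replicate (Suc i) (CHR ''i'')"

lemma tup_eq [simp]: "tup i = tup j \<longleftrightarrow> i = j"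
  by (simp add: tup_def)

lemma tup_static [simp]: "tup i \<notin> static" "tup i \<noteq> ''A''" "tup i \<noteq> ''C''" "''A'' \<noteq> tup i" "''C'' \<noteq> tup i" "tup i \<noteq> ''n''"
  by (simp_all add: tup_def static_def)

primrec nest :: "nat \<Rightarrow> prog \<Rightarrow> prog" where
  "nest 0 p = p"
| "nest (Suc k) p = For (tup k) ''n'' (nest k p)"

definition cycle_test :: "nat \<Rightarrow> bexp" where
  "cycle_test l = conjs (map (\<lambda>i. Conj (true (Read ''A'' (cell (tup i))))
     (true (G_at (cell (tup i)) (cell (tup (Suc i mod l)))))) [0..<l])"

definition drop_tuple :: "nat \<Rightarrow> prog" where
  "drop_tuple l = seqs (map (\<lambda>i. Assign ''A'' (cell (tup i)) (Const 0) ;; Assign ''C'' (cell (tup i)) (Const 1)) [0..<l])"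

text \<open>All \<open>n\<close>-ary tuples of length \<open>l\<close> are tried; this is polynomial
  because \<open>l\<close> is one of five constants.\<close>

definition cycles :: "nat \<Rightarrow> prog" where
  "cycles l = nest l (If (cycle_test l) (drop_tuple l) Nop)"

definition all_cycles :: prog where
  "all_cycles = cycles 3 ;; cycles 5 ;; cycles 7 ;; cycles 9 ;; cycles 11"

lemma writes_drop_tuple: "writes (drop_tuple l) \<subseteq> {''A'', ''C''}"
proof -
  have "writes (seqs (map (\<lambda>i. Assign ''A'' (cell (tup i)) (Const 0) ;; Assign ''C'' (cell (tup i)) (Const 1)) is)) \<subseteq> {''A'', ''C''}"
    for "is"
    by (induction "is") auto
  then show ?thesis
    by (simp add: drop_tuple_def)
qed

lemma writes_nest: "writes (nest k p) = tup ` {..<k} \<union> writes p"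
  by (induction k) (auto simp: lessThan_Suc)

lemma den_drop_tuple:
  "den (drop_tuple l) s ''A'' = (\<lambda>v. if v \<in> (\<lambda>i. s (tup i) 0) ` {..<l} then 0 else s ''A'' v)"
  "den (drop_tuple l) s ''C'' = (\<lambda>v. if v \<in> (\<lambda>i. s (tup i) 0) ` {..<l} then 1 else s ''C'' v)"
proof -
  let ?f = "\<lambda>is. seqs (map (\<lambda>i. Assign ''A'' (cell (tup i)) (Const 0) ;; Assign ''C'' (cell (tup i)) (Const 1)) is)"
  have "den (?f is) s ''A'' = (\<lambda>v. if v \<in> (\<lambda>i. s (tup i) 0) ` set is then 0 else s ''A'' v) \<and>
     den (?f is) s ''C'' = (\<lambda>v. if v \<in> (\<lambda>i. s (tup i) 0) ` set is then 1 else s ''C'' v)" for "is" s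
    by (induction "is" arbitrary: s) (auto simp: fun_eq_iff)
  from this[of "[0..<l]" s] show
    "den (drop_tuple l) s ''A'' = (\<lambda>v. if v \<in> (\<lambda>i. s (tup i) 0) ` {..<l} then 0 else s ''A'' v)"
    "den (drop_tuple l) s ''C'' = (\<lambda>v. if v \<in> (\<lambda>i. s (tup i) 0) ` {..<l} then 1 else s ''C'' v)"
    by (simp_all add: drop_tuple_def atLeast0LessThan)
qed

lemma closed_walk_shift:
  assumes "\<And>i. i < l \<Longrightarrow> (y i, y (Suc i mod l)) \<in> R" "0 < l"
  shows "(y (i mod l), y ((i + k) mod l)) \<in> R ^^ k"
proof (induction k)
  case (Suc k)
  have "(y ((i + k) mod l), y (Suc ((i + k) mod l) mod l)) \<in> R"
    using assms by simp
  then show ?case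
    using Suc by (auto simp: mod_Suc_eq)
qed simp

text \<open>A repeated vertex splits the closed walk into two shorter closed walks, one of which is
  odd.\<close>

lemma shortest_odd_closed_walk_inj:
  assumes R: "\<And>i. i < l \<Longrightarrow> (y i, y (Suc i mod l)) \<in> R" and l: "odd l"
    and no: "\<And>k v. odd k \<Longrightarrow> k < l \<Longrightarrow> (v, v) \<notin> R ^^ k"
  shows "inj_on y {..<l}"
proof -
  have l0: "0 < l"
    using l by (cases l) auto
  have "False" if ij: "i < j" "j < l" "y i = y j" for i j
  proof -
    have 1: "(y i, y i) \<in> R ^^ (j - i)"
      using closed_walk_shift[of l y R i "j - i"] R l0 ij by simp
    have "(j + (l - (j - i))) mod l = i"
      using ij by simp
    then have 2: "(y j, y j) \<in> R ^^ (l - (j - i))"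
      using closed_walk_shift[of l y R j "l - (j - i)"] R l0 ij by simp
    show False
    proof (cases "odd (j - i)")
      case True
      then show ?thesis using no[of "j - i"] 1 ij by auto
    next
      case False
      then show ?thesis using no[of "l - (j - i)"] 2 ij l by auto
    qed
  qed
  then show ?thesis
    by (intro inj_onI) (metis lessThan_iff linorder_neqE_nat)
qed

text \<open>Count positions: every edge has its first or its second end in \<open>K\<close>, and
  rotating by one position maps the edges of the second kind injectively to those of the
  first.\<close>

lemma cover_cycle:
  assumes "\<And>i. i < l \<Longrightarrow> y i \<in> K \<or> y (Suc i mod l) \<in> K" "inj_on y {..<l}" "0 < l"
  shows "l \<le> 2 * card (K \<inter> y ` {..<l})"
proof -
  let ?I = "{i. i < l \<and> y i \<in> K}" and ?J = "{i. i < l \<and> y (Suc i mod l) \<in> K}"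
  have "inj_on (\<lambda>i. Suc i mod l) ?J"
  proof (rule inj_onI)
    fix i j assume "i \<in> ?J" "j \<in> ?J" "Suc i mod l = Suc j mod l"
    then show "i = j"
      by (auto simp: mod_Suc split: if_splits)
  qed
  moreover have "(\<lambda>i. Suc i mod l) ` ?J \<subseteq> ?I"
    using assms(3) by auto
  ultimately have "card ?J \<le> card ?I"
    by (rule card_inj_on_le) simp
  moreover have "card {..<l} \<le> card ?I + card ?J"
    using assms(1) by (intro order.trans[OF card_mono card_Un_le]) auto
  moreover have "card ?I = card (y ` ?I)"
    using assms(2) by (intro card_image[symmetric]) (auto simp: inj_on_def)
  moreover have "y ` ?I = K \<inter> y ` {..<l}"
    by auto
  ultimately show ?thesis
    by simp
qed

context input
begin

definition cover :: "nat set \<Rightarrow> bool" where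
  "cover K \<longleftrightarrow> (\<forall>(u, v)\<in>gE. u \<in> K \<or> v \<in> K)"

text \<open>What was put into \<open>C\<close> so far costs at most 11/6 of what any cover spends on
  the same vertices. The denominator is cleared to stay within the natural numbers.\<close>

definition charged :: "store \<Rightarrow> bool" where
  "charged t \<longleftrightarrow> env t \<and> marked t ''C'' = {..<n} - marked t ''A'' \<and>
     (\<forall>K. cover K \<longrightarrow> 6 * card (marked t ''C'') \<le> 11 * card (K \<inter> marked t ''C''))"

lemma charged_cong:
  "charged s \<Longrightarrow> t ''A'' = s ''A'' \<Longrightarrow> t ''C'' = s ''C'' \<Longrightarrow> env t \<Longrightarrow> charged t"
proof -
  assume *: "charged s" "t ''A'' = s ''A''" "t ''C'' = s ''C''" "env t"
  have A: "marked t ''A'' = marked s ''A''" and C: "marked t ''C'' = marked s ''C''"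
    using *(2,3) by (simp_all add: marked_def)
  show ?thesis
    using *(1,4) unfolding charged_def A C by blast
qed

definition on_cycle :: "nat \<Rightarrow> (nat \<Rightarrow> nat) \<Rightarrow> nat set \<Rightarrow> bool" where
  "on_cycle l y A \<longleftrightarrow> (\<forall>i<l. y i \<in> A \<and> (y i, y (Suc i mod l)) \<in> gE)"

definition odd_free :: "nat \<Rightarrow> nat set \<Rightarrow> bool" where
  "odd_free l A \<longleftrightarrow> (\<forall>k v. odd k \<longrightarrow> k < l \<longrightarrow> (v, v) \<notin> (gE \<inter> A \<times> A) ^^ k)"

lemma relpow_mono: "(R :: ('x \<times> 'x) set) \<subseteq> R' \<Longrightarrow> R ^^ k \<subseteq> R' ^^ k"
proof (induction k)
  case (Suc k)
  then show ?case
    by (auto intro!: relcompI)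
qed simp

lemma odd_free_mono: "odd_free l A \<Longrightarrow> B \<subseteq> A \<Longrightarrow> odd_free l B"
  unfolding odd_free_def using relpow_mono[of "gE \<inter> B \<times> B" "gE \<inter> A \<times> A"] by blast

lemma drop_tuple_charged:
  assumes "charged s" "odd l" "l \<le> 11" "odd_free l (marked s ''A'')"
    and "on_cycle l (\<lambda>i. s (tup i) 0) (marked s ''A'')"
  shows "charged (den (drop_tuple l) s)" "marked (den (drop_tuple l) s) ''A'' \<subseteq> marked s ''A''"
    "\<not> on_cycle l (\<lambda>i. s (tup i) 0) (marked (den (drop_tuple l) s) ''A'')"
proof -
  let ?y = "\<lambda>i. s (tup i) 0" and ?t = "den (drop_tuple l) s"
  let ?Y = "?y ` {..<l}"
  have l0: "0 < l"
    using assms(2) by (cases l) auto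
  have Y: "?Y \<subseteq> marked s ''A''"
    using assms(5) by (auto simp: on_cycle_def)
  have A': "marked ?t ''A'' = marked s ''A'' - ?Y"
    by (auto simp: marked_def den_drop_tuple)
  have C': "marked ?t ''C'' = marked s ''C'' \<union> ?Y"
    using Y by (auto simp: marked_def den_drop_tuple)
  have R: "(?y i, ?y (Suc i mod l)) \<in> gE \<inter> marked s ''A'' \<times> marked s ''A''" if "i < l" for i
    using assms(5) that l0 unfolding on_cycle_def by simp
  have inj: "inj_on ?y {..<l}"
    using shortest_odd_closed_walk_inj[of l ?y "gE \<inter> marked s ''A'' \<times> marked s ''A''"] R assms(2,4)
    unfolding odd_free_def by blast
  have disj: "marked s ''C'' \<inter> ?Y = {}"
    using Y assms(1) unfolding charged_def by auto
  have "6 * card (marked ?t ''C'') \<le> 11 * card (K \<inter> marked ?t ''C'')" if K: "cover K" for K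
  proof -
    have "l \<le> 2 * card (K \<inter> ?Y)"
      by (rule cover_cycle[OF _ inj l0]) (use K R in \<open>auto simp: cover_def\<close>)
    then have "l + 1 \<le> 2 * card (K \<inter> ?Y)"
      using assms(2) by presburger
    \<comment> \<open>The inequality \<open>12 * l \<le> 11 * (l + 1)\<close> holds exactly up to
      \<open>l = 11\<close>.\<close>
    then have "6 * l \<le> 11 * card (K \<inter> ?Y)"
      using assms(3) by simp
    moreover have "card (marked ?t ''C'') = card (marked s ''C'') + l"
      unfolding C' using disj inj by (simp add: card_Un_disjoint card_image)
    moreover have "card (K \<inter> marked ?t ''C'') = card (K \<inter> marked s ''C'') + card (K \<inter> ?Y)"
    proof -
      have "K \<inter> marked ?t ''C'' = (K \<inter> marked s ''C'') \<union> (K \<inter> ?Y)"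
        unfolding C' by auto
      then show ?thesis
        using disj by (simp add: card_Un_disjoint Int_assoc disjoint_iff)
    qed
    moreover have "6 * card (marked s ''C'') \<le> 11 * card (K \<inter> marked s ''C'')"
      using assms(1) K unfolding charged_def by blast
    ultimately show ?thesis
      by simp
  qed
  moreover have "env ?t"
    using assms(1) writes_drop_tuple[of l] by (intro env_den) (auto simp: charged_def static_def)
  moreover have "marked ?t ''C'' = {..<n} - marked ?t ''A''"
    using assms(1) Y marked_subset[of s "''A''"] unfolding A' C' charged_def by auto
  ultimately show "charged ?t"
    by (simp add: charged_def)
  show "marked ?t ''A'' \<subseteq> marked s ''A''"
    unfolding A' by auto
  show "\<not> on_cycle l ?y (marked ?t ''A'')"
    using l0 unfolding A' on_cycle_def by (auto intro!: exI[of _ 0])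
qed

text \<open>Induction on the number \<open>k\<close> of inner loops, with the outer counters fixed.
  After its test a tuple is no closed walk in \<open>A\<close>, and this persists because
  \<open>A\<close> only shrinks.\<close>

lemma den_nest_cycles:
  assumes l: "odd l" "l \<le> 11" and "k \<le> l" "charged s" "odd_free l (marked s ''A'')"
    and "\<And>i. k \<le> i \<Longrightarrow> i < l \<Longrightarrow> s (tup i) 0 < n"
  shows "charged (den (nest k (If (cycle_test l) (drop_tuple l) Nop)) s) \<and>
    marked (den (nest k (If (cycle_test l) (drop_tuple l) Nop)) s) ''A'' \<subseteq> marked s ''A'' \<and>
    (\<forall>y. (\<forall>i<k. y i < n) \<longrightarrow> (\<forall>i. k \<le> i \<longrightarrow> i < l \<longrightarrow> y i = s (tup i) 0) \<longrightarrow>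
      \<not> on_cycle l y (marked (den (nest k (If (cycle_test l) (drop_tuple l) Nop)) s) ''A''))"
  using assms(3-)
proof (induction k arbitrary: s)
  case 0
  have l0: "0 < l"
    using l by (cases l) auto
  have lt: "s (tup i) 0 < n" if "i < l" for i
    using 0 that by simp
  have env: "env s"
    using 0 by (simp add: charged_def)
  have test: "bval (cycle_test l) s \<longleftrightarrow> on_cycle l (\<lambda>i. s (tup i) 0) (marked s ''A'')"
  proof -
    have "0 < s ''G'' (s ''vn'' (s (tup i) 0) + s (tup (Suc i mod l)) 0) \<longleftrightarrow>
        (s (tup i) 0, s (tup (Suc i mod l)) 0) \<in> gE" if "i < l" for i
      using env_simps(3)[OF env lt[OF that]] env_simps(6)[OF env lt[OF that] lt[of "Suc i mod l"]] l0 by simp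
    moreover have "s (tup i) 0 \<in> marked s ''A'' \<longleftrightarrow> 0 < s ''A'' (s (tup i) 0)" if "i < l" for i
      using lt[OF that] by (simp add: marked_def)
    moreover have "bval (cycle_test l) s \<longleftrightarrow> (\<forall>i<l. 0 < s ''A'' (s (tup i) 0) \<and>
        0 < s ''G'' (s ''vn'' (s (tup i) 0) + s (tup (Suc i mod l)) 0))"
      by (auto simp: cycle_test_def)
    ultimately show ?thesis
      unfolding on_cycle_def by meson
  qed
  have same: "on_cycle l y B \<longleftrightarrow> on_cycle l (\<lambda>i. s (tup i) 0) B" if "\<And>i. i < l \<Longrightarrow> y i = s (tup i) 0" for y B
    using that[of "Suc _ mod l"] that l0 unfolding on_cycle_def by simp
  show ?case
  proof (cases "bval (cycle_test l) s")
    case True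
    then have "on_cycle l (\<lambda>i. s (tup i) 0) (marked s ''A'')"
      using test by simp
    note D = drop_tuple_charged[OF 0(2) l 0(3) this]
    show ?thesis
      unfolding nest.simps den.simps if_P[OF True] using D same by blast
  next
    case False
    show ?thesis
      unfolding nest.simps den.simps if_not_P[OF False] using 0(2) False test same by blast
  qed
next
  case (Suc k)
  let ?p = "nest k (If (cycle_test l) (drop_tuple l) Nop)"
  let ?I = "\<lambda>j t. charged t \<and> marked t ''A'' \<subseteq> marked s ''A'' \<and>
    (\<forall>y. (\<forall>i<k. y i < n) \<longrightarrow> y k < j \<longrightarrow> (\<forall>i. Suc k \<le> i \<longrightarrow> i < l \<longrightarrow> y i = s (tup i) 0) \<longrightarrow> \<not> on_cycle l y (marked t ''A''))"
  have mono: "\<not> on_cycle l y A \<Longrightarrow> B \<subseteq> A \<Longrightarrow> \<not> on_cycle l y B" for y A B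
    by (auto simp: on_cycle_def)
  show ?case
    unfolding nest.simps
  proof (rule For_rule[where I = ?I])
    show "?I 0 s"
      using Suc.prems by simp
  next
    fix j t
    assume j: "j < s ''n'' 0" and I: "?I j t"
      and fr: "\<And>y. y \<noteq> tup k \<Longrightarrow> y \<notin> writes ?p \<Longrightarrow> t y = s y"
    let ?t = "set_cell (tup k) 0 j t"
    have jn: "j < n"
      using j Suc.prems(2) by (simp add: charged_def)
    have ch: "charged ?t"
      using I charged_cong[of t ?t] env_set_cell[of t "tup k"] by (auto simp: charged_def)
    have A: "marked ?t ''A'' = marked t ''A''"
      by (simp add: marked_def)
    have tup: "t (tup i) = s (tup i)" if "Suc k \<le> i" "i < l" for i
    proof (rule fr)
      show "tup i \<notin> writes ?p"
        using that writes_drop_tuple[of l] by (auto simp: writes_nest)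
    qed (use that in simp)
    have lt: "?t (tup i) 0 < n" if "k \<le> i" "i < l" for i
      using that jn tup[of i] Suc.prems(4)[of i] by (cases "i = k") auto
    have fr': "odd_free l (marked ?t ''A'')"
      using odd_free_mono Suc.prems(3) I A by metis
    note IH = Suc.IH[OF _ ch fr' lt]
    have "k \<le> l"
      using Suc.prems by simp
    show "?I (Suc j) (den ?p ?t)"
    proof (intro conjI allI impI)
      show "charged (den ?p ?t)" "marked (den ?p ?t) ''A'' \<subseteq> marked s ''A''"
        using IH[OF \<open>k \<le> l\<close>] I A by auto
      fix y assume y: "\<forall>i<k. y i < n" "y k < Suc j" "\<forall>i. Suc k \<le> i \<longrightarrow> i < l \<longrightarrow> y i = s (tup i) 0"
      show "\<not> on_cycle l y (marked (den ?p ?t) ''A'')"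
      proof (cases "y k = j")
        case True
        have "y i = ?t (tup i) 0" if "k \<le> i" "i < l" for i
          using that True tup[of i] y(3) by (cases "i = k") auto
        then show ?thesis
          using IH[OF \<open>k \<le> l\<close>] y by blast
      next
        case False
        then have "\<not> on_cycle l y (marked t ''A'')"
          using I y by simp
        then show ?thesis
          by (rule mono) (use IH[OF \<open>k \<le> l\<close>] A in simp)
      qed
    qed
  next
    fix t assume I: "?I (s ''n'' 0) t"
    let ?t = "set_cell (tup k) 0 (s ''n'' 0) t"
    have "s ''n'' 0 = n"
      using Suc.prems(2) by (simp add: charged_def)
    moreover have "charged ?t"
      using I charged_cong[of t ?t] env_set_cell[of t "tup k"] by (auto simp: charged_def)
    moreover have "marked ?t ''A'' = marked t ''A''"
      by (simp add: marked_def)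
    ultimately show "charged ?t \<and> marked ?t ''A'' \<subseteq> marked s ''A'' \<and>
      (\<forall>y. (\<forall>i<Suc k. y i < n) \<longrightarrow> (\<forall>i. Suc k \<le> i \<longrightarrow> i < l \<longrightarrow> y i = s (tup i) 0) \<longrightarrow> \<not> on_cycle l y (marked ?t ''A''))"
      using I by auto
  qed
qed

lemma den_cycles:
  assumes "odd l" "l \<le> 11" "charged s" "odd_free l (marked s ''A'')"
  shows "charged (den (cycles l) s)" "odd_free (l + 2) (marked (den (cycles l) s) ''A'')"
proof -
  let ?A = "marked (den (cycles l) s) ''A''"
  note C = den_nest_cycles[OF assms(1,2) order.refl assms(3,4), folded cycles_def]
  show "charged (den (cycles l) s)"
    using C by simp
  have l0: "0 < l"
    using assms(1) by (cases l) auto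
  have "(v, v) \<notin> (gE \<inter> ?A \<times> ?A) ^^ l" for v
  proof
    assume "(v, v) \<in> (gE \<inter> ?A \<times> ?A) ^^ l"
    then obtain f where f: "f 0 = v" "f l = v" "\<And>i. i < l \<Longrightarrow> (f i, f (Suc i)) \<in> gE \<inter> ?A \<times> ?A"
      unfolding relpow_fun_conv by blast
    have "on_cycle l f ?A"
      unfolding on_cycle_def
    proof (intro allI impI)
      fix i assume i: "i < l"
      have "f (Suc i mod l) = f (Suc i)"
        using f(1,2) i by (cases "Suc i = l") auto
      then show "f i \<in> ?A \<and> (f i, f (Suc i mod l)) \<in> gE"
        using f(3)[OF i] by simp
    qed
    moreover have "\<forall>i<l. f i < n"
      using f(3) marked_subset by fastforce
    ultimately show False
      using C by simp
  qed
  moreover have "odd_free l ?A"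
    using C odd_free_mono[OF assms(4)] by simp
  moreover have "k < l + 2 \<Longrightarrow> odd k \<Longrightarrow> k < l \<or> k = l" for k
    using assms(1) by (cases "k = l + 1") auto
  ultimately show "odd_free (l + 2) ?A"
    unfolding odd_free_def by metis
qed

lemma den_all_cycles:
  assumes "env s" "marked s ''A'' = {..<n}" "\<And>v. s ''C'' v = 0"
  shows "charged (den all_cycles s)" "odd_free 13 (marked (den all_cycles s) ''A'')"
proof -
  have "charged s"
    using assms by (auto simp: charged_def marked_def)
  moreover have "odd_free 3 (marked s ''A'')"
    unfolding odd_free_def
  proof (intro allI impI notI)
    fix k v assume "odd k" "k < 3" "(v, v) \<in> (gE \<inter> marked s ''A'' \<times> marked s ''A'') ^^ k"
    moreover from this have "k = 1"
      by (cases "k = 2") (auto simp: numeral_3_eq_3 less_Suc_eq)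
    ultimately show False
      using gE(3) by (auto simp: irrefl_def)
  qed
  ultimately show "charged (den all_cycles s)" "odd_free 13 (marked (den all_cycles s) ''A'')"
    using den_cycles[of 3 s] den_cycles[of 5 "den (cycles 3) s"] den_cycles[of 7 "den (cycles 5) (den (cycles 3) s)"]
      den_cycles[of 9 "den (cycles 7) (den (cycles 5) (den (cycles 3) s))"]
      den_cycles[of 11 "den (cycles 9) (den (cycles 7) (den (cycles 5) (den (cycles 3) s)))"]
    unfolding all_cycles_def by simp_all
qed

end

section \<open>Crown reduction\<close>

text \<open>Every left copy \<open>u\<close> of the bipartite double cover bids for a cheapest neighbour; \<open>ow r\<close> is the
  current owner of the right copy \<open>r\<close> (\<open>n\<close> if there is none), \<open>pr r\<close> its price, i.e. the number of
  bids for \<open>r\<close> so far. Bidders stop at price \<open>n + 1\<close>.\<close>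

locale auction =
  fixes n :: nat and gE :: "(nat \<times> nat) set" and A :: "nat set" and pr ow :: "nat \<Rightarrow> nat"
  assumes A_sub: "A \<subseteq> {..<n}"
    and owner: "\<And>r. r < n \<Longrightarrow> ow r < n \<Longrightarrow> r \<in> A \<and> ow r \<in> A \<and> (ow r, r) \<in> gE"
    and owner_inj: "\<And>r r'. r < n \<Longrightarrow> r' < n \<Longrightarrow> ow r < n \<Longrightarrow> ow r = ow r' \<Longrightarrow> r = r'"
    and owned: "\<And>r. r \<in> A \<Longrightarrow> 1 \<le> pr r \<Longrightarrow> ow r < n"
    and cheapest: "\<And>r r'. r < n \<Longrightarrow> ow r < n \<Longrightarrow> r' \<in> A \<Longrightarrow> (ow r, r') \<in> gE \<Longrightarrow> pr r \<le> pr r' + 1"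
    and price_le: "\<And>r. r < n \<Longrightarrow> pr r \<le> n + 1"

text \<open>A former owner of \<open>b\<close> just loses it. \<open>cheapest\<close> is kept
  because \<open>u\<close> took a cheapest neighbour, so that its raised price exceeds no other by
  more than one, and prices never fall.\<close>

lemma (in auction) bid:
  assumes "u \<in> A" "\<And>r. r < n \<Longrightarrow> ow r \<noteq> u" "b \<in> A" "(u, b) \<in> gE" "pr b \<le> n"
    and "\<And>r. r \<in> A \<Longrightarrow> (u, r) \<in> gE \<Longrightarrow> pr b \<le> pr r"
  shows "auction n gE A (pr(b := pr b + 1)) (ow(b := u))"
proof
  fix r r' assume *: "r < n" "r' < n" "(ow(b := u)) r < n" "(ow(b := u)) r = (ow(b := u)) r'"
  then show "r = r'"
    using assms(2) owner_inj by (auto split: if_splits)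
next
  fix r r' assume *: "r < n" "(ow(b := u)) r < n" "r' \<in> A" "((ow(b := u)) r, r') \<in> gE"
  show "(pr(b := pr b + 1)) r \<le> (pr(b := pr b + 1)) r' + 1"
  proof (cases "r = b")
    case True
    then show ?thesis
      using assms(6)[of r'] * by auto
  next
    case False
    then show ?thesis
      using cheapest[of r r'] * by (auto intro: le_SucI)
  qed
next
  show "A \<subseteq> {..<n}"
    by (rule A_sub)
  show "r \<in> A \<and> (ow(b := u)) r \<in> A \<and> ((ow(b := u)) r, r) \<in> gE" if "r < n" "(ow(b := u)) r < n" for r
    using owner[of r] assms(1,3,4) that by (cases "r = b") simp_all
  show "(ow(b := u)) r < n" if "r \<in> A" "1 \<le> (pr(b := pr b + 1)) r" for r
    using owned[of r] assms(1) A_sub that by (cases "r = b") auto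
  show "(pr(b := pr b + 1)) r \<le> n + 1" if "r < n" for r
    using price_le[of r] assms(5) that by (cases "r = b") simp_all
qed

text \<open>\<open>K\<close> meets each pair of \<open>u\<close> and \<open>f u\<close>; as
  \<open>f\<close> is injective, a vertex of \<open>K\<close> is counted at most twice.\<close>

lemma perfect_two_matching:
  assumes "finite R" "f ` R \<subseteq> R" "inj_on f R" "\<And>u. u \<in> R \<Longrightarrow> u \<in> K \<or> f u \<in> K"
  shows "card R \<le> 2 * card (K \<inter> R)"
proof -
  have "card {u \<in> R. f u \<in> K} = card (f ` {u \<in> R. f u \<in> K})"
    using assms(3) by (intro card_image[symmetric]) (auto simp: inj_on_def)
  also have "\<dots> \<le> card (K \<inter> R)"
    using assms(1,2) by (intro card_mono) auto
  finally have "card {u \<in> R. f u \<in> K} \<le> card (K \<inter> R)" .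
  moreover have "card R \<le> card (K \<inter> R) + card {u \<in> R. f u \<in> K}"
    using assms(1,4) by (intro order.trans[OF card_mono card_Un_le]) auto
  ultimately show ?thesis by simp
qed

text \<open>No item of \<open>A\<close> has price \<open>k - 1\<close>. An owner's item costs at
  most one more than any neighbour, so a bidder above this gap has all its neighbours above the gap
  as well.\<close>

locale auction_end = auction +
  fixes k :: nat
  assumes stuck: "\<And>u r. u \<in> A \<Longrightarrow> (\<And>r. r < n \<Longrightarrow> ow r \<noteq> u) \<Longrightarrow> r \<in> A \<Longrightarrow> (u, r) \<in> gE \<Longrightarrow> n + 1 \<le> pr r"
    and k: "1 \<le> k" "k \<le> n + 1" "\<And>r. r \<in> A \<Longrightarrow> pr r \<noteq> k - 1"
    and sym: "sym gE"
begin

text \<open>Bidders without an item belong here too; their neighbours have reached the maximal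
  price. In the half-integral solution read off from the gap, \<open>dear - bidders\<close> gets 1,
  \<open>bidders - dear\<close> gets 0 and every other vertex 1/2.\<close>

definition bidders :: "nat set" where
  "bidders = {u \<in> A. \<forall>r<n. ow r = u \<longrightarrow> k \<le> pr r}"

definition dear :: "nat set" where
  "dear = {u \<in> A. k \<le> pr u}"

lemma bidders_neighbours:
  assumes "u \<in> bidders" "r \<in> A" "(u, r) \<in> gE"
  shows "r \<in> dear"
proof (cases "\<exists>r'<n. ow r' = u")
  case True
  then obtain r' where r': "r' < n" "ow r' = u" by blast
  then have "k \<le> pr r'" "u < n"
    using assms(1) A_sub by (auto simp: bidders_def)
  moreover have "pr r' \<le> pr r + 1"
    using cheapest[of r' r] r' assms \<open>u < n\<close> by simp
  ultimately show ?thesis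
    using k(1) k(3)[OF assms(2)] assms(2) by (simp add: dear_def)
next
  case False
  then have "n + 1 \<le> pr r"
    using stuck[of u r] assms by (auto simp: bidders_def)
  then show ?thesis
    using k(2) assms(2) by (simp add: dear_def)
qed

lemma owner_dear:
  assumes "r \<in> dear"
  shows "ow r \<in> bidders" "(ow r, r) \<in> gE" "r < n" "ow r < n"
proof -
  have r: "r \<in> A" "k \<le> pr r" "r < n"
    using assms A_sub by (auto simp: dear_def)
  then have "ow r < n"
    using owned k(1) by (meson order_trans)
  moreover have "k \<le> pr r'" if "r' < n" "ow r' = ow r" for r'
    using owner_inj[OF r(3) that(1) \<open>ow r < n\<close>] r(2) that(2) by simp
  ultimately show "ow r \<in> bidders" "(ow r, r) \<in> gE" "r < n" "ow r < n"
    using owner[OF r(3)] r unfolding bidders_def by auto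
qed

lemma finite_A: "finite A"
  using A_sub finite_subset by blast

text \<open>The owner of a core item \<open>r\<close> is a neighbour of the bidder \<open>r\<close>
  and hence dear itself. So \<open>ow\<close> maps the finite core injectively into itself, thus
  onto itself.\<close>

lemma owner_core: "ow ` (bidders \<inter> dear) = bidders \<inter> dear"
proof (rule card_subset_eq)
  show "finite (bidders \<inter> dear)"
    using finite_A by (simp add: bidders_def)
  show sub: "ow ` (bidders \<inter> dear) \<subseteq> bidders \<inter> dear"
  proof
    fix u assume "u \<in> ow ` (bidders \<inter> dear)"
    then obtain r where r: "r \<in> bidders" "r \<in> dear" "u = ow r" by blast
    then have "u \<in> bidders" "(r, u) \<in> gE"
      using owner_dear[OF r(2)] sym by (auto dest: symD)
    then show "u \<in> bidders \<inter> dear"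
      using bidders_neighbours[OF r(1), of u] by (auto simp: bidders_def)
  qed
  have "inj_on ow (bidders \<inter> dear)"
    by (intro inj_onI) (metis IntD2 owner_dear(3,4) owner_inj)
  then show "card (ow ` (bidders \<inter> dear)) = card (bidders \<inter> dear)"
    by (rule card_image)
qed

text \<open>The owner of an item in \<open>dear - bidders\<close> is not dear: otherwise it would
  lie in the core and, by \<open>owner_core\<close>, own a second item there. So these items are
  matched into \<open>bidders - dear\<close>, and \<open>K\<close> meets every matching
  edge.\<close>

lemma crown_le:
  assumes K: "\<And>u v. (u, v) \<in> gE \<Longrightarrow> u \<in> K \<or> v \<in> K"
  shows "card (dear - bidders) \<le> card (K \<inter> (bidders - dear \<union> (dear - bidders)))"
proof -
  have out: "ow r \<in> bidders - dear" if "r \<in> dear - bidders" for r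
  proof -
    have "ow r \<notin> dear"
    proof
      assume "ow r \<in> dear"
      then have "ow r \<in> ow ` (bidders \<inter> dear)"
        using that owner_dear(1)[of r] owner_core by auto
      then obtain r' where r': "r' \<in> bidders" "r' \<in> dear" "ow r = ow r'"
        by blast
      then have "r = r'"
        using owner_inj[of r r'] owner_dear[of r] owner_dear[of r'] that by blast
      then show False
        using r' that by simp
    qed
    then show ?thesis
      using owner_dear(1)[of r] that by simp
  qed
  let ?f = "\<lambda>r. if r \<in> K then r else ow r"
  have "inj_on ?f (dear - bidders)"
  proof (rule inj_onI)
    fix r r' assume *: "r \<in> dear - bidders" "r' \<in> dear - bidders" "?f r = ?f r'"
    then show "r = r'"
      using out[of r] out[of r'] owner_inj[of r r'] owner_dear(3,4)[of r] owner_dear(3)[of r'] by (auto split: if_splits)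
  qed
  moreover have "?f ` (dear - bidders) \<subseteq> K \<inter> (bidders - dear \<union> (dear - bidders))"
  proof
    fix u assume "u \<in> ?f ` (dear - bidders)"
    then obtain r where r: "r \<in> dear - bidders" "u = ?f r" by blast
    then show "u \<in> K \<inter> (bidders - dear \<union> (dear - bidders))"
      using out[OF r(1)] K[of "ow r" r] owner_dear(2)[of r] by (cases "r \<in> K") auto
  qed
  moreover have "finite (K \<inter> (bidders - dear \<union> (dear - bidders)))"
    using finite_A by (simp add: bidders_def dear_def)
  ultimately show ?thesis
    by (rule card_inj_on_le)
qed

text \<open>A vertex of the core is sent to its owner, any other vertex of \<open>R\<close> to an
  item it owns. Each map is injective, follows edges and stays in its part.\<close>

lemma kernel_le:
  assumes K: "\<And>u v. (u, v) \<in> gE \<Longrightarrow> u \<in> K \<or> v \<in> K"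
  defines "R \<equiv> A - (bidders - dear \<union> (dear - bidders))"
  shows "card R \<le> 2 * card (K \<inter> R)"
proof -
  have item: "\<exists>r. ow r = u \<and> r < n \<and> r \<in> A - bidders - dear \<and> (u, r) \<in> gE" if u: "u \<in> A - bidders - dear" for u
  proof -
    obtain r where r: "r < n" "ow r = u" "pr r < k"
      using u unfolding bidders_def by (auto simp: not_le)
    have "ow r < n"
      using u r(2) A_sub by auto
    then have r': "r \<in> A" "(u, r) \<in> gE"
      using owner[OF r(1)] r by auto
    then have "r \<notin> bidders"
      using bidders_neighbours[of r u] u sym by (auto dest: symD)
    then show ?thesis
      using r r' by (auto simp: dear_def)
  qed
  obtain g where g: "\<And>u. u \<in> A - bidders - dear \<Longrightarrow> ow (g u) = u \<and> g u < n \<and> g u \<in> A - bidders - dear \<and> (u, g u) \<in> gE"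
    using item by metis
  let ?f = "\<lambda>u. if u \<in> dear then ow u else g u"
  have R: "u \<in> R \<longleftrightarrow> u \<in> bidders \<inter> dear \<or> u \<in> A - bidders - dear" for u
    by (auto simp: R_def bidders_def dear_def)
  have core: "ow u \<in> bidders \<inter> dear" if "u \<in> bidders \<inter> dear" for u
    using owner_core that by blast
  show ?thesis
  proof (rule perfect_two_matching[where f = ?f])
    show "finite R"
      using finite_A by (simp add: R_def)
    show "?f ` R \<subseteq> R"
      using core g R by auto
    show "inj_on ?f R"
    proof (rule inj_onI)
      fix u v assume *: "u \<in> R" "v \<in> R" "?f u = ?f v"
      show "u = v"
      proof (cases "u \<in> dear"; cases "v \<in> dear")
        assume "u \<in> dear" "v \<in> dear"
        then show ?thesis
          using * owner_inj[of u v] owner_dear(3,4)[of u] owner_dear(3)[of v] by simp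
      next
        assume "u \<in> dear" "v \<notin> dear"
        then show ?thesis
          using * core[of u] g[of v] R[of u] R[of v] by auto
      next
        assume "u \<notin> dear" "v \<in> dear"
        then show ?thesis
          using * core[of v] g[of u] R[of u] R[of v] by auto
      next
        assume "u \<notin> dear" "v \<notin> dear"
        then have "g u = g v" "u \<in> A - bidders - dear" "v \<in> A - bidders - dear"
          using * R by auto
        then show ?thesis
          using g by metis
      qed
    qed
    show "u \<in> K \<or> ?f u \<in> K" if "u \<in> R" for u
    proof (cases "u \<in> dear")
      case True
      then show ?thesis
        using K[OF owner_dear(2)[OF True]] by simp blast
    next
      case False
      then have "u \<in> A - bidders - dear"
        using R[of u] that by blast
      then have "(u, g u) \<in> gE"
        using g by blast
      then show ?thesis
        using K[of u "g u"] False by simp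
    qed
  qed
qed

end

section \<open>The auction as a program\<close>

definition find_item :: prog where
  "find_item =
     put ''f'' (Const 0) ;;
     For ''r'' ''n'' (If (eq (Read ''ow'' (cell ''r'')) (cell ''u'')) (put ''f'' (Const 1)) Nop)"

text \<open>Index \<open>n\<close> serves as a sentinel of price \<open>n + 1\<close>. The strict
  comparison rejects items of that price, and the result \<open>n\<close> means that nothing can be
  bid for.\<close>

definition find_cheapest :: prog where
  "find_cheapest =
     put ''b'' (cell ''n'') ;;
     For ''r'' ''n''
       (If (Conj (true (Read ''A'' (cell ''r''))) (Conj (true (G_at (cell ''u'') (cell ''r'')))
             (Less (Read ''pr'' (cell ''r'')) (Read ''pr'' (cell ''b'')))))
          (put ''b'' (cell ''r'')) Nop)"

definition bid :: prog where
  "bid =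
     find_item ;;
     If (Conj (Neg (true (cell ''f''))) (true (Read ''A'' (cell ''u''))))
       (find_cheapest ;;
        If (Less (cell ''b'') (cell ''n''))
          (Assign ''ow'' (cell ''b'') (cell ''u'') ;;
           Assign ''pr'' (cell ''b'') (Add (Read ''pr'' (cell ''b'')) (Const 1)))
          Nop)
       Nop"

definition pass :: prog where
  "pass = For ''u'' ''n'' bid"

text \<open>A block of \<open>n * n\<close> passes. Three blocks are run, since
  \<open>3 * n * n\<close> exceeds the largest possible sum of prices, \<open>n * (n + 1)\<close>,
  for positive \<open>n\<close>.\<close>

definition passes :: prog where
  "passes = For ''a'' ''n'' (For ''b1'' ''n'' pass)"

context input
begin

abbreviation running :: "store \<Rightarrow> bool" where
  "running t \<equiv> env t \<and> auction n gE (marked t ''A'') (t ''pr'') (t ''ow'') \<and> t ''pr'' n = n + 1"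

definition happy :: "store \<Rightarrow> nat \<Rightarrow> bool" where
  "happy t u \<longleftrightarrow> u \<in> marked t ''A'' \<longrightarrow> (\<forall>r<n. t ''ow'' r \<noteq> u) \<longrightarrow>
     (\<forall>r\<in>marked t ''A''. (u, r) \<in> gE \<longrightarrow> n + 1 \<le> t ''pr'' r)"

definition total :: "store \<Rightarrow> nat" where
  "total t = (\<Sum>r<n. t ''pr'' r)"

lemma writes_find_item [simp]: "writes find_item = {''f'', ''r''}"
  and writes_find_cheapest [simp]: "writes find_cheapest = {''b'', ''r''}"
  and writes_bid [simp]: "writes bid = {''f'', ''r'', ''b'', ''ow'', ''pr''}"
  and writes_pass [simp]: "writes pass = {''u'', ''f'', ''r'', ''b'', ''ow'', ''pr''}"
  by (auto simp: find_item_def find_cheapest_def bid_def pass_def)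

lemma den_find_item:
  assumes "env s"
  shows "den find_item s ''f'' 0 = of_bool (\<exists>r<n. s ''ow'' r = s ''u'' 0)"
proof -
  have "den (For ''r'' ''n'' (If (eq (Read ''ow'' (cell ''r'')) (cell ''u'')) (put ''f'' (Const 1)) Nop)) t ''f'' 0
      = (if \<exists>r<n. t ''ow'' r = t ''u'' 0 then 1 else t ''f'' 0)" if "t ''n'' 0 = n" for t
    using that by (intro den_flag_loop) simp_all
  from this[of "set_cell ''f'' 0 0 s"] assms show ?thesis
    by (simp add: find_item_def)
qed

lemma den_find_cheapest:
  assumes "env s" "s ''u'' 0 < n" "s ''pr'' n = n + 1"
  defines "b \<equiv> den find_cheapest s ''b'' 0"
  shows "b \<le> n" "b < n \<Longrightarrow> b \<in> marked s ''A'' \<and> (s ''u'' 0, b) \<in> gE \<and> s ''pr'' b \<le> n"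
    "\<And>r. r \<in> marked s ''A'' \<Longrightarrow> (s ''u'' 0, r) \<in> gE \<Longrightarrow> s ''pr'' b \<le> s ''pr'' r"
proof -
  let ?Q = "\<lambda>i b. b \<le> n \<and> s ''pr'' b \<le> n + 1 \<and> (b < n \<longrightarrow> b \<in> marked s ''A'' \<and> (s ''u'' 0, b) \<in> gE \<and> s ''pr'' b \<le> n) \<and>
     (\<forall>r<i. 0 < s ''A'' r \<longrightarrow> (s ''u'' 0, r) \<in> gE \<longrightarrow> s ''pr'' b \<le> s ''pr'' r)"
  let ?c = "Conj (true (Read ''A'' (cell ''r''))) (Conj (true (G_at (cell ''u'') (cell ''r'')))
             (Less (Read ''pr'' (cell ''r'')) (Read ''pr'' (cell ''b''))))"
  let ?s = "set_cell ''b'' 0 n s"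
  have "?Q n (den (For ''r'' ''n'' (If ?c (put ''b'' (cell ''r'')) Nop)) ?s ''b'' 0)"
  proof (rule For_rule_bound[where I = "\<lambda>i t. ?Q i (t ''b'' 0)" and k = n])
    show "?s ''n'' 0 = n" "?Q 0 (?s ''b'' 0)"
      using assms by simp_all
  next
    fix i and t :: store
    assume i: "i < n" and I: "?Q i (t ''b'' 0)"
      and "\<And>y. y \<noteq> ''r'' \<Longrightarrow> y \<notin> writes (If ?c (put ''b'' (cell ''r'')) Nop) \<Longrightarrow> t y = ?s y"
    then have t: "t ''A'' = s ''A''" "t ''G'' = s ''G''" "t ''pr'' = s ''pr''" "t ''u'' = s ''u''" "t ''vn'' = s ''vn''"
      by simp_all
    let ?t = "set_cell ''r'' 0 i t"
    have c: "bval ?c ?t \<longleftrightarrow> 0 < s ''A'' i \<and> (s ''u'' 0, i) \<in> gE \<and> s ''pr'' i < s ''pr'' (t ''b'' 0)"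
      using t env_simps(3)[OF assms(1,2)] env_simps(6)[OF assms(1,2) i] by simp
    show "?Q (Suc i) (den (If ?c (put ''b'' (cell ''r'')) Nop) ?t ''b'' 0)"
    proof (cases "bval ?c ?t")
      case True
      have den: "den (If ?c (put ''b'' (cell ''r'')) Nop) ?t ''b'' 0 = i"
        unfolding den.simps if_P[OF True] by simp
      show ?thesis
        unfolding den using True[unfolded c] I i by (auto simp: less_Suc_eq marked_def)
    next
      case False
      have den: "den (If ?c (put ''b'' (cell ''r'')) Nop) ?t ''b'' 0 = t ''b'' 0"
        unfolding den.simps if_not_P[OF False] by simp
      show ?thesis
        unfolding den using False[unfolded c] I by (auto simp: less_Suc_eq)
    qed
  qed simp
  moreover have "den find_cheapest s = den (For ''r'' ''n'' (If ?c (put ''b'' (cell ''r'')) Nop)) ?s"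
    using assms(1) by (simp add: find_cheapest_def)
  ultimately have "?Q n b"
    unfolding b_def by simp
  then show "b \<le> n" "b < n \<Longrightarrow> b \<in> marked s ''A'' \<and> (s ''u'' 0, b) \<in> gE \<and> s ''pr'' b \<le> n"
    "\<And>r. r \<in> marked s ''A'' \<Longrightarrow> (s ''u'' 0, r) \<in> gE \<Longrightarrow> s ''pr'' b \<le> s ''pr'' r"
    unfolding marked_def by auto
qed

lemma den_bid:
  assumes s: "running s" and u: "s ''u'' 0 < n"
  shows "running (den bid s)" "total s \<le> total (den bid s)"
    "happy s (s ''u'' 0) \<or> total s < total (den bid s)"
    "happy s (s ''u'' 0) \<or> total (den bid s) = total s \<Longrightarrow> den bid s ''pr'' = s ''pr'' \<and> den bid s ''ow'' = s ''ow''"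
proof -
  define t where "t = den find_item s"
  have t_fr: "t x = s x" if "x \<notin> {''f'', ''r''}" for x
    unfolding t_def using that by (intro den_frame) simp
  have t: "t ''u'' = s ''u''" "t ''A'' = s ''A''" "t ''pr'' = s ''pr''" "t ''ow'' = s ''ow''" "env t"
    using t_fr s by (simp_all add: t_def env_den static_def)
  have f: "t ''f'' 0 = of_bool (\<exists>r<n. s ''ow'' r = s ''u'' 0)"
    unfolding t_def using s by (intro den_find_item) simp
  define w where "w = den find_cheapest t"
  have w_fr: "w x = t x" if "x \<notin> {''b'', ''r''}" for x
    unfolding w_def using that by (intro den_frame) simp
  have w: "w ''u'' = s ''u''" "w ''A'' = s ''A''" "w ''pr'' = s ''pr''" "w ''ow'' = s ''ow''" "env w"
    using w_fr t by (simp_all add: w_def env_den static_def)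
  define b where "b = w ''b'' 0"
  have tm: "marked t ''A'' = marked s ''A''"
    using t by (simp add: marked_def)
  have b: "b \<le> n" "b < n \<Longrightarrow> b \<in> marked s ''A'' \<and> (s ''u'' 0, b) \<in> gE \<and> s ''pr'' b \<le> n"
    "\<And>r. r \<in> marked s ''A'' \<Longrightarrow> (s ''u'' 0, r) \<in> gE \<Longrightarrow> s ''pr'' b \<le> s ''pr'' r"
    using den_find_cheapest[of t] t u s tm unfolding b_def w_def by simp_all
  interpret auction n gE "marked s ''A''" "s ''pr''" "s ''ow''"
    using s by blast
  let ?idle = "(\<exists>r<n. s ''ow'' r = s ''u'' 0) \<or> s ''A'' (s ''u'' 0) = 0"
  consider (idle) "?idle" | (stuck) "\<not> ?idle" "b = n" | (bids) "\<not> ?idle" "b < n"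
    using b(1) le_neq_implies_less by blast
  then have "running (den bid s) \<and> total s \<le> total (den bid s) \<and> (happy s (s ''u'' 0) \<or> total s < total (den bid s)) \<and>
    (happy s (s ''u'' 0) \<or> total (den bid s) = total s \<longrightarrow> den bid s ''pr'' = s ''pr'' \<and> den bid s ''ow'' = s ''ow'')"
  proof cases
    case idle
    then have "den bid s = t"
      using f t by (auto simp: bid_def t_def[symmetric])
    moreover have "happy s (s ''u'' 0)"
      using idle by (auto simp: happy_def marked_def)
    ultimately show ?thesis
      using s t tm by (simp add: total_def)
  next
    case stuck
    then have "den bid s = w"
      using f t w b_def by (simp add: bid_def t_def[symmetric] w_def[symmetric])
    moreover have "happy s (s ''u'' 0)"
      using stuck b(3) s by (auto simp: happy_def)
    moreover have "marked w ''A'' = marked s ''A''"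
      using w by (simp add: marked_def)
    ultimately show ?thesis
      using s w by (simp add: total_def)
  next
    case bids
    then have B: "b \<in> marked s ''A''" "(s ''u'' 0, b) \<in> gE" "s ''pr'' b \<le> n"
      using b(2) by auto
    have den: "den bid s = set_cell ''pr'' b (s ''pr'' b + 1) (set_cell ''ow'' b (s ''u'' 0) w)"
      using bids f t w b_def by (simp add: bid_def t_def[symmetric] w_def[symmetric])
    have new: "den bid s ''pr'' = (s ''pr'')(b := s ''pr'' b + 1)" "den bid s ''ow'' = (s ''ow'')(b := s ''u'' 0)"
        "marked (den bid s) ''A'' = marked s ''A''"
      unfolding den using w by (auto simp: marked_def fun_eq_iff)
    have "auction n gE (marked s ''A'') ((s ''pr'')(b := s ''pr'' b + 1)) ((s ''ow'')(b := s ''u'' 0))"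
      using bids B u b(3) by (intro bid) (auto simp: marked_def)
    moreover have "env (den bid s)"
      unfolding den using w by (intro env_set_cell) (auto simp: static_def)
    moreover have "den bid s ''pr'' n = n + 1"
      using s bids by (simp add: new)
    moreover have "total (den bid s) = total s + 1"
    proof -
      have "total (den bid s) = (\<Sum>r<n. s ''pr'' r + (if r = b then 1 else 0))"
        unfolding total_def new by (intro sum.cong) auto
      then show ?thesis
        using bids(2) by (simp add: sum.distrib total_def)
    qed
    moreover have "\<not> happy s (s ''u'' 0)"
      using bids(1) B u by (auto simp: happy_def marked_def not_le intro!: exI[of _ b] le_imp_less_Suc)
    ultimately show ?thesis
      by (simp add: new)
  qed
  then show "running (den bid s)" "total s \<le> total (den bid s)"
    "happy s (s ''u'' 0) \<or> total s < total (den bid s)"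
    "happy s (s ''u'' 0) \<or> total (den bid s) = total s \<Longrightarrow> den bid s ''pr'' = s ''pr'' \<and> den bid s ''ow'' = s ''ow''"
    by blast+
qed

lemma happy_cong: "t ''pr'' = s ''pr'' \<Longrightarrow> t ''ow'' = s ''ow'' \<Longrightarrow> t ''A'' = s ''A'' \<Longrightarrow> happy t u = happy s u"
  by (simp add: happy_def marked_def)

lemma running_set_cell: "running t \<Longrightarrow> x \<notin> static \<union> {''A'', ''pr'', ''ow''} \<Longrightarrow> running (set_cell x i k t)"
  using env_set_cell[of t x i k] by (auto simp: marked_def)

text \<open>A bid can take the item of a vertex that was happy before, so progress is measured by
  the sum of the prices. A pass that leaves this sum unchanged has met only happy vertices and
  changed neither prices nor owners.\<close>

lemma den_pass:
  assumes s: "running s"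
  shows "running (den pass s) \<and> ((\<forall>u<n. happy (den pass s) u) \<or> total s < total (den pass s)) \<and>
    ((\<forall>u<n. happy s u) \<longrightarrow> (\<forall>u<n. happy (den pass s) u))"
proof -
  let ?same = "\<lambda>t. t ''pr'' = s ''pr'' \<and> t ''ow'' = s ''ow''"
  let ?I = "\<lambda>i t. running t \<and> t ''A'' = s ''A'' \<and> total s \<le> total t \<and>
    ((\<forall>u<i. happy s u) \<or> total s < total t) \<and> ((\<forall>u<i. happy s u) \<or> total t = total s \<longrightarrow> ?same t)"
  have "?I n (den pass s)"
    unfolding pass_def
  proof (rule For_rule_bound[where I = ?I and k = n])
    show "s ''n'' 0 = n"
      using s by simp
    show "?I 0 s"
      using s by simp
    show "?I n (set_cell ''u'' 0 n t)" if "?I n t" for t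
      using that running_set_cell[of t "''u''" 0 n] by (auto simp: static_def total_def)
  next
    fix i t assume i: "i < n" and I: "?I i t"
    let ?t = "set_cell ''u'' 0 i t"
    have run: "running ?t"
      using I by (intro running_set_cell) (auto simp: static_def)
    have eq: "total ?t = total t" "?t ''A'' = s ''A''" "?t ''u'' 0 = i" "?t ''pr'' = t ''pr''" "?t ''ow'' = t ''ow''"
      using I by (simp_all add: total_def)
    have A: "den bid ?t ''A'' = s ''A''"
      using den_frame[of "''A''" bid ?t] eq by simp
    note B = den_bid[OF run, unfolded eq, OF i]
    have hap: "happy ?t i = happy s i" if "?same t"
      using that eq by (intro happy_cong) auto
    show "?I (Suc i) (den bid ?t)"
    proof (cases "?same t")
      case True
      then have tot: "total t = total s"
        by (simp add: total_def)
      show ?thesis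
        using B hap[OF True] True tot I A by (auto simp: less_Suc_eq)
    next
      case False
      then have "\<not> (\<forall>u<i. happy s u)" "total s < total t"
        using I by (auto simp: le_less)
      then show ?thesis
        using B I A by auto
    qed
  qed
  then show ?thesis
    using happy_cong[of "den pass s" s] by blast
qed

lemma den_passes:
  assumes s: "running s"
  shows "running (den (passes ;; passes ;; passes) s)" "\<And>u. u < n \<Longrightarrow> happy (den (passes ;; passes ;; passes) s) u"
proof -
  let ?J = "\<lambda>k t. running t \<and> ((\<forall>u<n. happy t u) \<or> k \<le> total t)"
  have loop: "?J (k + n * c) (den (For x ''n'' p) t)"
    if p: "\<And>k t. ?J k t \<Longrightarrow> ?J (k + c) (den p t)" and t: "?J k t" and x: "x \<notin> static \<union> {''A'', ''pr'', ''ow''}" for p c x k t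
  proof (rule For_rule_bound[where I = "\<lambda>i t. ?J (k + i * c) t" and k = n])
    have set: "?J k (set_cell x 0 i t)" if "?J k t" for k i t
    proof -
      have "t y = set_cell x 0 i t y" if "y \<in> {''A'', ''pr'', ''ow''}" for y
        using x that by auto
      then have "happy (set_cell x 0 i t) u = happy t u" "total (set_cell x 0 i t) = total t" for u
        by (auto simp: happy_def total_def marked_def)
      then show ?thesis
        using that running_set_cell[OF _ x] by simp
    qed
    show "t ''n'' 0 = n" "?J (k + 0 * c) t"
      using t by simp_all
    show "?J (k + Suc i * c) (den p (set_cell x 0 i t'))" if "?J (k + i * c) t'" for i t'
      using p[OF set[OF that, of i]] by (simp add: add.commute add.left_commute)
    show "?J (k + n * c) (set_cell x 0 n t')" if "?J (k + n * c) t'" for t'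
      using set[OF that] .
  qed
  have pass: "?J (k + 1) (den pass t)" if "?J k t" for k t
    using den_pass[of t] that by auto
  have inner: "?J (k + n * 1) (den (For ''b1'' ''n'' pass) t)" if "?J k t" for k t
    by (rule loop[OF pass that]) (auto simp: static_def)
  have passes: "?J (k + n * (n * 1)) (den passes t)" if "?J k t" for k t
    unfolding passes_def by (rule loop[OF inner that]) (auto simp: static_def)
  have "?J 0 s"
    using s by simp
  from passes[OF passes[OF passes[OF this]]]
  have J: "?J (n * n + n * n + n * n) (den (passes ;; passes ;; passes) s)"
    by simp
  then show "running (den (passes ;; passes ;; passes) s)"
    by simp
  have "total (den (passes ;; passes ;; passes) s) \<le> (\<Sum>r<n. n + 1)"
    unfolding total_def using J by (intro sum_mono) (auto dest: auction.price_le)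
  then have "\<forall>u<n. happy (den (passes ;; passes ;; passes) s) u" if "0 < n"
  proof -
    have "n \<le> n * n" "(\<Sum>r<n. n + 1) = n * n + n"
      by simp_all
    then have "\<not> n * n + n * n + n * n \<le> (\<Sum>r<n. n + 1)"
      using that by linarith
    then show ?thesis
      using J \<open>total _ \<le> _\<close> by (meson order_trans)
  qed
  then show "\<And>u. u < n \<Longrightarrow> happy (den (passes ;; passes ;; passes) s) u"
    by auto
qed

end

section \<open>Price gaps and the removal of the crown\<close>

definition free_items :: prog where
  "free_items =
     For ''r'' ''n'' (Assign ''ow'' (cell ''r'') (cell ''n'')) ;;
     Assign ''pr'' (cell ''n'') (Add (cell ''n'') (Const 1))"

definition price_used :: prog where
  "price_used =
     put ''f'' (Const 0) ;;
     For ''r'' ''n''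
       (If (Conj (true (Read ''A'' (cell ''r''))) (eq (Read ''pr'' (cell ''r'')) (cell ''c''))) (put ''f'' (Const 1)) Nop)"

text \<open>The default \<open>n + 1\<close> claims a gap at price \<open>n\<close>: if every price
  below \<open>n\<close> occurs, the at most \<open>n\<close> vertices of \<open>A\<close> leave
  none for price \<open>n\<close>.\<close>

definition find_gap :: prog where
  "find_gap =
     put ''k'' (Add (cell ''n'') (Const 1)) ;;
     For ''c'' ''n'' (price_used ;; If (true (cell ''f'')) Nop (put ''k'' (Add (cell ''c'') (Const 1))))"

definition is_bidder :: prog where
  "is_bidder =
     put ''f'' (Const 1) ;;
     For ''r'' ''n''
       (If (Conj (eq (Read ''ow'' (cell ''r'')) (cell ''u'')) (Less (Read ''pr'' (cell ''r'')) (cell ''k'')))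
          (put ''f'' (Const 0)) Nop)"

definition remove_crown :: prog where
  "remove_crown =
     For ''u'' ''n''
       (is_bidder ;;
        If (true (Read ''A'' (cell ''u'')))
          (If (true (cell ''f''))
             (If (Less (Read ''pr'' (cell ''u'')) (cell ''k'')) (Assign ''A'' (cell ''u'') (Const 0)) Nop)
             (If (Less (Read ''pr'' (cell ''u'')) (cell ''k'')) Nop
                (Assign ''A'' (cell ''u'') (Const 0) ;; Assign ''C'' (cell ''u'') (Const 1))))
          Nop)"

definition reduce :: prog where
  "reduce = free_items ;; (passes ;; passes ;; passes) ;; find_gap ;; remove_crown"

context input
begin

lemma den_free_items:
  assumes "env s" "\<And>r. s ''pr'' r = 0"
  shows "running (den free_items s)"
proof -
  let ?p = "Assign ''ow'' (cell ''r'') (cell ''n'')"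
  define t where "t = den (For ''r'' ''n'' ?p) s"
  have t: "\<forall>r<n. t ''ow'' r = n"
    unfolding t_def
    by (rule For_rule_bound[where I = "\<lambda>i t. \<forall>r<i. t ''ow'' r = n" and k = n])
      (use assms in \<open>auto simp: less_Suc_eq\<close>)
  have fr: "t x = s x" if "x \<notin> {''ow'', ''r''}" for x
    unfolding t_def using that by (intro den_frame) simp
  have env: "env t"
    unfolding t_def using assms by (intro env_den) (auto simp: static_def)
  have den: "den free_items s = set_cell ''pr'' n (n + 1) t"
    using env by (simp add: free_items_def t_def)
  have "auction n gE (marked t ''A'') ((s ''pr'')(n := n + 1)) (t ''ow'')"
    using t assms(2) by unfold_locales (auto simp: marked_def)
  then show ?thesis
    unfolding den using env env_set_cell[OF env, of "''pr''"] fr[of "''pr''"] by (simp add: marked_def static_def)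
qed

lemma den_price_used:
  assumes "env s"
  shows "den price_used s ''f'' 0 = of_bool (\<exists>r\<in>marked s ''A''. s ''pr'' r = s ''c'' 0)"
proof -
  let ?c = "Conj (true (Read ''A'' (cell ''r''))) (eq (Read ''pr'' (cell ''r'')) (cell ''c''))"
  have "den (For ''r'' ''n'' (If ?c (put ''f'' (Const 1)) Nop)) t ''f'' 0
      = (if \<exists>r<n. 0 < t ''A'' r \<and> t ''pr'' r = t ''c'' 0 then 1 else t ''f'' 0)" if "t ''n'' 0 = n" for t
    using that by (intro den_flag_loop) simp_all
  from this[of "set_cell ''f'' 0 0 s"] assms show ?thesis
    by (auto simp: price_used_def marked_def)
qed

lemma writes_price_used [simp]: "writes price_used = {''f'', ''r''}"
  and writes_is_bidder [simp]: "writes is_bidder = {''f'', ''r''}"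
  by (auto simp: price_used_def is_bidder_def)

lemma den_find_gap:
  assumes "env s"
  defines "k \<equiv> den find_gap s ''k'' 0"
  shows "1 \<le> k" "k \<le> n + 1" "\<And>r. r \<in> marked s ''A'' \<Longrightarrow> s ''pr'' r \<noteq> k - 1"
proof -
  let ?Q = "\<lambda>i k. k = n + 1 \<and> (\<forall>c<i. \<exists>r\<in>marked s ''A''. s ''pr'' r = c) \<or>
     1 \<le> k \<and> k \<le> n \<and> (\<forall>r\<in>marked s ''A''. s ''pr'' r \<noteq> k - 1)"
  let ?p = "price_used ;; If (true (cell ''f'')) Nop (put ''k'' (Add (cell ''c'') (Const 1)))"
  let ?s = "set_cell ''k'' 0 (n + 1) s"
  have "?Q n (den (For ''c'' ''n'' ?p) ?s ''k'' 0)"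
  proof (rule For_rule_bound[where I = "\<lambda>i t. ?Q i (t ''k'' 0)" and k = n])
    fix i and t :: store
    assume i: "i < n" and I: "?Q i (t ''k'' 0)" and fr: "\<And>y. y \<noteq> ''c'' \<Longrightarrow> y \<notin> writes ?p \<Longrightarrow> t y = ?s y"
    let ?t = "set_cell ''c'' 0 i t"
    have "env ?s"
      using assms(1) by (intro env_set_cell) (auto simp: static_def)
    then have env: "env ?t"
      using env_loop[of ?s "''c''" "writes ?p" t i] fr by (simp add: static_def)
    have A: "marked ?t ''A'' = marked s ''A''" "?t ''pr'' = s ''pr''"
      using fr by (simp_all add: marked_def)
    have f: "den price_used ?t ''f'' 0 = of_bool (\<exists>r\<in>marked s ''A''. s ''pr'' r = i)"
      using den_price_used[OF env] A by simp
    have fr': "den price_used ?t ''k'' = t ''k''" "den price_used ?t ''c'' 0 = i"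
      using den_frame[of _ price_used ?t] by simp_all
    show "?Q (Suc i) (den ?p ?t ''k'' 0)"
    proof (cases "\<exists>r\<in>marked s ''A''. s ''pr'' r = i")
      case True
      then have "den ?p ?t ''k'' 0 = t ''k'' 0"
        using f fr' by simp
      then show ?thesis
        using I True by (auto simp: less_Suc_eq)
    next
      case False
      then have "den ?p ?t ''k'' 0 = i + 1"
        using f fr' by simp
      then show ?thesis
        using False i by auto
    qed
  qed (use assms in simp_all)
  moreover have "den find_gap s = den (For ''c'' ''n'' ?p) ?s"
    using assms by (simp add: find_gap_def)
  ultimately have Q: "?Q n k"
    unfolding k_def by simp
  then show "1 \<le> k" "k \<le> n + 1"
    by auto
  show "s ''pr'' r \<noteq> k - 1" if r: "r \<in> marked s ''A''" for r
  proof
    assume *: "s ''pr'' r = k - 1"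
    then have "k = n + 1" "\<forall>c<n. \<exists>r\<in>marked s ''A''. s ''pr'' r = c"
      using Q r by auto
    then have "c \<in> s ''pr'' ` marked s ''A''" if "c < Suc n" for c
    proof (cases "c = n")
      case True
      then show ?thesis
        using * r \<open>k = n + 1\<close> by (intro image_eqI[of _ _ r]) simp_all
    next
      case False
      then show ?thesis
        using \<open>\<forall>c<n. _ c\<close> that by (metis imageI less_SucE)
    qed
    then have "{..<Suc n} \<subseteq> s ''pr'' ` marked s ''A''"
      by auto
    then have "card {..<Suc n} \<le> card (marked s ''A'')"
      using surj_card_le finite_marked by blast
    also have "\<dots> \<le> card {..<n}"
      using marked_subset by (intro card_mono) auto
    finally show False
      by simp
  qed
qed

lemma den_is_bidder:
  assumes "env s"
  shows "den is_bidder s ''f'' 0 = of_bool (\<forall>r<n. s ''ow'' r = s ''u'' 0 \<longrightarrow> s ''k'' 0 \<le> s ''pr'' r)"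
proof -
  let ?c = "Conj (eq (Read ''ow'' (cell ''r'')) (cell ''u'')) (Less (Read ''pr'' (cell ''r'')) (cell ''k''))"
  have "den (For ''r'' ''n'' (If ?c (put ''f'' (Const 0)) Nop)) t ''f'' 0
      = (if \<exists>r<n. t ''ow'' r = t ''u'' 0 \<and> t ''pr'' r < t ''k'' 0 then 0 else t ''f'' 0)" if "t ''n'' 0 = n" for t
    using that by (intro den_flag_loop) simp_all
  from this[of "set_cell ''f'' 0 1 s"] assms show ?thesis
    by (auto simp: is_bidder_def not_le)
qed

lemma den_remove_crown:
  assumes "env s"
  defines "bidders \<equiv> {u \<in> marked s ''A''. \<forall>r<n. s ''ow'' r = u \<longrightarrow> s ''k'' 0 \<le> s ''pr'' r}"
    and "dear \<equiv> {u \<in> marked s ''A''. s ''k'' 0 \<le> s ''pr'' u}"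
  shows "marked (den remove_crown s) ''A'' = marked s ''A'' - (bidders - dear \<union> (dear - bidders))"
    "marked (den remove_crown s) ''C'' = marked s ''C'' \<union> (dear - bidders)"
proof -
  let ?I = "\<lambda>i t. (\<forall>v<n. t ''A'' v = (if v < i \<and> v \<in> bidders - dear \<union> (dear - bidders) then 0 else s ''A'' v)) \<and>
    (\<forall>v<n. t ''C'' v = (if v < i \<and> v \<in> dear - bidders then 1 else s ''C'' v))"
  let ?q = "If (true (Read ''A'' (cell ''u'')))
          (If (true (cell ''f''))
             (If (Less (Read ''pr'' (cell ''u'')) (cell ''k'')) (Assign ''A'' (cell ''u'') (Const 0)) Nop)
             (If (Less (Read ''pr'' (cell ''u'')) (cell ''k'')) Nop
                (Assign ''A'' (cell ''u'') (Const 0) ;; Assign ''C'' (cell ''u'') (Const 1))))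
          Nop"
  have "?I n (den remove_crown s)"
    unfolding remove_crown_def
  proof (rule For_rule_bound[where I = ?I and k = n])
    fix i and t :: store
    assume i: "i < n" and I: "?I i t" and fr: "\<And>y. y \<noteq> ''u'' \<Longrightarrow> y \<notin> writes (is_bidder ;; ?q) \<Longrightarrow> t y = s y"
    let ?t = "set_cell ''u'' 0 i t"
    define w where "w = den is_bidder ?t"
    have env: "env ?t"
      using env_loop[of s "''u''" "writes (is_bidder ;; ?q)" t i] assms(1) fr by (simp add: static_def)
    have t: "t ''ow'' = s ''ow''" "t ''pr'' = s ''pr''" "t ''k'' = s ''k''"
      using fr by simp_all
    have w: "w ''A'' = t ''A''" "w ''C'' = t ''C''" "w ''pr'' = s ''pr''" "w ''k'' = s ''k''" "w ''u'' 0 = i"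
      unfolding w_def using den_frame[of _ is_bidder ?t] t by simp_all
    have A: "t ''A'' i = s ''A'' i"
      using I i by simp
    have f: "0 < w ''f'' 0 \<longleftrightarrow> i \<in> bidders" if "0 < s ''A'' i"
      unfolding w_def using den_is_bidder[OF env] t that i by (simp add: bidders_def marked_def)
    have d: "s ''pr'' i < s ''k'' 0 \<longleftrightarrow> i \<notin> dear" if "0 < s ''A'' i"
      using that i by (auto simp: dear_def marked_def)
    have out: "i \<notin> bidders" "i \<notin> dear" if "\<not> 0 < s ''A'' i"
      using that by (auto simp: bidders_def dear_def marked_def)
    have "den (is_bidder ;; ?q) ?t = den ?q w"
      by (simp add: w_def)
    moreover have "?I (Suc i) (den ?q w)"
    proof (cases "0 < s ''A'' i")
      case True
      then show ?thesis
        using I w A f[OF True] d[OF True] by (cases "i \<in> bidders"; cases "i \<in> dear") (auto simp: less_Suc_eq)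
    next
      case False
      then show ?thesis
        using I w A out by (auto simp: less_Suc_eq)
    qed
    ultimately show "?I (Suc i) (den (is_bidder ;; ?q) ?t)"
      by metis
  qed (use assms(1) in simp_all)
  then have "den remove_crown s ''A'' v = (if v \<in> bidders - dear \<union> (dear - bidders) then 0 else s ''A'' v)"
    "den remove_crown s ''C'' v = (if v \<in> dear - bidders then 1 else s ''C'' v)" if "v < n" for v
    using that by simp_all
  moreover have "v < n" if "v \<in> dear - bidders" for v
    using that by (simp add: dear_def marked_def)
  ultimately show "marked (den remove_crown s) ''A'' = marked s ''A'' - (bidders - dear \<union> (dear - bidders))"
    "marked (den remove_crown s) ''C'' = marked s ''C'' \<union> (dear - bidders)"
    unfolding marked_def by (auto split: if_splits)
qed

text \<open>\<open>C\<close> is paid for by the part of the cover outside \<open>A\<close>. Vertices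
  in neither set stay out of the cover for good; every edge at them already has its other end in
  \<open>C\<close>.\<close>

definition kernel :: "store \<Rightarrow> bool" where
  "kernel t \<longleftrightarrow> env t \<and> odd_free 13 (marked t ''A'') \<and> marked t ''A'' \<inter> marked t ''C'' = {} \<and>
     (\<forall>(u, v)\<in>gE. u \<in> marked t ''C'' \<or> v \<in> marked t ''C'' \<or> u \<in> marked t ''A'' \<and> v \<in> marked t ''A'') \<and>
     (\<forall>K. cover K \<longrightarrow> 6 * card (marked t ''C'') \<le> 11 * card (K \<inter> ({..<n} - marked t ''A'')) \<and>
        card (marked t ''A'') \<le> 2 * card (K \<inter> marked t ''A''))"

lemma den_reduce:
  assumes "charged s" "odd_free 13 (marked s ''A'')" "\<And>r. s ''pr'' r = 0"
  shows "kernel (den reduce s)"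
proof -
  have env: "env s"
    using assms by (simp add: charged_def)
  define t where "t = den (passes ;; passes ;; passes) (den free_items s)"
  have fr: "t x = s x" if "x \<notin> {''r'', ''ow'', ''pr'', ''a'', ''b1'', ''u'', ''f'', ''b''}" for x
    unfolding t_def using that
    by (subst den_frame, simp add: passes_def) (rule den_frame, simp add: free_items_def)
  note P = den_passes[OF den_free_items[OF env assms(3)], folded t_def]
  define w where "w = den find_gap t"
  have fr': "w x = t x" if "x \<notin> {''k'', ''c'', ''f'', ''r''}" for x
    unfolding w_def using that by (intro den_frame) (simp add: find_gap_def)
  have w: "w ''A'' = s ''A''" "w ''C'' = s ''C''" "w ''pr'' = t ''pr''" "w ''ow'' = t ''ow''" "t ''A'' = s ''A''"
    using fr fr' by simp_all
  have envw: "env w"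
    unfolding w_def using P by (intro env_den) (auto simp: find_gap_def static_def)
  note gap = den_find_gap[of t, folded w_def]
  let ?A = "marked s ''A''" and ?C = "marked s ''C''"
  have m: "marked w ''A'' = ?A" "marked w ''C'' = ?C" "marked t ''A'' = ?A"
    using w by (simp_all add: marked_def)
  interpret auction_end n gE ?A "w ''pr''" "w ''ow''" "w ''k'' 0"
  proof -
    interpret auction n gE ?A "w ''pr''" "w ''ow''"
      using P(1) m w by simp
    show "auction_end n gE ?A (w ''pr'') (w ''ow'') (w ''k'' 0)"
    proof
      show "n + 1 \<le> w ''pr'' r" if "u \<in> ?A" "\<And>r. r < n \<Longrightarrow> w ''ow'' r \<noteq> u" "r \<in> ?A" "(u, r) \<in> gE" for u r
        using P(2)[of u] that m w by (auto simp: happy_def marked_def)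
    qed (use gap P(1) m w gE(2) in simp_all)
  qed
  define z where "z = den remove_crown w"
  have z: "marked z ''A'' = ?A - (bidders - dear \<union> (dear - bidders))" "marked z ''C'' = ?C \<union> (dear - bidders)"
    using den_remove_crown[OF envw] m unfolding z_def bidders_def dear_def by simp_all
  have envz: "env z"
    unfolding z_def using envw by (intro env_den) (auto simp: remove_crown_def static_def)
  have sub: "bidders \<subseteq> ?A" "dear \<subseteq> ?A"
    by (auto simp: bidders_def dear_def)
  have C: "?C = {..<n} - ?A" and 6: "\<And>K. cover K \<Longrightarrow> 6 * card ?C \<le> 11 * card (K \<inter> ?C)"
    using assms(1) unfolding charged_def by blast+
  have An: "?A \<subseteq> {..<n}"
    by (rule marked_subset)
  have edges: "u \<in> marked z ''C'' \<or> v \<in> marked z ''C'' \<or> u \<in> marked z ''A'' \<and> v \<in> marked z ''A''"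
    if e: "(u, v) \<in> gE" for u v
  proof (rule ccontr)
    assume no: "\<not> ?thesis"
    have uv: "u \<in> ?A" "v \<in> ?A"
      using no e gE(1) C z(2) by auto
    have ve: "(v, u) \<in> gE"
      using e gE(2) by (rule symD[rotated])
    \<comment> \<open>An uncovered edge must have an end that was removed without being taken, but
      all neighbours in \<open>A\<close> of such an end are dear, hence in \<open>C\<close> or still
      in \<open>A\<close>.\<close>
    have "u \<in> bidders - dear \<or> v \<in> bidders - dear"
      using no uv z by blast
    then show False
      using bidders_neighbours[OF _ uv(2) e] bidders_neighbours[OF _ uv(1) ve] no z(2) by blast
  qed
  have "6 * card (marked z ''C'') \<le> 11 * card (K \<inter> ({..<n} - marked z ''A''))" if K: "cover K" for K
  proof -
    let ?Q = "dear - bidders" and ?I = "bidders - dear"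
    have "card (marked z ''C'') = card ?C + card ?Q"
      unfolding z(2) using sub C finite_A finite_marked by (intro card_Un_disjoint) (auto simp: dear_def)
    moreover have "K \<inter> ({..<n} - marked z ''A'') = (K \<inter> ?C) \<union> (K \<inter> (?I \<union> ?Q))"
      unfolding z(1) C using sub An by blast
    then have "card (K \<inter> ({..<n} - marked z ''A'')) = card (K \<inter> ?C) + card (K \<inter> (?I \<union> ?Q))"
      using sub C finite_A finite_marked[of s "''C''"] by (simp only:) (intro card_Un_disjoint; auto simp: dear_def bidders_def)
    moreover have "card ?Q \<le> card (K \<inter> (?I \<union> ?Q))"
      using K by (intro crown_le) (auto simp: cover_def)
    ultimately show ?thesis
      using 6[OF K] by simp
  qed
  moreover have "card (marked z ''A'') \<le> 2 * card (K \<inter> marked z ''A'')" if "cover K" for K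
    unfolding z(1) using that by (intro kernel_le) (auto simp: cover_def)
  moreover have "odd_free 13 (marked z ''A'')"
    using assms(2) by (rule odd_free_mono) (auto simp: z)
  moreover have "marked z ''A'' \<inter> marked z ''C'' = {}"
    unfolding z using C sub by auto
  ultimately have "kernel z"
    using edges envz unfolding kernel_def by blast
  then show ?thesis
    by (simp add: reduce_def z_def w_def t_def)
qed

end

section \<open>Computing the levels\<close>

text \<open>A layering under construction: \<open>d x = 0\<close> means that \<open>x\<close> has no level yet, and \<open>cur\<close> is the level
  given last.\<close>

locale partial_layering =
  fixes E :: "('p \<times> 'p) set" and X :: "('v \<times> 'p) set" and d :: "'v \<times> 'p \<Rightarrow> nat" and cur :: nat
  assumes node: "0 < d x \<Longrightarrow> x \<in> X"
    and string: "(x, y) \<in> same_string E X \<Longrightarrow> 0 < d x \<Longrightarrow> 0 < d y \<Longrightarrow> d x = d y"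
    and point: "(x, y) \<in> same_point X \<Longrightarrow> 0 < d x \<Longrightarrow> 0 < d y \<Longrightarrow> d x \<le> d y + 1"
    and down: "1 < d x \<Longrightarrow> \<exists>x' y. (x, x') \<in> (same_string E X)\<^sup>* \<and> (x', y) \<in> same_point X \<and> d x = d y + 1"
    and root: "d x = 1 \<Longrightarrow> d y = 1 \<Longrightarrow> (x, y) \<in> joined E X \<Longrightarrow> (x, y) \<in> (same_string E X)\<^sup>*"
    and open_string: "(x, y) \<in> same_string E X \<Longrightarrow> d x = 0 \<Longrightarrow> 0 < d y \<Longrightarrow> d y = cur"
    and open_point: "(x, y) \<in> same_point X \<Longrightarrow> d x = 0 \<Longrightarrow> 0 < d y \<Longrightarrow> d y \<le> cur \<and> cur \<le> d y + 1"

text \<open>Moving along a string is free and changing the string costs one, so the levels are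
  shortest distances with weights 0 and 1, shifted by one.\<close>

definition candidates :: "('p \<times> 'p) set \<Rightarrow> ('v \<times> 'p) set \<Rightarrow> ('v \<times> 'p \<Rightarrow> nat) \<Rightarrow> (('v \<times> 'p) \<times> nat) set" where
  "candidates E X d = {(x, d y) | x y. (x, y) \<in> same_string E X \<and> d x = 0 \<and> 0 < d y} \<union>
     {(x, d y + 1) | x y. (x, y) \<in> same_point X \<and> d x = 0 \<and> 0 < d y}"

lemma partial_layering_empty: "partial_layering E X (\<lambda>x. 0) cur"
  unfolding partial_layering_def by simp

context partial_layering
begin

lemma complete:
  assumes "\<And>x. x \<in> X \<Longrightarrow> 0 < d x"
  shows "layering E X d"
  unfolding layering_def
proof (intro conjI ballI allI impI)
  show "1 \<le> d x" if "x \<in> X" for x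
    using assms[OF that] by simp
  show "d x = d y" if "(x, y) \<in> same_string E X" for x y
    using same_string_in[OF that] by (intro string[OF that] assms) simp_all
  show "d x \<le> d y + 1" if "(x, y) \<in> same_point X" for x y
    using same_point_in[OF that] by (intro point[OF that] assms) simp_all
  show "\<exists>x' y. (x, x') \<in> (same_string E X)\<^sup>* \<and> (x', y) \<in> same_point X \<and> d x = d y + 1" if "1 < d x" for x
    using that by (rule down)
  show "(x, y) \<in> (same_string E X)\<^sup>*" if "d x = 1" "d y = 1" "(x, y) \<in> joined E X" for x y
    using that by (rule root)
qed

text \<open>When there is no offer, no labelled node is joined to a blank one. So \<open>x\<close>
  lies in a component without levels and may become its root.\<close>

lemma new_root:
  assumes E: "sym E" and none: "candidates E X d = {}" and x: "x \<in> X" "d x = 0"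
  shows "partial_layering E X (d(x := 1)) 1"
proof -
  have symS: "(z, y) \<in> same_string E X" if "(y, z) \<in> same_string E X" for y z
    using sym_same_string[OF E] that by (rule symD)
  have symP: "(z, y) \<in> same_point X" if "(y, z) \<in> same_point X" for y z
    using sym_same_point that by (rule symD)
  have closedS: "d y = 0" if "(z, y) \<in> same_string E X" "d z = 0" for y z
  proof (rule ccontr)
    assume "d y \<noteq> 0"
    then have "(z, d y) \<in> candidates E X d"
      using that unfolding candidates_def by blast
    then show False
      using none by simp
  qed
  have closedP: "d y = 0" if "(z, y) \<in> same_point X" "d z = 0" for y z
  proof (rule ccontr)
    assume "d y \<noteq> 0"
    then have "(z, d y + 1) \<in> candidates E X d"
      using that unfolding candidates_def by blast
    then show False
      using none by simp
  qed
  have far: "d z = 0 \<longrightarrow> d y = 0" if "(z, y) \<in> joined E X" for y z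
    using that by (induction rule: rtrancl_induct) (use closedS closedP in blast)+
  have nx: "(y, x) \<notin> joined E X" "(x, y) \<notin> joined E X" if "0 < d y" for y
    using far[of x y] joined_sym[OF E, of y x] x(2) that by auto
  have old: "0 < d y" "y \<noteq> x" if "y \<noteq> x" "0 < (d(x := 1)) y" for y
    using that by simp_all
  show ?thesis
  proof
    show "y \<in> X" if "0 < (d(x := 1)) y" for y
      using node[of y] x that by (cases "y = x") simp_all
    show "(d(x := 1)) y = (d(x := 1)) z" if "(y, z) \<in> same_string E X" "0 < (d(x := 1)) y" "0 < (d(x := 1)) z" for y z
      using string[OF that(1)] closedS[OF that(1)] closedS[OF symS[OF that(1)]] that(2,3) x
      by (cases "y = x"; cases "z = x") simp_all
    show "(d(x := 1)) y \<le> (d(x := 1)) z + 1" if "(y, z) \<in> same_point X" "0 < (d(x := 1)) y" "0 < (d(x := 1)) z" for y z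
      using point[OF that(1)] closedP[OF that(1)] closedP[OF symP[OF that(1)]] that(2,3) x
      by (cases "y = x"; cases "z = x") simp_all
    show "\<exists>x' z. (y, x') \<in> (same_string E X)\<^sup>* \<and> (x', z) \<in> same_point X \<and> (d(x := 1)) y = (d(x := 1)) z + 1"
      if *: "1 < (d(x := 1)) y" for y
    proof -
      have y: "y \<noteq> x" "1 < d y"
        using * by (cases "y = x"; simp)+
      then obtain y' z where z: "(y, y') \<in> (same_string E X)\<^sup>*" "(y', z) \<in> same_point X" "d y = d z + 1"
        using down by blast
      then have "z \<noteq> x"
        using x(2) y by auto
      then show ?thesis
        using z y by (intro exI[of _ y'] exI[of _ z]) simp
    qed
    show "(y, z) \<in> (same_string E X)\<^sup>*" if "(d(x := 1)) y = 1" "(d(x := 1)) z = 1" "(y, z) \<in> joined E X" for y z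
      using that root[of y z] nx[of y] nx[of z] by (cases "y = x"; cases "z = x") simp_all
    show "(d(x := 1)) z = 1" if "(y, z) \<in> same_string E X" "(d(x := 1)) y = 0" "0 < (d(x := 1)) z" for y z
      using that closedS[OF that(1)] by (cases "y = x"; cases "z = x") simp_all
    show "(d(x := 1)) z \<le> 1 \<and> 1 \<le> (d(x := 1)) z + 1"
      if "(y, z) \<in> same_point X" "(d(x := 1)) y = 0" "0 < (d(x := 1)) z" for y z
      using that closedP[OF that(1)] by (cases "y = x"; cases "z = x") simp_all
  qed
qed

text \<open>Dijkstra's argument: no offer lies below the last level \<open>cur\<close>, and choosing
  the least offer keeps every labelled node with a blank neighbour close enough to the new current
  level.\<close>

lemma extend:
  assumes E: "sym E" and k: "(x, k) \<in> candidates E X d"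
    and least: "\<And>y l. (y, l) \<in> candidates E X d \<Longrightarrow> k \<le> l"
  shows "partial_layering E X (d(x := k)) k" "x \<in> X" "d x = 0" "0 < k"
proof -
  show x: "x \<in> X" "d x = 0" "0 < k"
    using k by (auto simp: candidates_def same_string_def same_point_def)
  have via: "(\<exists>y. (x, y) \<in> same_string E X \<and> 0 < d y \<and> k = d y) \<or> (\<exists>y. (x, y) \<in> same_point X \<and> 0 < d y \<and> k = d y + 1)"
    using k unfolding candidates_def by blast
  then have cur: "cur \<le> k"
    using open_string[of x] open_point[of x] x(2) by fastforce
  have S: "d z = k" if "(y, z) \<in> same_string E X" "d y = 0" "0 < d z" for y z
  proof -
    have "(y, d z) \<in> candidates E X d"
      using that unfolding candidates_def by blast
    then show ?thesis
      using least open_string[OF that] cur by fastforce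
  qed
  have P: "k \<le> d z + 1 \<and> d z \<le> k" if "(y, z) \<in> same_point X" "d y = 0" "0 < d z" for y z
  proof -
    have "(y, d z + 1) \<in> candidates E X d"
      using that unfolding candidates_def by blast
    then show ?thesis
      using least open_point[OF that] cur by fastforce
  qed
  have symS: "(z, y) \<in> same_string E X" if "(y, z) \<in> same_string E X" for y z
    using sym_same_string[OF E] that by (rule symD)
  have symP: "(z, y) \<in> same_point X" if "(y, z) \<in> same_point X" for y z
    using sym_same_point that by (rule symD)
  show "partial_layering E X (d(x := k)) k"
  proof
    show "y \<in> X" if "0 < (d(x := k)) y" for y
      using node[of y] x that by (cases "y = x") simp_all
    show "(d(x := k)) y = (d(x := k)) z" if "(y, z) \<in> same_string E X" "0 < (d(x := k)) y" "0 < (d(x := k)) z" for y z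
      using string[OF that(1)] S[OF that(1)] S[OF symS[OF that(1)]] x that(2,3) by (cases "y = x"; cases "z = x") simp_all
    show "(d(x := k)) y \<le> (d(x := k)) z + 1" if "(y, z) \<in> same_point X" "0 < (d(x := k)) y" "0 < (d(x := k)) z" for y z
      using point[OF that(1)] P[OF that(1)] P[OF symP[OF that(1)]] x that(2,3) by (cases "y = x"; cases "z = x") simp_all
    show "\<exists>y' z. (y, y') \<in> (same_string E X)\<^sup>* \<and> (y', z) \<in> same_point X \<and> (d(x := k)) y = (d(x := k)) z + 1"
      if y: "1 < (d(x := k)) y" for y
    proof -
      have "\<exists>y' z. (y, y') \<in> (same_string E X)\<^sup>* \<and> (y', z) \<in> same_point X \<and> (d(x := k)) y = d z + 1 \<and> 0 < d z"
      proof (cases "y = x")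
        case False
        then have d: "(d(x := k)) y = d y"
          by simp
        then obtain y' z where "(y, y') \<in> (same_string E X)\<^sup>*" "(y', z) \<in> same_point X" "d y = d z + 1"
          using down[of y] y by metis
        then show ?thesis
          using y d by (intro exI[of _ y'] exI[of _ z]) simp
      next
        case True
        consider z where "(x, z) \<in> same_string E X" "0 < d z" "k = d z" | z where "(x, z) \<in> same_point X" "0 < d z" "k = d z + 1"
          using via by blast
        then show ?thesis
        proof cases
          case 1
          then obtain z' w where "(z, z') \<in> (same_string E X)\<^sup>*" "(z', w) \<in> same_point X" "d z = d w + 1"
            using down[of z] y True by auto
          then show ?thesis
            using 1 True y by (intro exI[of _ z'] exI[of _ w]) (simp add: converse_rtrancl_into_rtrancl)
        next
          case 2
          then show ?thesis
            using True by (intro exI[of _ x] exI[of _ z]) simp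
        qed
      qed
      then obtain y' z where z: "(y, y') \<in> (same_string E X)\<^sup>*" "(y', z) \<in> same_point X" "(d(x := k)) y = d z + 1" "0 < d z"
        by blast
      then have "(d(x := k)) z = d z"
        using x(2) by auto
      then show ?thesis
        using z by metis
    qed
    \<comment> \<open>Offers made at a point are at least 2, so level 1 is inherited only along a
      string and the root fragment remains unique.\<close>
    have near: "\<exists>y'. (y, y') \<in> (same_string E X)\<^sup>* \<and> d y' = 1" if "(d(x := k)) y = 1" for y
    proof (cases "y = x")
      case True
      then have "k = 1"
        using that by simp
      then obtain z where "(x, z) \<in> same_string E X" "d z = 1"
        using via by auto
      then show ?thesis
        using True by blast
    next
      case False
      then show ?thesis
        using that by (intro exI[of _ y]) simp
    qed
    show "(y, z) \<in> (same_string E X)\<^sup>*" if *: "(d(x := k)) y = 1" "(d(x := k)) z = 1" "(y, z) \<in> joined E X" for y z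
    proof -
      obtain y' z' where yz: "(y, y') \<in> (same_string E X)\<^sup>*" "d y' = 1" "(z, z') \<in> (same_string E X)\<^sup>*" "d z' = 1"
        using near[OF *(1)] near[OF *(2)] by blast
      have "(y', z') \<in> joined E X"
        by (rule rtrancl_trans[OF joined_sym[OF E same_string_joined[OF yz(1)]] joined_string[OF *(3) yz(3)]])
      then have "(y', z') \<in> (same_string E X)\<^sup>*"
        using root yz by blast
      moreover have "(z', z) \<in> (same_string E X)\<^sup>*"
        using sym_rtrancl[OF sym_same_string[OF E, of X]] yz(3) by (rule symD)
      ultimately show ?thesis
        using yz(1) by (meson rtrancl_trans)
    qed
    show "(d(x := k)) z = k" if "(y, z) \<in> same_string E X" "(d(x := k)) y = 0" "0 < (d(x := k)) z" for y z
      using S[OF that(1)] x that(2,3) by (cases "y = x"; cases "z = x") simp_all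
    show "(d(x := k)) z \<le> k \<and> k \<le> (d(x := k)) z + 1"
      if "(y, z) \<in> same_point X" "(d(x := k)) y = 0" "0 < (d(x := k)) z" for y z
      using P[OF that(1)] x that(2,3) by (cases "y = x"; cases "z = x") simp_all
  qed
qed

end

text \<open>Cell \<open>bk\<close> holds the least level offered so far (0 if none), \<open>be\<close> its parity and \<open>bv\<close>, \<open>bp\<close> the
  node; \<open>rv\<close>, \<open>rp\<close> is some node without level if \<open>rf\<close> is set.\<close>

definition offer :: "aexp \<Rightarrow> aexp \<Rightarrow> prog" where
  "offer k e =
     If (Conj (true (cell ''bk'')) (Neg (Less k (cell ''bk'')))) Nop
       (put ''bk'' k ;; put ''be'' e ;; put ''bv'' (cell ''v'') ;; put ''bp'' (cell ''p''))"

definition offers_string :: prog where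
  "offers_string =
     For ''q'' ''m''
       (If (Conj (true (P_at (cell ''p'') (cell ''q''))) (true (node_at ''d'' (cell ''v'') (cell ''q''))))
          (offer (node_at ''d'' (cell ''v'') (cell ''q'')) (node_at ''e'' (cell ''v'') (cell ''q''))) Nop)"

text \<open>The machine cannot divide, so the parities of the levels are maintained in a separate
  array \<open>e\<close>; the next level has parity one minus the present one.\<close>

definition offers_point :: prog where
  "offers_point =
     For ''u'' ''n''
       (If (true (node_at ''d'' (cell ''u'') (cell ''p'')))
          (offer (Add (node_at ''d'' (cell ''u'') (cell ''p'')) (Const 1))
             (Sub (Const 1) (node_at ''e'' (cell ''u'') (cell ''p'')))) Nop)"

definition scan_node :: prog where
  "scan_node =
     If (Conj (true (node_at ''X'' (cell ''v'') (cell ''p''))) (Neg (true (node_at ''d'' (cell ''v'') (cell ''p'')))))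
       (put ''rf'' (Const 1) ;; put ''rv'' (cell ''v'') ;; put ''rp'' (cell ''p'') ;; offers_string ;; offers_point)
       Nop"

definition scan :: prog where
  "scan = put ''bk'' (Const 0) ;; put ''rf'' (Const 0) ;; For ''v'' ''n'' (For ''p'' ''m'' scan_node)"

definition put_node :: "string \<Rightarrow> aexp \<Rightarrow> aexp \<Rightarrow> aexp \<Rightarrow> prog" where
  "put_node x v p k = Assign x (Add (Read ''vm'' v) p) k"

definition layer_step :: prog where
  "layer_step =
     scan ;;
     If (true (cell ''bk''))
       (put_node ''d'' (cell ''bv'') (cell ''bp'') (cell ''bk'') ;; put_node ''e'' (cell ''bv'') (cell ''bp'') (cell ''be''))
       (If (true (cell ''rf''))
          (put_node ''d'' (cell ''rv'') (cell ''rp'') (Const 1) ;; put_node ''e'' (cell ''rv'') (cell ''rp'') (Const 1))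
          Nop)"

text \<open>Each step labels one more node as long as any is blank, and there are at most
  \<open>n * m\<close> nodes.\<close>

definition layer :: prog where
  "layer =
     For ''v'' ''n'' (For ''p'' ''m'' (put_node ''d'' (cell ''v'') (cell ''p'') (Const 0))) ;;
     For ''a'' ''n'' (For ''b1'' ''m'' layer_step)"

context input
begin

definition entry :: "store \<Rightarrow> string \<Rightarrow> nat \<times> nat \<Rightarrow> nat" where
  "entry t x = (\<lambda>(v, p). if v < n \<and> p < m then t x (v * m + p) else 0)"

definition node_set :: "store \<Rightarrow> string \<Rightarrow> (nat \<times> nat) set" where
  "node_set t x = {y. 0 < entry t x y}"

lemma entry_cong: "t x = s x \<Longrightarrow> entry t x = entry s x"
  by (auto simp: entry_def fun_eq_iff)

lemma node_set_cong: "t x = s x \<Longrightarrow> node_set t x = node_set s x"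
  unfolding node_set_def by (subst entry_cong) auto

lemma index_eq: "p < m \<Longrightarrow> q < m \<Longrightarrow> v * m + p = u * m + q \<longleftrightarrow> v = u \<and> p = (q::nat)"
  by (metis add.commute div_mult_self1 mod_mult_self1 div_less mod_less add.right_neutral add_0 not_less_zero)

lemma entry_set_cell:
  assumes "v < n" "p < m"
  shows "entry (set_cell x (v * m + p) k t) x = (entry t x)((v, p) := k)"
  using assms by (auto simp: entry_def fun_eq_iff index_eq)

definition agree :: "store \<Rightarrow> store \<Rightarrow> bool" where
  "agree s t \<longleftrightarrow> env t \<and> t ''X'' = s ''X'' \<and> t ''d'' = s ''d'' \<and> t ''e'' = s ''e''"

abbreviation "cands s \<equiv> candidates pE (node_set s ''X'') (entry s ''d'')"

text \<open>\<open>Z\<close> is the set of offers that must have been taken into account; the value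
  0 of \<open>bk\<close> means that none was made.\<close>

definition best :: "store \<Rightarrow> ((nat \<times> nat) \<times> nat) set \<Rightarrow> store \<Rightarrow> bool" where
  "best s Z t \<longleftrightarrow> agree s t \<and>
     (0 < t ''bk'' 0 \<longrightarrow> ((t ''bv'' 0, t ''bp'' 0), t ''bk'' 0) \<in> cands s \<and> t ''be'' 0 = t ''bk'' 0 mod 2) \<and>
     (\<forall>(x, k)\<in>Z. 0 < t ''bk'' 0 \<and> t ''bk'' 0 \<le> k)"

lemma best_cong:
  "best s Z t \<Longrightarrow> (\<And>y. y \<in> static \<union> {''X'', ''d'', ''e'', ''bk'', ''be'', ''bv'', ''bp''} \<Longrightarrow> t' y = t y) \<Longrightarrow> best s Z t'"
  using env_cong[of t t'] unfolding best_def agree_def by simp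

lemma best_set_cell:
  "best s Z t \<Longrightarrow> x \<notin> static \<union> {''X'', ''d'', ''e'', ''bk'', ''be'', ''bv'', ''bp''} \<Longrightarrow> best s Z (set_cell x i k t)"
  by (erule best_cong) (auto intro: set_cell_other)

lemma writes_offer [simp]: "writes (offer k e) = {''bk'', ''be'', ''bv'', ''bp''}"
  by (auto simp: offer_def)

text \<open>The last hypothesis is there because \<open>bk\<close> is overwritten before
  \<open>e\<close> is evaluated.\<close>

lemma den_offer:
  assumes "best s Z t" "((t ''v'' 0, t ''p'' 0), aval k t) \<in> cands s" "0 < aval k t" "aval e t = aval k t mod 2"
    and k: "\<And>l. aval e (set_cell ''bk'' 0 l t) = aval e t"
  shows "best s (insert ((t ''v'' 0, t ''p'' 0), aval k t) Z) (den (offer k e) t)"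
proof (cases "0 < t ''bk'' 0 \<and> t ''bk'' 0 \<le> aval k t")
  case True
  then have "den (offer k e) t = t"
    by (simp add: offer_def not_less)
  then show ?thesis
    using assms(1) True by (auto simp: best_def)
next
  case False
  then have den: "den (offer k e) t = set_cell ''bp'' 0 (t ''p'' 0) (set_cell ''bv'' 0 (t ''v'' 0)
      (set_cell ''be'' 0 (aval k t mod 2) (set_cell ''bk'' 0 (aval k t) t)))"
    using assms(4) k by (auto simp: offer_def)
  have "agree s (den (offer k e) t)"
    unfolding den using assms(1) by (auto simp: best_def agree_def static_def intro!: env_set_cell)
  moreover have "(\<forall>(x, l)\<in>Z. aval k t \<le> l)"
    using assms(1) False unfolding best_def by (auto simp: not_le intro: less_imp_le order_trans)
  ultimately show ?thesis
    using assms(2,3) unfolding best_def by (simp add: den)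
qed


text \<open>Turns the two nested counters into one invariant about the set of pairs visited so
  far.\<close>

lemma grid_rule:
  assumes "I {} s" and env: "\<And>Y t. I Y t \<Longrightarrow> env t"
    and set: "\<And>Y t x i. x \<in> {''v'', ''p''} \<Longrightarrow> I Y t \<Longrightarrow> I Y (set_cell x 0 i t)"
    and step: "\<And>Y t v p. v < n \<Longrightarrow> p < m \<Longrightarrow> I Y t \<Longrightarrow> t ''v'' 0 = v \<Longrightarrow> t ''p'' 0 = p \<Longrightarrow> I (insert (v, p) Y) (den b t)"
    and b: "''v'' \<notin> writes b"
  shows "I ({..<n} \<times> {..<m}) (den (For ''v'' ''n'' (For ''p'' ''m'' b)) s)"
proof -
  have row: "I ({..<v} \<times> {..<m} \<union> {v} \<times> {..<m}) (den (For ''p'' ''m'' b) t)"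
    if t: "I ({..<v} \<times> {..<m}) t" "t ''v'' 0 = v" "v < n" for v t
  proof (rule For_rule_bound[where I = "\<lambda>i. I ({..<v} \<times> {..<m} \<union> {v} \<times> {..<i})" and k = m])
    show "t ''m'' 0 = m" "I ({..<v} \<times> {..<m} \<union> {v} \<times> {..<0}) t"
      using t env[OF t(1)] by simp_all
    show "I ({..<v} \<times> {..<m} \<union> {v} \<times> {..<m}) (set_cell ''p'' 0 m t')"
      if "I ({..<v} \<times> {..<m} \<union> {v} \<times> {..<m}) t'" for t'
      using that by (intro set) simp_all
  next
    fix i t'
    assume i: "i < m" and I: "I ({..<v} \<times> {..<m} \<union> {v} \<times> {..<i}) t'"
      and fr: "\<And>y. y \<noteq> ''p'' \<Longrightarrow> y \<notin> writes b \<Longrightarrow> t' y = t y"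
    have "I ({..<v} \<times> {..<m} \<union> {v} \<times> {..<i}) (set_cell ''p'' 0 i t')"
      using I by (intro set) simp_all
    moreover have "set_cell ''p'' 0 i t' ''v'' 0 = v" "set_cell ''p'' 0 i t' ''p'' 0 = i"
      using fr b t by simp_all
    ultimately have "I (insert (v, i) ({..<v} \<times> {..<m} \<union> {v} \<times> {..<i})) (den b (set_cell ''p'' 0 i t'))"
      by (rule step[OF t(3) i])
    moreover have "insert (v, i) ({..<v} \<times> {..<m} \<union> {v} \<times> {..<i}) = {..<v} \<times> {..<m} \<union> {v} \<times> {..<Suc i}"
      by auto
    ultimately show "I ({..<v} \<times> {..<m} \<union> {v} \<times> {..<Suc i}) (den b (set_cell ''p'' 0 i t'))"
      by simp
  qed
  show ?thesis
  proof (rule For_rule_bound[where I = "\<lambda>i. I ({..<i} \<times> {..<m})" and k = n])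
    show "s ''n'' 0 = n" "I ({..<0} \<times> {..<m}) s"
      using assms(1) env[OF assms(1)] by simp_all
    show "I ({..<n} \<times> {..<m}) (set_cell ''v'' 0 n t')" if "I ({..<n} \<times> {..<m}) t'" for t'
      using that by (intro set) simp_all
  next
    fix i t' assume i: "i < n" and I: "I ({..<i} \<times> {..<m}) t'"
    then have "I ({..<i} \<times> {..<m}) (set_cell ''v'' 0 i t')"
      by (intro set) simp_all
    then have "I ({..<i} \<times> {..<m} \<union> {i} \<times> {..<m}) (den (For ''p'' ''m'' b) (set_cell ''v'' 0 i t'))"
      using i by (intro row) simp_all
    moreover have "{..<i} \<times> {..<m} \<union> {i} \<times> {..<m} = {..<Suc i} \<times> {..<m}"
      by auto
    ultimately show "I ({..<Suc i} \<times> {..<m}) (den (For ''p'' ''m'' b) (set_cell ''v'' 0 i t'))"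
      by simp
  qed
qed

lemma best_agree: "best s Z t \<Longrightarrow> agree s t"
  by (simp add: best_def)

lemma entry_agree: "agree s t \<Longrightarrow> entry t ''d'' = entry s ''d'' \<and> entry t ''e'' = entry s ''e'' \<and> entry t ''X'' = entry s ''X''"
  by (auto simp: agree_def intro: entry_cong)

lemma aval_node_at:
  assumes "env t" "aval a t < n" "aval b t < m"
  shows "aval (node_at x a b) t = entry t x (aval a t, aval b t)"
  using assms env_simps(4)[OF assms(1,2)] by (simp add: entry_def)

definition string_cands :: "store \<Rightarrow> nat \<Rightarrow> nat \<Rightarrow> nat \<Rightarrow> ((nat \<times> nat) \<times> nat) set" where
  "string_cands s v p i = {((v, p), entry s ''d'' (v, q)) | q. q < i \<and> (p, q) \<in> pE \<and> 0 < entry s ''d'' (v, q)}"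

definition point_cands :: "store \<Rightarrow> nat \<Rightarrow> nat \<Rightarrow> nat \<Rightarrow> ((nat \<times> nat) \<times> nat) set" where
  "point_cands s v p i = {((v, p), entry s ''d'' (u, p) + 1) | u. u < i \<and> 0 < entry s ''d'' (u, p)}"

definition blank :: "store \<Rightarrow> (nat \<times> nat) set" where
  "blank s = {x \<in> node_set s ''X''. entry s ''d'' x = 0}"

definition levelled :: "store \<Rightarrow> bool" where
  "levelled s \<longleftrightarrow> env s \<and> (\<forall>x. 0 < entry s ''d'' x \<longrightarrow> x \<in> node_set s ''X'') \<and>
     (\<forall>x. 0 < entry s ''d'' x \<longrightarrow> entry s ''e'' x = entry s ''d'' x mod 2)"

text \<open>The scan tests only levels at the other node: a node with a level belongs to
  \<open>X\<close>, and it differs from \<open>(v, p)\<close>, which is blank.\<close>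

lemma cands_eq:
  assumes "levelled s"
  shows "cands s = (\<Union>(v, p)\<in>blank s. string_cands s v p m \<union> point_cands s v p n)" (is "_ = ?R")
proof -
  have X: "0 < entry s ''d'' x \<Longrightarrow> x \<in> node_set s ''X''" for x
    using assms unfolding levelled_def by blast
  have range: "v < n \<and> p < m" if "(v, p) \<in> node_set s ''X''" for v p
    using that by (auto simp: node_set_def entry_def split: if_splits)
  have "z \<in> cands s \<longleftrightarrow> z \<in> ?R" for z
  proof
    assume "z \<in> cands s"
    then consider x y where "z = (x, entry s ''d'' y)" "(x, y) \<in> same_string pE (node_set s ''X'')" "entry s ''d'' x = 0" "0 < entry s ''d'' y"
      | x y where "z = (x, entry s ''d'' y + 1)" "(x, y) \<in> same_point (node_set s ''X'')" "entry s ''d'' x = 0" "0 < entry s ''d'' y"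
      unfolding candidates_def by blast
    then show "z \<in> ?R"
    proof cases
      case 1
      then obtain v p q where "x = (v, p)" "y = (v, q)" "(v, p) \<in> node_set s ''X''" "(v, q) \<in> node_set s ''X''" "(p, q) \<in> pE"
        by (auto simp: same_string_def)
      then show ?thesis
        using 1 range[of v q] by (intro UN_I[of "(v, p)"]) (auto simp: blank_def string_cands_def)
    next
      case 2
      then obtain v u p where "x = (v, p)" "y = (u, p)" "(v, p) \<in> node_set s ''X''" "(u, p) \<in> node_set s ''X''"
        by (auto simp: same_point_def)
      then show ?thesis
        using 2 range[of u p] by (intro UN_I[of "(v, p)"]) (auto simp: blank_def point_cands_def)
    qed
  next
    assume "z \<in> ?R"
    then obtain v p where vp: "(v, p) \<in> blank s" "z \<in> string_cands s v p m \<or> z \<in> point_cands s v p n"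
      by auto
    then consider q where "z = ((v, p), entry s ''d'' (v, q))" "(p, q) \<in> pE" "0 < entry s ''d'' (v, q)"
      | u where "z = ((v, p), entry s ''d'' (u, p) + 1)" "0 < entry s ''d'' (u, p)"
      unfolding string_cands_def point_cands_def by blast
    then show "z \<in> cands s"
    proof cases
      case 1
      then have "((v, p), (v, q)) \<in> same_string pE (node_set s ''X'')"
        using vp(1) X by (simp add: same_string_def blank_def)
      then show ?thesis
        using 1 vp(1) unfolding candidates_def blank_def by blast
    next
      case 2
      then have "((v, p), (u, p)) \<in> same_point (node_set s ''X'')"
        using vp(1) X by (auto simp: same_point_def blank_def)
      then show ?thesis
        using 2 vp(1) unfolding candidates_def blank_def by blast
    qed
  qed
  then show ?thesis
    by blast
qed

lemma den_offers_string:
  assumes s: "levelled s" and t: "best s Z t" "t ''v'' 0 = v" "t ''p'' 0 = p" and vp: "(v, p) \<in> blank s" "v < n" "p < m"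
  shows "best s (Z \<union> string_cands s v p m) (den offers_string t)"
proof -
  let ?b = "If (Conj (true (P_at (cell ''p'') (cell ''q''))) (true (node_at ''d'' (cell ''v'') (cell ''q''))))
          (offer (node_at ''d'' (cell ''v'') (cell ''q'')) (node_at ''e'' (cell ''v'') (cell ''q''))) Nop"
  let ?I = "\<lambda>i t. best s (Z \<union> string_cands s v p i) t"
  show ?thesis
    unfolding offers_string_def
  proof (rule For_rule_bound[where I = ?I and k = m])
    show "t ''m'' 0 = m"
      using best_agree[OF t(1)] by (simp add: agree_def)
    show "?I 0 t"
      using t by (simp add: string_cands_def)
    show "?I m (set_cell ''q'' 0 m t')" if "?I m t'" for t'
      using that by (rule best_set_cell) (simp add: static_def)
  next
    fix i t'
    assume i: "i < m" and I: "?I i t'" and fr: "\<And>y. y \<noteq> ''q'' \<Longrightarrow> y \<notin> writes ?b \<Longrightarrow> t' y = t y"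
    let ?t = "set_cell ''q'' 0 i t'"
    have best: "?I i ?t"
      using I by (rule best_set_cell) (simp add: static_def)
    have ag: "agree s ?t"
      by (rule best_agree[OF best])
    then have env: "env ?t"
      by (simp add: agree_def)
    have v: "?t ''v'' 0 = v" "?t ''p'' 0 = p" "?t ''q'' 0 = i"
      using fr[of "''v''"] fr[of "''p''"] t by simp_all
    have cells: "aval (cell ''v'') ?t = v" "aval (cell ''p'') ?t = p" "aval (cell ''q'') ?t = i"
      using v by (simp_all only: aval.simps)
    have d: "aval (node_at ''d'' (cell ''v'') (cell ''q'')) ?t = entry s ''d'' (v, i)"
      "aval (node_at ''e'' (cell ''v'') (cell ''q'')) ?t = entry s ''e'' (v, i)"
      using aval_node_at[OF env, of "cell ''v''" "cell ''q''"] vp i entry_agree[OF ag] unfolding cells by metis+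
    have P: "0 < aval (P_at (cell ''p'') (cell ''q'')) ?t \<longleftrightarrow> (p, i) \<in> pE"
      using env_simps(5,8)[OF env] v vp i by simp
    have next_set: "string_cands s v p (Suc i) = (if (p, i) \<in> pE \<and> 0 < entry s ''d'' (v, i)
        then insert ((v, p), entry s ''d'' (v, i)) (string_cands s v p i) else string_cands s v p i)"
      by (auto simp: string_cands_def less_Suc_eq)
    show "?I (Suc i) (den ?b ?t)"
    proof (cases "(p, i) \<in> pE \<and> 0 < entry s ''d'' (v, i)")
      case True
      then have c: "bval (Conj (true (P_at (cell ''p'') (cell ''q''))) (true (node_at ''d'' (cell ''v'') (cell ''q'')))) ?t"
        using P d by (simp del: aval.simps(2,3))
      have indep: "aval (node_at ''e'' (cell ''v'') (cell ''q'')) (set_cell ''bk'' 0 l ?t)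
          = aval (node_at ''e'' (cell ''v'') (cell ''q'')) ?t" for l
        by simp
      have "((v, p), entry s ''d'' (v, i)) \<in> cands s"
        unfolding cands_eq[OF s] using True vp(1) i by (intro UN_I[of "(v, p)"]) (auto simp: string_cands_def)
      then have "best s (insert ((v, p), entry s ''d'' (v, i)) (Z \<union> string_cands s v p i))
          (den (offer (node_at ''d'' (cell ''v'') (cell ''q'')) (node_at ''e'' (cell ''v'') (cell ''q''))) ?t)"
        using True s den_offer[OF best _ _ _ indep, of "node_at ''d'' (cell ''v'') (cell ''q'')", unfolded d v]
        unfolding levelled_def by blast
      then show ?thesis
        unfolding den.simps if_P[OF c] next_set if_P[OF True] by simp
    next
      case False
      then have c: "\<not> bval (Conj (true (P_at (cell ''p'') (cell ''q''))) (true (node_at ''d'' (cell ''v'') (cell ''q'')))) ?t"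
        using P d by (simp del: aval.simps(2,3))
      show ?thesis
        unfolding den.simps if_not_P[OF c] next_set if_not_P[OF False] by (rule best)
    qed
  qed
qed

lemma den_offers_point:
  assumes s: "levelled s" and t: "best s Z t" "t ''v'' 0 = v" "t ''p'' 0 = p" and vp: "(v, p) \<in> blank s" "v < n" "p < m"
  shows "best s (Z \<union> point_cands s v p n) (den offers_point t)"
proof -
  let ?k = "Add (node_at ''d'' (cell ''u'') (cell ''p'')) (Const 1)"
  let ?e = "Sub (Const 1) (node_at ''e'' (cell ''u'') (cell ''p''))"
  let ?c = "true (node_at ''d'' (cell ''u'') (cell ''p''))"
  let ?b = "If ?c (offer ?k ?e) Nop"
  let ?I = "\<lambda>i t. best s (Z \<union> point_cands s v p i) t"
  show ?thesis
    unfolding offers_point_def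
  proof (rule For_rule_bound[where I = ?I and k = n])
    show "t ''n'' 0 = n"
      using best_agree[OF t(1)] by (simp add: agree_def)
    show "?I 0 t"
      using t by (simp add: point_cands_def)
    show "?I n (set_cell ''u'' 0 n t')" if "?I n t'" for t'
      using that by (rule best_set_cell) (simp add: static_def)
  next
    fix i t'
    assume i: "i < n" and I: "?I i t'" and fr: "\<And>y. y \<noteq> ''u'' \<Longrightarrow> y \<notin> writes ?b \<Longrightarrow> t' y = t y"
    let ?t = "set_cell ''u'' 0 i t'"
    have best: "?I i ?t"
      using I by (rule best_set_cell) (simp add: static_def)
    have ag: "agree s ?t"
      by (rule best_agree[OF best])
    then have env: "env ?t"
      by (simp add: agree_def)
    have v: "?t ''v'' 0 = v" "?t ''p'' 0 = p" "?t ''u'' 0 = i"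
      using fr[of "''v''"] fr[of "''p''"] t by simp_all
    have cells: "aval (cell ''u'') ?t = i" "aval (cell ''p'') ?t = p"
      using v by (simp_all only: aval.simps)
    have d: "aval (node_at ''d'' (cell ''u'') (cell ''p'')) ?t = entry s ''d'' (i, p)"
      "aval (node_at ''e'' (cell ''u'') (cell ''p'')) ?t = entry s ''e'' (i, p)"
      using aval_node_at[OF env, of "cell ''u''" "cell ''p''"] vp i entry_agree[OF ag] unfolding cells by metis+
    have next_set: "point_cands s v p (Suc i) = (if 0 < entry s ''d'' (i, p)
        then insert ((v, p), entry s ''d'' (i, p) + 1) (point_cands s v p i) else point_cands s v p i)"
      by (auto simp: point_cands_def less_Suc_eq)
    show "?I (Suc i) (den ?b ?t)"
    proof (cases "0 < entry s ''d'' (i, p)")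
      case True
      then have c: "bval ?c ?t"
        using d by (simp del: aval.simps(2,3))
      have k: "aval ?k ?t = entry s ''d'' (i, p) + 1" "aval ?e ?t = 1 - entry s ''e'' (i, p)"
        using d by (simp_all del: aval.simps(2))
      have par: "1 - entry s ''e'' (i, p) = (entry s ''d'' (i, p) + 1) mod 2"
      proof -
        have "entry s ''e'' (i, p) = entry s ''d'' (i, p) mod 2"
          using s True by (simp add: levelled_def)
        then show ?thesis
          by presburger
      qed
      have indep: "aval ?e (set_cell ''bk'' 0 l ?t) = aval ?e ?t" for l
        by simp
      have "((v, p), entry s ''d'' (i, p) + 1) \<in> cands s"
        unfolding cands_eq[OF s] using True vp(1) i by (intro UN_I[of "(v, p)"]) (auto simp: point_cands_def)
      then have "best s (insert ((v, p), entry s ''d'' (i, p) + 1) (Z \<union> point_cands s v p i)) (den (offer ?k ?e) ?t)"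
        using den_offer[OF best _ _ _ indep, of ?k, unfolded k v] par by simp
      then show ?thesis
        unfolding den.simps if_P[OF c] next_set if_P[OF True] by simp
    next
      case False
      then have c: "\<not> bval ?c ?t"
        using d by (simp del: aval.simps(2,3))
      show ?thesis
        unfolding den.simps if_not_P[OF c] next_set if_not_P[OF False] by (rule best)
    qed
  qed
qed


lemma writes_scan [simp]: "writes offers_string = {''q'', ''bk'', ''be'', ''bv'', ''bp''}"
  "writes offers_point = {''u'', ''bk'', ''be'', ''bv'', ''bp''}"
  "writes scan_node = {''rf'', ''rv'', ''rp'', ''q'', ''u'', ''bk'', ''be'', ''bv'', ''bp''}"
  "writes scan = {''v'', ''p'', ''rf'', ''rv'', ''rp'', ''q'', ''u'', ''bk'', ''be'', ''bv'', ''bp''}"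
  by (auto simp: offers_string_def offers_point_def scan_node_def scan_def)

definition node_cands :: "store \<Rightarrow> nat \<times> nat \<Rightarrow> ((nat \<times> nat) \<times> nat) set" where
  "node_cands s x = string_cands s (fst x) (snd x) m \<union> point_cands s (fst x) (snd x) n"

definition scanned :: "store \<Rightarrow> (nat \<times> nat) set \<Rightarrow> store \<Rightarrow> bool" where
  "scanned s Y t \<longleftrightarrow> best s (\<Union>x\<in>Y \<inter> blank s. node_cands s x) t \<and>
     (0 < t ''rf'' 0 \<longrightarrow> (t ''rv'' 0, t ''rp'' 0) \<in> blank s) \<and> (Y \<inter> blank s \<noteq> {} \<longrightarrow> 0 < t ''rf'' 0)"

lemma den_scan_node:
  assumes s: "levelled s" and t: "scanned s Y t" "t ''v'' 0 = v" "t ''p'' 0 = p" and vp: "v < n" "p < m"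
  shows "scanned s (insert (v, p) Y) (den scan_node t)"
proof -
  let ?c = "Conj (true (node_at ''X'' (cell ''v'') (cell ''p''))) (Neg (true (node_at ''d'' (cell ''v'') (cell ''p''))))"
  have best: "best s (\<Union>x\<in>Y \<inter> blank s. node_cands s x) t"
    using t(1) by (simp add: scanned_def)
  then have ag: "agree s t"
    by (rule best_agree)
  then have env: "env t"
    by (simp add: agree_def)
  have cells: "aval (cell ''v'') t = v" "aval (cell ''p'') t = p"
    using t by simp_all
  have "aval (node_at ''X'' (cell ''v'') (cell ''p'')) t = entry s ''X'' (v, p)"
      "aval (node_at ''d'' (cell ''v'') (cell ''p'')) t = entry s ''d'' (v, p)"
    using aval_node_at[OF env, of "cell ''v''" "cell ''p''"] vp entry_agree[OF ag] unfolding cells by metis+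
  then have c: "bval ?c t \<longleftrightarrow> (v, p) \<in> blank s"
    by (simp add: blank_def node_set_def del: aval.simps(2))
  show ?thesis
  proof (cases "(v, p) \<in> blank s")
    case False
    then show ?thesis
      using t(1) c unfolding scan_node_def den.simps scanned_def by (simp del: bval.simps)
  next
    case True
    let ?t = "set_cell ''rp'' 0 p (set_cell ''rv'' 0 v (set_cell ''rf'' 0 1 t))"
    have t1: "best s (\<Union>x\<in>Y \<inter> blank s. node_cands s x) ?t" "?t ''v'' 0 = v" "?t ''p'' 0 = p"
      using t by (auto intro!: best_set_cell best simp: static_def)
    let ?u = "den offers_string ?t"
    have "best s ((\<Union>x\<in>Y \<inter> blank s. node_cands s x) \<union> string_cands s v p m) ?u"
      by (rule den_offers_string[OF s t1 True vp])
    moreover have "?u ''v'' 0 = v" "?u ''p'' 0 = p"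
      using t1 by (simp_all add: den_frame)
    ultimately have "best s ((\<Union>x\<in>Y \<inter> blank s. node_cands s x) \<union> string_cands s v p m \<union> point_cands s v p n)
        (den offers_point ?u)"
      by (rule den_offers_point[OF s _ _ _ True vp])
    moreover have "(\<Union>x\<in>insert (v, p) Y \<inter> blank s. node_cands s x)
        = (\<Union>x\<in>Y \<inter> blank s. node_cands s x) \<union> string_cands s v p m \<union> point_cands s v p n"
      using True by (auto simp: node_cands_def)
    moreover have "den scan_node t = den offers_point ?u"
    proof -
      have cT: "bval ?c t"
        using True c by blast
      show ?thesis
        unfolding scan_node_def den.simps if_P[OF cT] using t by simp
    qed
    moreover have "den offers_point ?u x = ?t x" if "x \<in> {''rf'', ''rv'', ''rp''}" for x
      using that by (auto simp: den_frame)
    ultimately show ?thesis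
      using True unfolding scanned_def by simp
  qed
qed

lemma scanned_set_cell:
  "scanned s Y t \<Longrightarrow> x \<notin> static \<union> {''X'', ''d'', ''e'', ''bk'', ''be'', ''bv'', ''bp'', ''rf'', ''rv'', ''rp''} \<Longrightarrow>
    scanned s Y (set_cell x i k t)"
  unfolding scanned_def using best_set_cell[of s _ t x i k] set_cell_other[of _ x i k t] by auto

lemma den_scan:
  assumes s: "levelled s"
  shows "agree s (den scan s)"
    "0 < den scan s ''bk'' 0 \<longrightarrow> ((den scan s ''bv'' 0, den scan s ''bp'' 0), den scan s ''bk'' 0) \<in> cands s \<and>
       den scan s ''be'' 0 = den scan s ''bk'' 0 mod 2"
    "\<And>x k. (x, k) \<in> cands s \<Longrightarrow> 0 < den scan s ''bk'' 0 \<and> den scan s ''bk'' 0 \<le> k"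
    "0 < den scan s ''rf'' 0 \<longrightarrow> (den scan s ''rv'' 0, den scan s ''rp'' 0) \<in> blank s"
    "blank s \<noteq> {} \<longrightarrow> 0 < den scan s ''rf'' 0"
proof -
  have env: "env s"
    using s by (simp add: levelled_def)
  let ?s = "set_cell ''rf'' 0 0 (set_cell ''bk'' 0 0 s)"
  have "scanned s ({..<n} \<times> {..<m}) (den (For ''v'' ''n'' (For ''p'' ''m'' scan_node)) ?s)"
  proof (rule grid_rule)
    have "env ?s"
      using env by (intro env_set_cell) (auto simp: static_def)
    then show "scanned s {} ?s"
      by (simp add: scanned_def best_def agree_def)
    show "env t" if "scanned s Y t" for Y t
      using that by (simp add: scanned_def best_def agree_def)
    show "scanned s Y (set_cell x 0 i t)" if "x \<in> {''v'', ''p''}" "scanned s Y t" for Y t x i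
      using that(2) by (rule scanned_set_cell) (use that(1) in \<open>auto simp: static_def\<close>)
    show "scanned s (insert (v, p) Y) (den scan_node t)"
      if "v < n" "p < m" "scanned s Y t" "t ''v'' 0 = v" "t ''p'' 0 = p" for Y t v p
      by (rule den_scan_node[OF s that(3,4,5,1,2)])
  qed simp
  then have sc: "scanned s ({..<n} \<times> {..<m}) (den scan s)"
    by (simp add: scan_def)
  have all: "{..<n} \<times> {..<m} \<inter> blank s = blank s"
    by (auto simp: blank_def node_set_def entry_def split: if_splits)
  have un: "(\<Union>x\<in>blank s. node_cands s x) = cands s"
    unfolding cands_eq[OF s] node_cands_def by (auto simp: case_prod_beta)
  note sc = sc[unfolded scanned_def all un best_def]
  show "agree s (den scan s)"
    "0 < den scan s ''bk'' 0 \<longrightarrow> ((den scan s ''bv'' 0, den scan s ''bp'' 0), den scan s ''bk'' 0) \<in> cands s \<and>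
       den scan s ''be'' 0 = den scan s ''bk'' 0 mod 2"
    "0 < den scan s ''rf'' 0 \<longrightarrow> (den scan s ''rv'' 0, den scan s ''rp'' 0) \<in> blank s"
    "blank s \<noteq> {} \<longrightarrow> 0 < den scan s ''rf'' 0"
    using sc by blast+
  show "0 < den scan s ''bk'' 0 \<and> den scan s ''bk'' 0 \<le> k" if "(x, k) \<in> cands s" for x k
    using sc that by blast
qed

section \<open>One step of the layering and its iteration\<close>

definition growing :: "store \<Rightarrow> store \<Rightarrow> bool" where
  "growing s t \<longleftrightarrow> levelled t \<and> t ''X'' = s ''X'' \<and>
     (\<exists>cur. partial_layering pE (node_set s ''X'') (entry t ''d'') cur)"

lemma put_node_step:
  assumes t: "agree s t" and s: "levelled s" and x: "(v, p) \<in> blank s" and k: "0 < k" "k' = k mod 2"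
  defines "t' \<equiv> set_cell ''e'' (v * m + p) k' (set_cell ''d'' (v * m + p) k t)"
  shows "levelled t'" "t' ''X'' = s ''X''" "entry t' ''d'' = (entry s ''d'')((v, p) := k)"
proof -
  have vp: "v < n" "p < m" "(v, p) \<in> node_set s ''X''"
    using x by (auto simp: blank_def node_set_def entry_def split: if_splits)
  have d: "entry t' ''d'' = (entry s ''d'')((v, p) := k)"
  proof -
    have "entry t' ''d'' = entry (set_cell ''d'' (v * m + p) k t) ''d''"
      by (rule entry_cong) (auto simp: t'_def fun_eq_iff)
    then show ?thesis
      using entry_set_cell[OF vp(1,2)] entry_agree[OF t] by simp
  qed
  have e: "entry t' ''e'' = (entry s ''e'')((v, p) := k')"
  proof -
    have "entry t' ''e'' = (entry (set_cell ''d'' (v * m + p) k t) ''e'')((v, p) := k')"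
      unfolding t'_def by (rule entry_set_cell[OF vp(1,2)])
    moreover have "entry (set_cell ''d'' (v * m + p) k t) ''e'' = entry s ''e''"
      using t by (intro entry_cong) (simp add: agree_def)
    ultimately show ?thesis by simp
  qed
  show X: "t' ''X'' = s ''X''"
    using t by (simp add: t'_def agree_def)
  then have "node_set t' ''X'' = node_set s ''X''"
    by (rule node_set_cong)
  moreover have "env t'"
    unfolding t'_def using t by (intro env_set_cell) (auto simp: agree_def static_def)
  ultimately show "levelled t'"
    using s d e k vp(3) unfolding levelled_def by (auto split: if_splits)
  show "entry t' ''d'' = (entry s ''d'')((v, p) := k)"
    by (rule d)
qed

text \<open>The step follows \<open>extend\<close> if the scan found an offer and
  \<open>new_root\<close> if it found only a blank node. Either way one blank node disappears, which
  is the progress measure for the loop.\<close>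

lemma den_layer_step:
  assumes s: "growing s t" and sym: "sym pE"
  shows "growing s (den layer_step t)"
    "blank t = {} \<and> blank (den layer_step t) = {} \<or> (\<exists>x\<in>blank t. blank (den layer_step t) = blank t - {x})"
proof -
  obtain cur where pl: "partial_layering pE (node_set s ''X'') (entry t ''d'') cur" and X: "t ''X'' = s ''X''" and lv: "levelled t"
    using s unfolding growing_def by blast
  have nX: "node_set t ''X'' = node_set s ''X''"
    using X by (rule node_set_cong)
  note sc = den_scan[OF lv]
  define w where "w = den scan t"
  note sc = sc[folded w_def]
  have envw: "env w"
    using sc(1) by (simp add: agree_def)
  interpret partial_layering pE "node_set s ''X''" "entry t ''d''" cur
    by (rule pl)
  have update: "growing s (set_cell ''e'' (v * m + p) k' (set_cell ''d'' (v * m + p) k w)) \<and>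
      blank (set_cell ''e'' (v * m + p) k' (set_cell ''d'' (v * m + p) k w)) = blank t - {(v, p)}"
    if x: "(v, p) \<in> blank t" and k: "0 < k" "k' = k mod 2"
      and "\<exists>cur. partial_layering pE (node_set s ''X'') ((entry t ''d'')((v, p) := k)) cur" for v p k k'
  proof -
    note P = put_node_step[OF sc(1) lv x k]
    have "node_set (set_cell ''e'' (v * m + p) k' (set_cell ''d'' (v * m + p) k w)) ''X'' = node_set t ''X''"
      by (rule node_set_cong) (rule P(2))
    then show ?thesis
      using P that X k unfolding growing_def blank_def by auto
  qed
  have "growing s (den layer_step t) \<and>
    (blank t = {} \<and> blank (den layer_step t) = {} \<or> (\<exists>x\<in>blank t. blank (den layer_step t) = blank t - {x}))"
  proof (cases "0 < w ''bk'' 0")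
    case True
    let ?v = "w ''bv'' 0" and ?p = "w ''bp'' 0" and ?k = "w ''bk'' 0"
    have k: "((?v, ?p), ?k) \<in> candidates pE (node_set s ''X'') (entry t ''d'')" "w ''be'' 0 = ?k mod 2"
      using sc(2) True nX by simp_all
    have least: "?k \<le> l" if "(y, l) \<in> candidates pE (node_set s ''X'') (entry t ''d'')" for y l
      using sc(3)[of y l] that nX by simp
    have pk: "partial_layering pE (node_set s ''X'') ((entry t ''d'')((?v, ?p) := ?k)) ?k"
      by (rule extend(1)[OF sym k(1)]) (erule least)
    have "(?v, ?p) \<in> node_set s ''X''"
      by (rule extend(2)[OF sym k(1)]) (erule least)
    moreover have "entry t ''d'' (?v, ?p) = 0"
      by (rule extend(3)[OF sym k(1)]) (erule least)
    ultimately have bl: "(?v, ?p) \<in> blank t"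
      using nX by (simp add: blank_def)
    then have vp: "?v < n" "?p < m"
      by (auto simp: blank_def node_set_def entry_def split: if_splits)
    have "den layer_step t = set_cell ''e'' (?v * m + ?p) (w ''be'' 0) (set_cell ''d'' (?v * m + ?p) ?k w)"
      using True vp envw by (simp add: layer_step_def w_def[symmetric] put_node_def)
    then show ?thesis
      using update[OF bl True k(2)] pk bl by (metis (no_types, lifting))
  next
    case False
    have none: "candidates pE (node_set s ''X'') (entry t ''d'') = {}"
      using sc(3) False nX by auto
    show ?thesis
    proof (cases "0 < w ''rf'' 0")
      case True
      let ?v = "w ''rv'' 0" and ?p = "w ''rp'' 0"
      have bl: "(?v, ?p) \<in> blank t"
        using sc(4) True by simp
      then have vp: "(?v, ?p) \<in> node_set s ''X''" "entry t ''d'' (?v, ?p) = 0"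
        using nX by (simp_all add: blank_def)
      then have "?v < n" "?p < m"
        by (auto simp: node_set_def entry_def split: if_splits)
      note vp = this vp
      have "den layer_step t = set_cell ''e'' (?v * m + ?p) 1 (set_cell ''d'' (?v * m + ?p) 1 w)"
        using True False vp envw by (simp add: layer_step_def w_def[symmetric] put_node_def)
      then show ?thesis
        using update[OF bl, of 1 1] new_root[OF sym none vp(3,4)] bl by auto
    next
      case no_root: False
      then have "blank t = {}"
        using sc(5) no_root by auto
      moreover have den: "den layer_step t = w"
        using False no_root by (simp add: layer_step_def w_def[symmetric])
      moreover have eq: "entry w ''d'' = entry t ''d''" "entry w ''e'' = entry t ''e''" "entry w ''X'' = entry t ''X''"
        using entry_agree[OF sc(1)] by auto
      then have "blank w = blank t" "growing s w"
        using s sc(1) envw X unfolding growing_def blank_def levelled_def node_set_def agree_def by simp_all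
      ultimately show ?thesis
        by simp
    qed
  qed
  then show "growing s (den layer_step t)"
    "blank t = {} \<and> blank (den layer_step t) = {} \<or> (\<exists>x\<in>blank t. blank (den layer_step t) = blank t - {x})"
    by blast+
qed


lemma writes_layer_step [simp]:
  "writes layer_step = {''v'', ''p'', ''rf'', ''rv'', ''rp'', ''q'', ''u'', ''bk'', ''be'', ''bv'', ''bp'', ''d'', ''e''}"
  by (auto simp: layer_step_def put_node_def)

lemma blank_cong:
  assumes "t ''X'' = s ''X''" "t ''d'' = s ''d''"
  shows "blank t = blank s"
  unfolding blank_def node_set_cong[of t "''X''" s, OF assms(1)] entry_cong[of t "''d''" s, OF assms(2)] ..

lemma growing_cong:
  assumes g: "growing s t" and eq: "t' ''X'' = t ''X''" "t' ''d'' = t ''d''" "t' ''e'' = t ''e''" and "env t'"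
  shows "growing s t'"
proof -
  have "entry t' ''d'' = entry t ''d''" "entry t' ''e'' = entry t ''e''" "node_set t' ''X'' = node_set t ''X''"
    by (rule entry_cong, rule eq)+ (rule node_set_cong, rule eq)
  then show ?thesis
    using assms unfolding growing_def levelled_def by simp
qed

lemma finite_blank: "finite (blank t)" and card_blank: "card (blank t) \<le> n * m"
proof -
  have "blank t \<subseteq> {..<n} \<times> {..<m}"
    by (auto simp: blank_def node_set_def entry_def split: if_splits)
  then show "finite (blank t)" "card (blank t) \<le> n * m"
    using card_mono[of "{..<n} \<times> {..<m}" "blank t"] finite_subset by auto
qed

lemma den_clear:
  assumes "env s"
  defines "c \<equiv> For ''v'' ''n'' (For ''p'' ''m'' (put_node ''d'' (cell ''v'') (cell ''p'') (Const 0)))"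
  shows "env (den c s)" "entry (den c s) ''d'' = (\<lambda>_. 0)" "den c s ''X'' = s ''X''"
proof -
  let ?I = "\<lambda>Y t. env t \<and> (\<forall>(v, p)\<in>Y. t ''d'' (v * m + p) = 0)"
  have "?I ({..<n} \<times> {..<m}) (den c s)"
    unfolding c_def
  proof (rule grid_rule[where I = ?I])
    show "?I Y (set_cell x 0 i t)" if "x \<in> {''v'', ''p''}" "?I Y t" for Y t x i
    proof -
      have "env (set_cell x 0 i t)"
        using that by (intro env_set_cell) (auto simp: static_def)
      moreover have "set_cell x 0 i t ''d'' = t ''d''"
        using that(1) by auto
      ultimately show ?thesis
        using that(2) by simp
    qed
    show "?I (insert (v, p) Y) (den (put_node ''d'' (cell ''v'') (cell ''p'') (Const 0)) t)"
      if "v < n" "p < m" "?I Y t" "t ''v'' 0 = v" "t ''p'' 0 = p" for Y t v p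
    proof -
      have "den (put_node ''d'' (cell ''v'') (cell ''p'') (Const 0)) t = set_cell ''d'' (v * m + p) 0 t"
        using that by (simp add: put_node_def)
      moreover have "env (set_cell ''d'' (v * m + p) 0 t)"
        using that(3) by (intro env_set_cell) (auto simp: static_def)
      ultimately show ?thesis
        using that(3) by auto
    qed
  qed (use assms(1) in \<open>simp_all add: put_node_def\<close>)
  then show "env (den c s)" "entry (den c s) ''d'' = (\<lambda>_. 0)"
    by (auto simp: entry_def fun_eq_iff)
  show "den c s ''X'' = s ''X''"
    unfolding c_def by (rule den_frame) (simp add: put_node_def)
qed

lemma den_layer:
  assumes s: "env s" and sym: "sym pE"
  shows "env (den layer s)" "layering pE (node_set s ''X'') (entry (den layer s) ''d'')"
    "\<And>x. x \<in> node_set s ''X'' \<Longrightarrow> entry (den layer s) ''e'' x = entry (den layer s) ''d'' x mod 2"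
proof -
  define t where "t = den (For ''v'' ''n'' (For ''p'' ''m'' (put_node ''d'' (cell ''v'') (cell ''p'') (Const 0)))) s"
  note c = den_clear[OF s, folded t_def]
  have "growing s t"
    using c partial_layering_empty[of pE "node_set s ''X''" 0] unfolding growing_def levelled_def by auto
  then have start: "growing s t \<and> card (blank t) \<le> n * m - 0"
    using card_blank by simp
  let ?J = "\<lambda>k t. growing s t \<and> card (blank t) \<le> n * m - k"
  have set: "?J k (set_cell x 0 i t)" if "?J k t" "x \<in> {''a'', ''b1''}" for k x i t
  proof -
    have "growing s (set_cell x 0 i t)"
      by (rule growing_cong[of s t]) (use that env_set_cell[of t x 0 i] in \<open>auto simp: growing_def levelled_def static_def\<close>)
    moreover have "blank (set_cell x 0 i t) = blank t"
      by (rule blank_cong) (use that in auto)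
    ultimately show ?thesis
      using that by simp
  qed
  have step: "?J (k + 1) (den layer_step t)" if J: "?J k t" for k t
  proof -
    consider "blank (den layer_step t) = {}" | x where "x \<in> blank t" "blank (den layer_step t) = blank t - {x}"
      using den_layer_step(2)[OF conjunct1[OF J] sym] by blast
    then have "card (blank (den layer_step t)) \<le> n * m - (k + 1)"
    proof cases
      case 2
      then have "card (blank (den layer_step t)) = card (blank t) - 1"
        using finite_blank by simp
      then show ?thesis
        using diff_le_mono[OF conjunct2[OF J], of 1] by simp
    qed simp
    then show ?thesis
      using den_layer_step(1)[OF conjunct1[OF J] sym] by simp
  qed
  have loop: "?J (k + N * c) (den (For x b p) t)"
    if p: "\<And>k t. ?J k t \<Longrightarrow> ?J (k + c) (den p t)" and t: "?J k t" and x: "x \<in> {''a'', ''b1''}"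
      and N: "\<And>t. env t \<Longrightarrow> t b 0 = N" for p c x k t b N
  proof (rule For_rule_bound[where I = "\<lambda>i. ?J (k + i * c)" and k = N])
    show "t b 0 = N" "?J (k + 0 * c) t"
      using t by (auto simp: growing_def levelled_def intro: N)
    show "?J (k + Suc i * c) (den p (set_cell x 0 i t'))" if "?J (k + i * c) t'" for i t'
      using p[OF set[OF that x, of i]] by (simp add: add.commute add.left_commute)
    show "?J (k + N * c) (set_cell x 0 N t')" if "?J (k + N * c) t'" for t'
      using set[OF that x] .
  qed
  have inner: "?J (k + m * 1) (den (For ''b1'' ''m'' layer_step) t)" if "?J k t" for k t
    by (rule loop[OF step that]) simp_all
  have "?J (0 + n * (m * 1)) (den (For ''a'' ''n'' (For ''b1'' ''m'' layer_step)) t)"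
    by (rule loop[OF inner start]) simp_all
  then have J: "growing s (den layer s)" "blank (den layer s) = {}"
    using finite_blank by (simp_all add: layer_def t_def[symmetric])
  then obtain cur where pl: "partial_layering pE (node_set s ''X'') (entry (den layer s) ''d'') cur" and
    lv: "levelled (den layer s)" and X: "den layer s ''X'' = s ''X''"
    unfolding growing_def by blast
  have "node_set (den layer s) ''X'' = node_set s ''X''"
    using X by (rule node_set_cong)
  note same = this
  have pos: "0 < entry (den layer s) ''d'' x" if "x \<in> node_set s ''X''" for x
  proof (rule ccontr)
    assume "\<not> ?thesis"
    then have "x \<in> blank (den layer s)"
      using that same by (simp add: blank_def)
    then show False
      using J(2) by simp
  qed
  show "env (den layer s)"
    using lv by (simp add: levelled_def)
  show "layering pE (node_set s ''X'') (entry (den layer s) ''d'')"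
    by (rule partial_layering.complete[OF pl pos])
  show "entry (den layer s) ''e'' x = entry (den layer s) ''d'' x mod 2" if "x \<in> node_set s ''X''" for x
    using lv pos[OF that] unfolding levelled_def by blast
qed

end

section \<open>Choosing parity classes\<close>

text \<open>Vertices of the target set \<open>T\<close> contribute all their nodes to \<open>X\<close>, the other vertices those not
  covered from the previous level.\<close>

definition below_test :: prog where
  "below_test =
     put ''f'' (Const 1) ;;
     For ''u'' ''n''
       (If (Conj (true (Read ''A'' (cell ''u''))) (Conj (true (node_at ''S'' (cell ''u'') (cell ''p'')))
             (eq (Add (node_at ''d'' (cell ''u'') (cell ''p'')) (Const 1)) (node_at ''d'' (cell ''v'') (cell ''p'')))))
          (put ''f'' (Const 0)) Nop)"

definition expose_node :: prog where
  "expose_node =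
     below_test ;;
     If (Conj (Conj (true (node_at ''S'' (cell ''v'') (cell ''p''))) (true (Read ''A'' (cell ''v''))))
           (Neg (Conj (Neg (true (Read ''T'' (cell ''v'')))) (Neg (true (cell ''f''))))))
       (put_node ''X'' (cell ''v'') (cell ''p'') (Const 1))
       (put_node ''X'' (cell ''v'') (cell ''p'') (Const 0))"

definition expose :: prog where
  "expose = For ''v'' ''n'' (For ''p'' ''m'' expose_node)"

definition copy :: "string \<Rightarrow> string \<Rightarrow> prog" where
  "copy x y = For ''v'' ''n'' (Assign x (cell ''v'') (Read y (cell ''v'')))"

text \<open>A string of \<open>T\<close> has the same level at all its points, so the last point
  visited may decide.\<close>

definition get_parity :: prog where
  "get_parity =
     For ''p'' ''m'' (If (true (node_at ''S'' (cell ''v'') (cell ''p''))) (put ''f'' (node_at ''e'' (cell ''v'') (cell ''p''))) Nop)"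

definition count_parity :: prog where
  "count_parity =
     put ''c0'' (Const 0) ;; put ''c1'' (Const 0) ;;
     For ''v'' ''n''
       (get_parity ;; Assign ''par'' (cell ''v'') (cell ''f'') ;;
        If (true (Read ''T'' (cell ''v'')))
          (If (true (cell ''f'')) (put ''c1'' (Add (cell ''c1'') (Const 1))) (put ''c0'' (Add (cell ''c0'') (Const 1))))
          Nop)"

definition drop_if :: "bexp \<Rightarrow> prog" where
  "drop_if c =
     For ''v'' ''n''
       (If (Conj (true (Read ''T'' (cell ''v''))) c)
          (Assign ''T'' (cell ''v'') (Const 0) ;; Assign ''C'' (cell ''v'') (Const 1)) Nop)"

definition select :: prog where
  "select =
     count_parity ;;
     If (Less (cell ''c0'') (cell ''c1''))
       (drop_if (Neg (true (Read ''par'' (cell ''v'')))))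
       (drop_if (true (Read ''par'' (cell ''v''))))"

context input
begin

lemma den_below_test:
  assumes "env s" "s ''v'' 0 = v" "s ''p'' 0 = p" "v < n" "p < m"
  shows "0 < den below_test s ''f'' 0 \<longleftrightarrow>
    (\<forall>u\<in>marked s ''A''. p \<in> S u \<longrightarrow> entry s ''d'' (u, p) + 1 \<noteq> entry s ''d'' (v, p))"
proof -
  let ?c = "Conj (true (Read ''A'' (cell ''u''))) (Conj (true (node_at ''S'' (cell ''u'') (cell ''p'')))
             (eq (Add (node_at ''d'' (cell ''u'') (cell ''p'')) (Const 1)) (node_at ''d'' (cell ''v'') (cell ''p''))))"
  let ?Q = "\<lambda>u. u \<in> marked s ''A'' \<and> p \<in> S u \<and> entry s ''d'' (u, p) + 1 = entry s ''d'' (v, p)"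
  let ?s = "set_cell ''f'' 0 1 s"
  have "den (For ''u'' ''n'' (If ?c (put ''f'' (Const 0)) Nop)) ?s ''f'' 0 = (if \<exists>u<n. ?Q u then 0 else ?s ''f'' 0)"
  proof (rule den_flag_loop)
    show "?s ''n'' 0 = n" "''u'' \<noteq> ''f''"
      using assms by simp_all
    fix i t assume i: "i < n" and fr: "\<And>y. y \<noteq> ''u'' \<Longrightarrow> y \<noteq> ''f'' \<Longrightarrow> t y = ?s y"
    show "bval ?c (set_cell ''u'' 0 i t) \<longleftrightarrow> ?Q i"
      using i fr assms env_simps(4)[OF assms(1)] env_simps(7)[OF assms(1) i assms(5)]
      by (simp add: marked_def entry_def)
  qed
  moreover have "(\<exists>u<n. ?Q u) \<longleftrightarrow> (\<exists>u. ?Q u)"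
    by (auto simp: marked_def)
  ultimately show ?thesis
    using assms by (auto simp: below_test_def)
qed

lemma writes_expose [simp]: "writes below_test = {''f'', ''u''}" "writes expose_node = {''f'', ''u'', ''X''}"
    "writes expose = {''v'', ''p'', ''f'', ''u'', ''X''}"
  by (auto simp: below_test_def expose_node_def expose_def put_node_def)

text \<open>Membership in \<open>T\<close> takes the place of the parity test in
  \<open>exposed\<close>. If \<open>T\<close> is all of \<open>A\<close>, every node is exposed, so
  one program serves for the layering of all nodes as well.\<close>

definition exposed_nodes :: "store \<Rightarrow> (nat \<times> nat) set" where
  "exposed_nodes s = {(v, p). v \<in> marked s ''A'' \<and> p \<in> S v \<and> (v \<in> marked s ''T'' \<or>
     (\<forall>u\<in>marked s ''A''. p \<in> S u \<longrightarrow> entry s ''d'' (u, p) + 1 \<noteq> entry s ''d'' (v, p)))}"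

lemma den_expose:
  assumes "env s"
  shows "env (den expose s)" "node_set (den expose s) ''X'' = exposed_nodes s"
proof -
  let ?I = "\<lambda>Y t. env t \<and> t ''A'' = s ''A'' \<and> t ''T'' = s ''T'' \<and> t ''d'' = s ''d'' \<and>
    (\<forall>x\<in>Y. x \<in> node_set t ''X'' \<longleftrightarrow> x \<in> exposed_nodes s)"
  have "?I ({..<n} \<times> {..<m}) (den expose s)"
    unfolding expose_def
  proof (rule grid_rule[where I = ?I])
    show "?I Y (set_cell x 0 i t)" if "x \<in> {''v'', ''p''}" "?I Y t" for Y t x i
    proof -
      have "env (set_cell x 0 i t)"
        using that by (intro env_set_cell) (auto simp: static_def)
      moreover have "y \<notin> {''v'', ''p''} \<Longrightarrow> set_cell x 0 i t y = t y" for y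
        using that(1) by (metis set_cell_other)
      moreover from this have "node_set (set_cell x 0 i t) ''X'' = node_set t ''X''"
        by (intro node_set_cong) simp
      ultimately show ?thesis
        using that(2) by simp
    qed
    show "?I (insert (v, p) Y) (den expose_node t)"
      if vp: "v < n" "p < m" and I: "?I Y t" and t: "t ''v'' 0 = v" "t ''p'' 0 = p" for Y t v p
    proof -
      define w where "w = den below_test t"
      have fr: "w y = t y" if "y \<notin> {''f'', ''u''}" for y
        unfolding w_def using that by (intro den_frame) simp
      have w: "w ''v'' 0 = v" "w ''p'' 0 = p" "w ''A'' = s ''A''" "w ''T'' = s ''T''" "w ''X'' = t ''X''" "w ''d'' = s ''d''"
        using fr I t by simp_all
      have env: "env w"
        unfolding w_def using I by (intro env_den) (auto simp: static_def)
      have m: "marked t ''A'' = marked s ''A''" "entry t ''d'' = entry s ''d''"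
        using I by (auto simp: marked_def intro!: entry_cong)
      have f: "0 < w ''f'' 0 \<longleftrightarrow> (\<forall>u\<in>marked s ''A''. p \<in> S u \<longrightarrow> entry s ''d'' (u, p) + 1 \<noteq> entry s ''d'' (v, p))"
        using den_below_test[OF conjunct1[OF I] t vp] m unfolding w_def by simp
      let ?k = "of_bool ((v, p) \<in> exposed_nodes s)"
      let ?c = "Conj (Conj (true (node_at ''S'' (cell ''v'') (cell ''p''))) (true (Read ''A'' (cell ''v''))))
           (Neg (Conj (Neg (true (Read ''T'' (cell ''v'')))) (Neg (true (cell ''f'')))))"
      have "(v, p) \<in> exposed_nodes s \<longleftrightarrow> 0 < s ''A'' v \<and> p \<in> S v \<and> (0 < s ''T'' v \<or> 0 < w ''f'' 0)"
        unfolding f using vp by (auto simp: exposed_nodes_def marked_def)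
      then have c: "bval ?c w \<longleftrightarrow> (v, p) \<in> exposed_nodes s"
        using w vp env env_simps(7)[OF env vp] by auto
      have "den expose_node t = set_cell ''X'' (v * m + p) ?k w"
      proof (cases "(v, p) \<in> exposed_nodes s")
        case True
        then have b: "bval ?c w"
          using c by blast
        show ?thesis
          unfolding expose_node_def den.simps w_def[symmetric] if_P[OF b] using True w vp env by (simp add: put_node_def)
      next
        case False
        then have b: "\<not> bval ?c w"
          using c by blast
        show ?thesis
          unfolding expose_node_def den.simps w_def[symmetric] if_not_P[OF b] using False w vp env by (simp add: put_node_def)
      qed
      moreover have "env (set_cell ''X'' (v * m + p) ?k w)"
        using env by (intro env_set_cell) (auto simp: static_def)
      moreover have "entry (set_cell ''X'' (v * m + p) ?k w) ''X'' = (entry t ''X'')((v, p) := ?k)"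
        unfolding entry_set_cell[OF vp] using w(5) by (simp add: entry_cong[of w "''X''" t])
      ultimately show ?thesis
        using w I by (auto simp: node_set_def)
    qed
  qed (use assms in auto)
  moreover have "node_set t ''X'' \<subseteq> {..<n} \<times> {..<m}" for t
    by (auto simp: node_set_def entry_def split: if_splits)
  moreover have "exposed_nodes s \<subseteq> {..<n} \<times> {..<m}"
    using S by (auto simp: exposed_nodes_def marked_def)
  ultimately show "env (den expose s)" "node_set (den expose s) ''X'' = exposed_nodes s"
    by (blast, blast)
qed

lemma den_copy:
  assumes "env s" "x \<notin> static" "x \<noteq> ''v''" "y \<noteq> ''v''" "x \<noteq> y"
  shows "env (den (copy x y) s)" "marked (den (copy x y) s) x = marked s y"
proof -
  have "\<forall>v<n. den (copy x y) s x v = s y v"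
    unfolding copy_def
    by (rule For_rule_bound[where I = "\<lambda>i t. \<forall>v<i. t x v = s y v" and k = n])
      (use assms in \<open>auto simp: less_Suc_eq\<close>)
  then show "marked (den (copy x y) s) x = marked s y"
    by (auto simp: marked_def)
  show "env (den (copy x y) s)"
    using assms by (intro env_den) (auto simp: copy_def static_def)
qed

lemma den_get_parity:
  assumes "env s" "s ''v'' 0 = v" "v < n" "\<And>p. p \<in> S v \<Longrightarrow> entry s ''e'' (v, p) = k"
  shows "den get_parity s ''f'' 0 = k"
proof -
  let ?b = "If (true (node_at ''S'' (cell ''v'') (cell ''p''))) (put ''f'' (node_at ''e'' (cell ''v'') (cell ''p''))) Nop"
  have "(\<exists>p<m. p \<in> S v) \<longrightarrow> den get_parity s ''f'' 0 = k"
    unfolding get_parity_def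
  proof (rule For_rule_bound[where I = "\<lambda>i t. (\<exists>p<i. p \<in> S v) \<longrightarrow> t ''f'' 0 = k" and k = m])
    fix i t assume i: "i < m" and I: "(\<exists>p<i. p \<in> S v) \<longrightarrow> t ''f'' 0 = k"
      and fr: "\<And>y. y \<noteq> ''p'' \<Longrightarrow> y \<notin> writes ?b \<Longrightarrow> t y = s y"
    have "s ''e'' (v * m + i) = k" if "i \<in> S v"
      using assms(4)[OF that] assms(3) i by (simp add: entry_def)
    then show "(\<exists>p<Suc i. p \<in> S v) \<longrightarrow> den ?b (set_cell ''p'' 0 i t) ''f'' 0 = k"
      using I fr assms(2,3) i env_simps(4)[OF assms(1,3)] env_simps(7)[OF assms(1,3) i] by (auto simp: less_Suc_eq)
  qed (use assms in auto)
  then show ?thesis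
    using S[OF assms(3)] by auto
qed

lemma writes_select [simp]: "writes get_parity = {''p'', ''f''}" "writes count_parity = {''c0'', ''c1'', ''v'', ''p'', ''f'', ''par''}"
  "writes (drop_if c) = {''v'', ''T'', ''C''}" "writes select = {''c0'', ''c1'', ''v'', ''p'', ''f'', ''par'', ''T'', ''C''}"
  by (auto simp: get_parity_def count_parity_def drop_if_def select_def)

lemma den_count_parity:
  assumes s: "env s" and k: "\<And>v p. v \<in> marked s ''T'' \<Longrightarrow> p \<in> S v \<Longrightarrow> entry s ''e'' (v, p) = k v"
  shows "\<And>v. v \<in> marked s ''T'' \<Longrightarrow> den count_parity s ''par'' v = k v"
    "den count_parity s ''c1'' 0 = card {v \<in> marked s ''T''. 0 < k v}"
    "den count_parity s ''c0'' 0 = card {v \<in> marked s ''T''. \<not> 0 < k v}"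
proof -
  let ?q = "If (true (Read ''T'' (cell ''v'')))
          (If (true (cell ''f'')) (put ''c1'' (Add (cell ''c1'') (Const 1))) (put ''c0'' (Add (cell ''c0'') (Const 1))))
          Nop"
  let ?b = "get_parity ;; Assign ''par'' (cell ''v'') (cell ''f'') ;; ?q"
  let ?s = "set_cell ''c1'' 0 0 (set_cell ''c0'' 0 0 s)"
  let ?T = "marked s ''T''"
  let ?I = "\<lambda>i t. (\<forall>v\<in>?T. v < i \<longrightarrow> t ''par'' v = k v) \<and>
    t ''c1'' 0 = card {v \<in> ?T. v < i \<and> 0 < k v} \<and> t ''c0'' 0 = card {v \<in> ?T. v < i \<and> \<not> 0 < k v}"
  have next_card: "card {v \<in> ?T. v < Suc i \<and> P v} = card {v \<in> ?T. v < i \<and> P v} + of_bool (i \<in> ?T \<and> P i)" for P i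
  proof -
    have "{v \<in> ?T. v < Suc i \<and> P v} = (if i \<in> ?T \<and> P i then insert i {v \<in> ?T. v < i \<and> P v} else {v \<in> ?T. v < i \<and> P v})"
      by (auto simp: less_Suc_eq)
    then show ?thesis
      by simp
  qed
  have "?I n (den (For ''v'' ''n'' ?b) ?s)"
  proof (rule For_rule_bound[where I = ?I and k = n])
    fix i t assume i: "i < n" and I: "?I i t" and fr: "\<And>y. y \<noteq> ''v'' \<Longrightarrow> y \<notin> writes ?b \<Longrightarrow> t y = ?s y"
    let ?t = "set_cell ''v'' 0 i t"
    have "env ?s"
      using s by (intro env_set_cell) (auto simp: static_def)
    then have env: "env ?t"
      using env_loop[of ?s "''v''" "writes ?b" t i] fr by (simp add: static_def)
    define w where "w = den get_parity ?t"
    have w: "w ''T'' = s ''T''" "w ''par'' = t ''par''" "w ''c0'' = t ''c0''" "w ''c1'' = t ''c1''" "w ''v'' 0 = i"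
      unfolding w_def using den_frame[of _ get_parity ?t] fr by simp_all
    have T: "0 < s ''T'' i \<longleftrightarrow> i \<in> ?T"
      using i by (simp add: marked_def)
    have f: "w ''f'' 0 = k i" if "i \<in> ?T"
      unfolding w_def
    proof (rule den_get_parity[OF env])
      show "entry ?t ''e'' (i, p) = k i" if "p \<in> S i" for p
        using k[OF \<open>i \<in> ?T\<close> that] fr entry_cong[of ?t "''e''" s] by simp
    qed (use i in simp_all)
    have den: "den ?b ?t = den ?q (set_cell ''par'' i (w ''f'' 0) w)"
      using w by (simp add: w_def[symmetric])
    show "?I (Suc i) (den ?b ?t)"
      unfolding den using I w T f next_card[of i] by (cases "i \<in> ?T"; cases "0 < k i") (auto simp: less_Suc_eq)
  qed (use s in auto)
  moreover have den: "den count_parity s = den (For ''v'' ''n'' ?b) ?s"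
    by (simp add: count_parity_def)
  moreover have eq: "{v \<in> ?T. v < n \<and> P v} = {v \<in> ?T. P v}" for P
    by (auto simp: marked_def)
  ultimately have I: "?I n (den count_parity s)"
    unfolding den by blast
  show "den count_parity s ''c1'' 0 = card {v \<in> marked s ''T''. 0 < k v}"
    "den count_parity s ''c0'' 0 = card {v \<in> marked s ''T''. \<not> 0 < k v}"
    using I unfolding eq by blast+
  show "den count_parity s ''par'' v = k v" if "v \<in> ?T" for v
    using I that by (simp add: marked_def)
qed

lemma den_drop_if:
  assumes s: "env s" and c: "\<And>t v. v \<in> marked s ''T'' \<Longrightarrow> t ''par'' = s ''par'' \<Longrightarrow> t ''v'' 0 = v \<Longrightarrow> bval c t \<longleftrightarrow> Q v"
  shows "marked (den (drop_if c) s) ''T'' = {v \<in> marked s ''T''. \<not> Q v}"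
    "marked (den (drop_if c) s) ''C'' = marked s ''C'' \<union> {v \<in> marked s ''T''. Q v}"
proof -
  let ?b = "If (Conj (true (Read ''T'' (cell ''v''))) c)
          (Assign ''T'' (cell ''v'') (Const 0) ;; Assign ''C'' (cell ''v'') (Const 1)) Nop"
  let ?D = "{v \<in> marked s ''T''. Q v}"
  let ?I = "\<lambda>i t. \<forall>v<n. t ''T'' v = (if v < i \<and> v \<in> ?D then 0 else s ''T'' v) \<and>
    t ''C'' v = (if v < i \<and> v \<in> ?D then 1 else s ''C'' v)"
  have "?I n (den (drop_if c) s)"
    unfolding drop_if_def
  proof (rule For_rule_bound[where I = ?I and k = n])
    fix i t assume i: "i < n" and I: "?I i t" and fr: "\<And>y. y \<noteq> ''v'' \<Longrightarrow> y \<notin> writes ?b \<Longrightarrow> t y = s y"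
    let ?t = "set_cell ''v'' 0 i t"
    have T: "t ''T'' i = s ''T'' i"
      using I i by simp
    have b: "bval (Conj (true (Read ''T'' (cell ''v''))) c) ?t \<longleftrightarrow> i \<in> ?D"
      using c[of i ?t] fr[of "''par''"] T i by (auto simp: marked_def)
    show "?I (Suc i) (den ?b ?t)"
    proof (cases "i \<in> ?D")
      case True
      then have "bval (Conj (true (Read ''T'' (cell ''v''))) c) ?t"
        using b by blast
      then have "den ?b ?t = set_cell ''C'' i 1 (set_cell ''T'' i 0 ?t)"
        unfolding den.simps by (simp only: if_True) simp
      then show ?thesis
        using I True by (auto simp: less_Suc_eq)
    next
      case False
      then have "\<not> bval (Conj (true (Read ''T'' (cell ''v''))) c) ?t"
        using b by blast
      then have "den ?b ?t = ?t"
        unfolding den.simps by (simp only: if_False)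
      then show ?thesis
        using I False by (auto simp: less_Suc_eq)
    qed
  qed (use s in auto)
  then have "den (drop_if c) s ''T'' v = (if v \<in> ?D then 0 else s ''T'' v)"
    "den (drop_if c) s ''C'' v = (if v \<in> ?D then 1 else s ''C'' v)" if "v < n" for v
    using that by auto
  then show "marked (den (drop_if c) s) ''T'' = {v \<in> marked s ''T''. \<not> Q v}"
    "marked (den (drop_if c) s) ''C'' = marked s ''C'' \<union> ?D"
    by (auto simp: marked_def split: if_splits)
qed

lemma den_select:
  assumes s: "env s" and k: "\<And>v p. v \<in> marked s ''T'' \<Longrightarrow> p \<in> S v \<Longrightarrow> entry s ''e'' (v, p) = k v"
  shows "env (den select s)"
    "\<exists>b. marked (den select s) ''T'' = {v \<in> marked s ''T''. (0 < k v) = b}"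
    "marked (den select s) ''C'' = marked s ''C'' \<union> (marked s ''T'' - marked (den select s) ''T'')"
    "card (marked s ''T'') \<le> 2 * card (marked (den select s) ''T'')"
proof -
  show "env (den select s)"
    using s by (intro env_den) (auto simp: static_def)
  define t where "t = den count_parity s"
  have env: "env t"
    unfolding t_def using s by (intro env_den) (auto simp: static_def)
  have m: "marked t ''T'' = marked s ''T''" "marked t ''C'' = marked s ''C''"
    unfolding t_def by (simp_all add: marked_def den_frame)
  note c = den_count_parity[OF s k, folded t_def]
  let ?T = "marked s ''T''"
  have sum: "card ?T = card {v \<in> ?T. 0 < k v} + card {v \<in> ?T. \<not> 0 < k v}"
    by (subst card_Un_disjoint[symmetric]) (auto intro!: arg_cong[of _ _ card])
  have split: "?T - {v \<in> ?T. 0 < k v} = {v \<in> ?T. \<not> 0 < k v}" "?T - {v \<in> ?T. k v = 0} = {v \<in> ?T. 0 < k v}"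
    by auto
  let ?d = "if t ''c0'' 0 < t ''c1'' 0 then drop_if (Neg (true (Read ''par'' (cell ''v'')))) else drop_if (true (Read ''par'' (cell ''v'')))"
  have den: "den select s = den ?d t"
    by (simp add: select_def t_def)
  have "(\<exists>b. marked (den select s) ''T'' = {v \<in> ?T. (0 < k v) = b}) \<and>
    marked (den select s) ''C'' = marked s ''C'' \<union> (?T - marked (den select s) ''T'') \<and>
    card ?T \<le> 2 * card (marked (den select s) ''T'')"
  proof (cases "t ''c0'' 0 < t ''c1'' 0")
    case True
    have D: "marked (den select s) ''T'' = {v \<in> ?T. \<not> \<not> 0 < k v}"
      "marked (den select s) ''C'' = marked s ''C'' \<union> {v \<in> ?T. \<not> 0 < k v}"
      unfolding den if_P[OF True]
      using den_drop_if[OF env, of "Neg (true (Read ''par'' (cell ''v'')))" "\<lambda>v. \<not> 0 < k v"] c(1) m by simp_all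
    then show ?thesis
      using True c(2,3) sum split by (intro conjI exI[of _ True]) simp_all
  next
    case False
    have D: "marked (den select s) ''T'' = {v \<in> ?T. \<not> 0 < k v}"
      "marked (den select s) ''C'' = marked s ''C'' \<union> {v \<in> ?T. 0 < k v}"
      unfolding den if_not_P[OF False]
      using den_drop_if[OF env, of "true (Read ''par'' (cell ''v''))" "\<lambda>v. 0 < k v"] c(1) m by simp_all
    then show ?thesis
      using False c(2,3) sum split by (intro conjI exI[of _ False]) simp_all
  qed
  then show "\<exists>b. marked (den select s) ''T'' = {v \<in> ?T. (0 < k v) = b}"
    "marked (den select s) ''C'' = marked s ''C'' \<union> (?T - marked (den select s) ''T'')"
    "card ?T \<le> 2 * card (marked (den select s) ''T'')"
    by blast+
qed

end

section \<open>The three stages and the total cost\<close>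

definition stage :: prog where
  "stage = expose ;; layer ;; select"

text \<open>The first stage yields \<open>L\<close>, the second \<open>M\<close> on the nodes
  exposed with respect to the first choice. Before the third, \<open>A\<close> becomes the set of
  survivors, so that only these are layered and coloured by parity.\<close>

definition stages :: prog where
  "stages = copy ''T'' ''A'' ;; stage ;; stage ;; copy ''A'' ''T'' ;; stage"

context input
begin

lemma writes_copy [simp]: "writes (copy x y) = {''v'', x}"
  by (simp add: copy_def)

lemma writes_layer [simp]:
  "writes layer = {''v'', ''p'', ''d'', ''a'', ''b1'', ''rf'', ''rv'', ''rp'', ''q'', ''u'', ''bk'', ''be'', ''bv'', ''bp'', ''e''}"
  unfolding layer_def put_node_def writes.simps writes_layer_step by (rule subset_antisym) simp_all

lemma den_stage:
  assumes s: "env s" and sym: "sym pE" and linked: "\<forall>v<n. linked pE (S v)"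
    and sub: "marked s ''T'' \<subseteq> marked s ''A''"
  shows "env (den stage s)" "marked (den stage s) ''A'' = marked s ''A''"
    "layering pE (exposed_nodes s) (entry (den stage s) ''d'')"
    "\<exists>b. \<forall>v\<in>marked s ''T''. \<forall>p\<in>S v. v \<in> marked (den stage s) ''T'' \<longleftrightarrow> odd (entry (den stage s) ''d'' (v, p)) = b"
    "marked (den stage s) ''T'' \<subseteq> marked s ''T''"
    "marked (den stage s) ''C'' = marked s ''C'' \<union> (marked s ''T'' - marked (den stage s) ''T'')"
    "card (marked s ''T'') \<le> 2 * card (marked (den stage s) ''T'')"
proof -
  define s1 where "s1 = den expose s"
  define s2 where "s2 = den layer s1"
  have den: "den stage s = den select s2"
    by (simp add: stage_def s1_def s2_def)
  note s1 = den_expose[OF s, folded s1_def]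
  note s2 = den_layer[OF s1(1) sym, folded s2_def, unfolded s1(2)]
  have fr1: "s1 ''A'' = s ''A''" "s1 ''T'' = s ''T''" "s1 ''C'' = s ''C''"
    unfolding s1_def by (simp_all add: den_frame)
  have fr2: "s2 ''A'' = s ''A''" "s2 ''T'' = s ''T''" "s2 ''C'' = s ''C''"
    unfolding s2_def using fr1 by (simp_all add: den_frame)
  have marked2: "marked s2 x = marked s x" if "x \<in> {''A'', ''T'', ''C''}" for x
    using that fr2 by (intro marked_cong) auto
  define k where "k v = entry s2 ''d'' (v, SOME p. p \<in> S v) mod 2" for v
  have k: "entry s2 ''d'' (v, p) mod 2 = k v" and k': "entry s2 ''e'' (v, p) = k v"
    if "v \<in> marked s ''T''" "p \<in> S v" for v p
  proof -
    have X: "(v, q) \<in> exposed_nodes s" if "q \<in> S v" for q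
      using that \<open>v \<in> marked s ''T''\<close> sub by (auto simp: exposed_nodes_def)
    have "(SOME p. p \<in> S v) \<in> S v"
      using that(2) by (rule someI)
    moreover have "linked pE (S v)"
      using linked that(1) by (simp add: marked_def)
    ultimately have "entry s2 ''d'' (v, p) = entry s2 ''d'' (v, SOME p. p \<in> S v)"
      using that(2) X by (intro level_whole_string[OF sym s2(2)])
    then show "entry s2 ''d'' (v, p) mod 2 = k v"
      by (simp add: k_def)
    then show "entry s2 ''e'' (v, p) = k v"
      using s2(3)[OF X[OF that(2)]] by simp
  qed
  have T2: "v \<in> marked s2 ''T'' \<Longrightarrow> v \<in> marked s ''T''" for v
    by (simp add: marked2)
  have sel: "env (den select s2)"
    "\<exists>b. marked (den select s2) ''T'' = {v \<in> marked s2 ''T''. (0 < k v) = b}"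
    "marked (den select s2) ''C'' = marked s2 ''C'' \<union> (marked s2 ''T'' - marked (den select s2) ''T'')"
    "card (marked s2 ''T'') \<le> 2 * card (marked (den select s2) ''T'')"
    by (rule den_select[OF s2(1)]; use k' T2 in blast)+
  have "den stage s ''d'' = s2 ''d''" "den stage s ''A'' = s2 ''A''"
    unfolding den by (simp_all add: den_frame)
  then have d: "entry (den stage s) ''d'' = entry s2 ''d''"
    by (intro entry_cong)
  show "env (den stage s)" "layering pE (exposed_nodes s) (entry (den stage s) ''d'')"
    using sel(1) s2(2) unfolding d by (simp_all add: den)
  show "marked (den stage s) ''A'' = marked s ''A''"
    using \<open>den stage s ''A'' = s2 ''A''\<close> fr2 by (simp add: marked_def)
  show "marked (den stage s) ''C'' = marked s ''C'' \<union> (marked s ''T'' - marked (den stage s) ''T'')"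
    "card (marked s ''T'') \<le> 2 * card (marked (den stage s) ''T'')"
    using sel(3,4) by (simp_all add: den marked2)
  obtain b where b: "marked (den stage s) ''T'' = {v \<in> marked s ''T''. (0 < k v) = b}"
    using sel(2) by (auto simp: den marked2)
  then show "marked (den stage s) ''T'' \<subseteq> marked s ''T''"
    by blast
  have "v \<in> marked (den stage s) ''T'' \<longleftrightarrow> odd (entry s2 ''d'' (v, p)) = b" if "v \<in> marked s ''T''" "p \<in> S v" for v p
  proof -
    have "0 < k v \<longleftrightarrow> odd (entry s2 ''d'' (v, p))"
      unfolding k[OF that, symmetric] by (simp add: odd_iff_mod_2_eq_one)
    then show ?thesis
      unfolding b using that(1) by simp
  qed
  then show "\<exists>b. \<forall>v\<in>marked s ''T''. \<forall>p\<in>S v. v \<in> marked (den stage s) ''T'' \<longleftrightarrow> odd (entry (den stage s) ''d'' (v, p)) = b"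
    unfolding d by (intro exI[of _ b] ballI)
qed

lemma exposed_nodes_all: "marked s ''T'' = marked s ''A'' \<Longrightarrow> exposed_nodes s = nodes (marked s ''A'') S"
  by (auto simp: exposed_nodes_def nodes_def)

lemma den_stages:
  assumes s: "kernel s" and plane: "plane_graph P \<phi> \<gamma>" and P: "parcs P = pE"
    and linked: "\<forall>v<n. linked pE (S v)"
    and edge: "\<And>u v. u < n \<Longrightarrow> v < n \<Longrightarrow> u \<noteq> v \<Longrightarrow> (u, v) \<in> gE \<longleftrightarrow> S u \<inter> S v \<noteq> {}"
  shows "cover (marked (den stages s) ''C'')"
    "cover K \<Longrightarrow> 6 * card (marked (den stages s) ''C'') \<le> 11 * card (K \<inter> {..<n})"
proof -
  have symE: "sym pE"
    using plane_graph.sym_adj[OF plane] P by simp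
  note k = s[unfolded kernel_def]
  define A where "A = marked s ''A''"
  define s1 where "s1 = den (copy ''T'' ''A'') s"
  define s2 where "s2 = den stage s1"
  define s3 where "s3 = den stage s2"
  define s4 where "s4 = den (copy ''A'' ''T'') s3"
  define s5 where "s5 = den stage s4"
  have den: "den stages s = s5"
    by (simp add: stages_def s1_def s2_def s3_def s4_def s5_def)
  have s1: "env s1" "marked s1 ''T'' = A"
    unfolding s1_def A_def by (rule den_copy; use k in \<open>simp add: static_def\<close>)+
  have "s1 ''A'' = s ''A''" "s1 ''C'' = s ''C''"
    unfolding s1_def by (simp_all add: den_frame)
  then have A1: "marked s1 ''A'' = A" and C1: "marked s1 ''C'' = marked s ''C''"
    by (simp_all add: A_def marked_def)
  have "marked s1 ''T'' \<subseteq> marked s1 ''A''"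
    by (simp add: s1 A1)
  note st1 = den_stage[OF s1(1) symE linked this, folded s2_def]
  define T1 where "T1 = marked s2 ''T''"
  define L where "L = entry s2 ''d''"
  have A2: "marked s2 ''A'' = A"
    using st1(2) A1 by simp
  have T1A: "T1 \<subseteq> A"
    using st1(5) s1(2) by (simp add: T1_def)
  have L: "layering pE (nodes A S) L"
    using st1(3) exposed_nodes_all[of s1] s1(2) A1 by (simp add: L_def)
  obtain a where a: "\<forall>v\<in>A. \<forall>p\<in>S v. v \<in> T1 \<longleftrightarrow> odd (L (v, p)) = a"
    using st1(4) unfolding s1(2) T1_def L_def by blast
  have "marked s2 ''T'' \<subseteq> marked s2 ''A''"
    using T1A by (simp add: A2 T1_def)
  note st2 = den_stage[OF st1(1) symE linked this, folded s3_def]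
  define T2 where "T2 = marked s3 ''T''"
  define M where "M = entry s3 ''d''"
  have T21: "T2 \<subseteq> T1"
    using st2(5) by (simp add: T2_def T1_def)
  have "exposed_nodes s2 = exposed (nodes A S) L a"
    unfolding exposed_nodes_def exposed_def nodes_def A2 using a by (auto simp: T1_def[symmetric] L_def[symmetric])
  then have M: "layering pE (exposed (nodes A S) L a) M"
    using st2(3) by (simp add: M_def)
  obtain b where b: "\<forall>v\<in>T1. \<forall>p\<in>S v. v \<in> T2 \<longleftrightarrow> odd (M (v, p)) = b"
    using st2(4) unfolding T2_def T1_def M_def by blast
  have s4: "env s4" "marked s4 ''A'' = T2"
    unfolding s4_def T2_def by (rule den_copy; use st2(1) in \<open>simp add: static_def\<close>)+
  have "s4 ''T'' = s3 ''T''" "s4 ''C'' = s3 ''C''"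
    unfolding s4_def by (simp_all add: den_frame)
  then have T4: "marked s4 ''T'' = T2" and C4: "marked s4 ''C'' = marked s3 ''C''"
    by (simp_all add: T2_def marked_def)
  have "marked s4 ''T'' \<subseteq> marked s4 ''A''"
    by (simp add: T4 s4)
  note st3 = den_stage[OF s4(1) symE linked this, folded s5_def]
  define T3 where "T3 = marked s5 ''T''"
  define N where "N = entry s5 ''d''"
  have T32: "T3 \<subseteq> T2"
    using st3(5) by (simp add: T3_def T4)
  have N: "layering pE (nodes T2 S) N"
    using st3(3) exposed_nodes_all[of s4] T4 s4(2) by (simp add: N_def)
  obtain c where c: "\<forall>v\<in>T2. \<forall>p\<in>S v. v \<in> T3 \<longleftrightarrow> odd (N (v, p)) = c"
    using st3(4) unfolding T3_def T4 N_def by blast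
  have An: "A \<subseteq> {..<n}"
    by (simp add: A_def marked_subset)
  have "(u, v) \<in> conflict A S \<longleftrightarrow> (u, v) \<in> gE \<inter> A \<times> A" for u v
    using edge[of u v] subsetD[OF An, of u] subsetD[OF An, of v] gE(3) by (auto simp: conflict_def irrefl_def)
  then have "conflict A S = gE \<inter> A \<times> A"
    by (intro set_eqI) (metis surj_pair)
  moreover have "odd_free 13 A"
    using k by (simp add: A_def)
  ultimately have short: "(v, v) \<notin> conflict A S ^^ l" if "odd l" "l \<le> 11" for v l
    using that unfolding odd_free_def by simp
  interpret string_plane P \<phi> \<gamma> A S L M a
  proof (intro string_plane.intro plane string_plane_axioms.intro)
    show "linked (parcs P) (S v)" if "v \<in> A" for v
      using linked An that by (auto simp: P)
  qed (use short L M in \<open>simp_all add: P\<close>)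
  have indep: "S u \<inter> S v = {}" if uv: "u \<in> T3" "v \<in> T3" "u \<noteq> v" for u v
  proof (rule ccontr)
    assume "S u \<inter> S v \<noteq> {}"
    then obtain p where p: "p \<in> S u" "p \<in> S v"
      by blast
    have T2: "w \<in> A \<and> w \<in> T1 \<and> w \<in> T2" if "w \<in> T2" for w
      using that T21 T1A by blast
    have "odd (N (u, p)) \<noteq> odd (N (v, p))"
    proof (rule final_levels_differ[of T2 b N, unfolded P])
      show "odd (L (w, q)) = a \<and> odd (M (w, q)) = b" if "w \<in> T2" "q \<in> S w" for w q
        using T2[OF that(1)] a b that(2) by blast
    qed (use T2 N uv T32 p in blast)+
    moreover have "odd (N (u, p)) = c" "odd (N (v, p)) = c"
      using c T32 uv p by blast+
    ultimately show False
      by simp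
  qed
  have C5: "marked s5 ''C'' = marked s ''C'' \<union> (A - T3)"
    using st1(6) st2(6) st3(6) C1 C4 T4 s1(2) T1A T21 T32 unfolding T1_def T2_def T3_def by blast
  show "cover (marked (den stages s) ''C'')"
    unfolding cover_def den
  proof clarify
    fix u v assume uv: "(u, v) \<in> gE" "v \<notin> marked s5 ''C''"
    show "u \<in> marked s5 ''C''"
    proof (rule ccontr)
      assume "u \<notin> marked s5 ''C''"
      then have "u \<notin> marked s ''C''" "v \<notin> marked s ''C''"
        using uv C5 by blast+
      then have "u \<in> A" "v \<in> A"
        using k uv(1) unfolding A_def by blast+
      then have "u \<in> T3" "v \<in> T3"
        using C5 uv(2) \<open>u \<notin> marked s5 ''C''\<close> by blast+
      moreover have "u \<noteq> v"
        using gE(3) uv(1) by (auto simp: irrefl_def)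
      moreover have "u < n" "v < n"
        using gE(1) uv(1) by auto
      ultimately show False
        using indep[of u v] edge[of u v] uv(1) by blast
    qed
  qed
  have fin: "finite A" "finite T3"
    by (simp_all add: A_def T3_def)
  have "card A \<le> 2 * card T1" "card T1 \<le> 2 * card T2" "card T2 \<le> 2 * card T3"
    using st1(7) st2(7) st3(7) by (simp_all add: s1(2) T1_def T2_def T3_def T4)
  then have T3: "card A \<le> 8 * card T3"
    by simp
  have "card (marked s5 ''C'') \<le> card (marked s ''C'') + card (A - T3)"
    unfolding C5 by (rule card_Un_le)
  moreover have "card (A - T3) = card A - card T3" "card T3 \<le> card A"
    using fin T32 T21 T1A by (auto intro!: card_Diff_subset card_mono)
  ultimately have C: "card (marked s5 ''C'') + card T3 \<le> card (marked s ''C'') + card A"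
    by simp
  show "6 * card (marked (den stages s) ''C'') \<le> 11 * card (K \<inter> {..<n})" if "cover K"
  proof -
    have "6 * card (marked s ''C'') \<le> 11 * card (K \<inter> ({..<n} - A))" "card A \<le> 2 * card (K \<inter> A)"
      using k that unfolding A_def by blast+
    moreover have "card (K \<inter> {..<n}) = card (K \<inter> ({..<n} - A) \<union> K \<inter> A)"
      using An by (intro arg_cong[of _ _ card]) blast
    then have "card (K \<inter> {..<n}) = card (K \<inter> ({..<n} - A)) + card (K \<inter> A)"
      using fin by (simp add: card_Un_disjoint disjoint_iff)
    \<comment> \<open>Of \<open>A\<close> at most 7/8 is taken, hence at most 7/4 of the cover's
      share in \<open>A\<close>. Multiplied by 6 this is 21/2, below the permitted 11.\<close>
    ultimately show ?thesis
      using C T3 unfolding den by linarith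
  qed
qed

end

section \<open>Running time and approximation ratio\<close>

definition main :: prog where
  "main = row_offsets ;; all_cycles ;; reduce ;; stages"

text \<open>The form in which the premises of \<open>compile_exec\<close> are checked by the
  simplifier: the only loop limits are the two input sizes, which are never overwritten.\<close>

definition safe :: "prog \<Rightarrow> bool" where
  "safe p \<longleftrightarrow> proper p \<and> bounds p \<subseteq> {''n'', ''m''} \<and> ''n'' \<notin> writes p \<and> ''m'' \<notin> writes p"

lemma safe_simps [simp]:
  "safe Nop" "safe (Assign x a e) \<longleftrightarrow> x \<noteq> ''n'' \<and> x \<noteq> ''m''"
  "safe (p ;; q) \<longleftrightarrow> safe p \<and> safe q" "safe (If b p q) \<longleftrightarrow> safe p \<and> safe q"
  "safe (For x N p) \<longleftrightarrow> x \<notin> writes p \<and> N \<in> {''n'', ''m''} \<and> x \<noteq> ''n'' \<and> x \<noteq> ''m'' \<and> safe p"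
  by (auto simp: safe_def)

lemma tup_neq [simp]: "tup i \<noteq> ''m''" "tup i \<noteq> ''n''" "''m'' \<noteq> tup i" "''n'' \<noteq> tup i" "''pr'' \<noteq> tup i"
  by (simp_all add: tup_def)

lemma safe_drop_tuple: "safe (drop_tuple l)"
proof -
  have "safe (seqs (map (\<lambda>i. Assign ''A'' (cell (tup i)) (Const 0) ;; Assign ''C'' (cell (tup i)) (Const 1)) is))" for "is"
    by (induction "is") auto
  then show ?thesis
    by (simp add: drop_tuple_def)
qed

lemma writes_cycles: "writes (cycles l) \<subseteq> tup ` UNIV \<union> {''A'', ''C''}"
  using writes_drop_tuple[of l] by (auto simp: cycles_def writes_nest)

lemma safe_nest: "safe p \<Longrightarrow> (\<And>i. tup i \<notin> writes p) \<Longrightarrow> safe (nest k p)"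
  by (induction k) (auto simp: writes_nest)

lemma safe_cycles: "safe (cycles l)"
  unfolding cycles_def using writes_drop_tuple[of l] safe_drop_tuple by (intro safe_nest) auto

lemma safe_reduce: "safe reduce"
  by (simp add: reduce_def free_items_def passes_def pass_def bid_def find_item_def find_cheapest_def find_gap_def
      price_used_def remove_crown_def is_bidder_def)

lemma safe_layer: "safe layer"
  by (simp add: layer_def layer_step_def put_node_def scan_def scan_node_def offers_point_def offers_string_def offer_def)

lemma safe_stages: "safe stages"
  by (simp add: stages_def stage_def safe_layer expose_def expose_node_def below_test_def put_node_def copy_def
      select_def drop_if_def count_parity_def get_parity_def)

lemma safe_main: "safe main"
  by (simp add: main_def row_offsets_def all_cycles_def safe_cycles safe_reduce safe_stages)

lemma exec_main:
  assumes "s ''n'' 0 \<le> B" "s ''m'' 0 \<le> B"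
  shows "\<exists>t \<le> poly (time_bound main) B. exec (compile main) s t (den main s)"
  using safe_main assms by (intro compile_exec) (auto simp: safe_def)

context input
begin

lemma den_main:
  assumes "s ''n'' 0 = n" "s ''m'' 0 = m"
    and zero: "\<And>x i. x \<in> {''vn'', ''vm'', ''pm'', ''C'', ''pr''} \<Longrightarrow> s x i = 0"
    and "\<And>u v. u < n \<Longrightarrow> v < n \<Longrightarrow> 0 < s ''G'' (u * n + v) \<longleftrightarrow> (u, v) \<in> gE"
    and "\<And>v p. v < n \<Longrightarrow> p < m \<Longrightarrow> 0 < s ''S'' (v * m + p) \<longleftrightarrow> p \<in> S v"
    and "\<And>p q. p < m \<Longrightarrow> q < m \<Longrightarrow> 0 < s ''P'' (p * m + q) \<longleftrightarrow> (p, q) \<in> pE"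
    and plane: "plane_graph P \<phi> \<gamma>" "parcs P = pE" "\<forall>v<n. linked pE (S v)"
    and edge: "\<And>u v. u < n \<Longrightarrow> v < n \<Longrightarrow> u \<noteq> v \<Longrightarrow> (u, v) \<in> gE \<longleftrightarrow> S u \<inter> S v \<noteq> {}"
  shows "cover (marked (den main s) ''C'')"
    "cover K \<Longrightarrow> 6 * card (marked (den main s) ''C'') \<le> 11 * card (K \<inter> {..<n})"
proof -
  define s1 where "s1 = den row_offsets s"
  define s2 where "s2 = den all_cycles s1"
  have s1: "env s1" "marked s1 ''A'' = {..<n}"
    unfolding s1_def by (rule den_row_offsets; use assms in simp)+
  have z1: "s1 ''C'' v = 0" "s1 ''pr'' v = 0" for v
    unfolding s1_def using zero by (simp_all add: den_frame row_offsets_def)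
  note s2 = den_all_cycles[OF s1 z1(1), folded s2_def]
  have "''pr'' \<notin> writes all_cycles"
    using writes_cycles by (auto simp: all_cycles_def dest!: subsetD[OF writes_cycles])
  then have "s2 ''pr'' r = 0" for r
    unfolding s2_def using z1(2) by (simp add: den_frame)
  then have "kernel (den reduce s2)"
    using s2 by (intro den_reduce)
  note stages = den_stages[OF this plane edge]
  have "den main s = den stages (den reduce s2)"
    by (simp add: main_def s1_def s2_def)
  then show "cover (marked (den main s) ''C'')"
    "cover K \<Longrightarrow> 6 * card (marked (den main s) ''C'') \<le> 11 * card (K \<inter> {..<n})"
    using stages by simp_all
qed

end

text \<open>Connectedness of a digraph means strong connectedness of its symmetric closure, and here
  the arcs are symmetric already.\<close>

lemma linked_if_connected:
  assumes "sym (parcs P)" "Digraph_Component.connected (with_proj P \<restriction> A)"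
  shows "linked (parcs P) A"
  unfolding linked_def
proof (intro ballI)
  fix p q assume "p \<in> A" "q \<in> A"
  let ?H = "mk_symmetric (with_proj P \<restriction> A)"
  have "p \<rightarrow>\<^sup>*\<^bsub>with_proj ?H\<^esub> q"
    using assms(2) \<open>p \<in> A\<close> \<open>q \<in> A\<close> unfolding Digraph_Component.connected_def strongly_connected_def by simp
  then have "(p, q) \<in> rtrancl_on A (parcs ?H)"
    by (simp add: reachable_def)
  moreover have "parcs ?H \<subseteq> parcs P \<inter> A \<times> A"
    using assms(1) by (auto simp: parcs_mk_symmetric dest: symD)
  ultimately show "(p, q) \<in> (parcs P \<inter> A \<times> A)\<^sup>*"
    using rtrancl_on_sub_rtrancl rtrancl_mono by blast
qed

lemma pair_graph_parcs:
  assumes "pair_graph G"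
  shows "parcs G \<subseteq> pverts G \<times> pverts G" "sym (parcs G)" "irrefl (parcs G)" "finite (pverts G)"
proof -
  interpret pair_graph G by fact
  show "parcs G \<subseteq> pverts G \<times> pverts G"
    using in_arcsD1 in_arcsD2 by auto
  show "sym (parcs G)"
    by (auto intro!: symI dest: arcs_symmetric)
  show "irrefl (parcs G)"
    using no_loops' by (auto simp: irrefl_def)
  show "finite (pverts G)"
    by simp
qed

lemma vertex_cover_iff:
  assumes "parcs G \<subseteq> pverts G \<times> pverts G"
  shows "vertex_cover G C \<longleftrightarrow> C \<subseteq> pverts G \<and> (\<forall>(u, v)\<in>parcs G. u \<in> C \<or> v \<in> C)"
  using assms by (auto simp: vertex_cover_def)

lemma vc_attained: "\<exists>C. vertex_cover G C \<and> card C = vc G"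
proof -
  have "vertex_cover G (pverts G)"
    by (simp add: vertex_cover_def)
  then have "\<exists>k C. vertex_cover G C \<and> card C = k"
    by blast
  then show ?thesis
    unfolding vc_def by (rule LeastI_ex)
qed

lemma row_index: "u < k \<Longrightarrow> v < l \<Longrightarrow> u * l + v < k * l \<and> (u * l + v) div l = u \<and> (u * l + v) mod l = v" for l :: nat
  using mult_le_mono1[of "Suc u" k l] by auto

theorem theorem1:
  shows "\<exists>(c :: com) (p :: nat poly).
    \<forall>(G :: nat pair_pre_digraph) (P :: nat pair_pre_digraph) (S :: nat \<Rightarrow> nat set).
      numbered G \<longrightarrow> numbered P \<longrightarrow> string_graph G \<longrightarrow> string_representation G P S \<longrightarrow>
      (\<exists>t s. exec c (input_store G P S) t s \<and>
             t \<le> poly p (representation_size G P S) \<and>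
             vertex_cover G (output_set G s) \<and>
             real (card (output_set G s)) \<le> 11 / 6 * real (vc G))"
proof (intro exI[of _ "compile main"] exI[of _ "time_bound main"] allI impI)
  fix G P :: "nat pair_pre_digraph" and S :: "nat \<Rightarrow> nat set"
  assume num: "numbered G" "numbered P" and rep: "string_representation G P S"
  define n where "n = card (pverts G)"
  define m where "m = card (pverts P)"
  have verts: "pverts G = {..<n}" "pverts P = {..<m}"
    using num by (simp_all add: numbered_def n_def m_def)
  have G: "pair_graph G" and "planar_graph P"
    and sets: "\<And>v. v < n \<Longrightarrow> S v \<noteq> {} \<and> S v \<subseteq> {..<m} \<and> Digraph_Component.connected (with_proj P \<restriction> S v)"
    and edge: "\<And>u v. u < n \<Longrightarrow> v < n \<Longrightarrow> u \<noteq> v \<Longrightarrow> (u, v) \<in> parcs G \<longleftrightarrow> S u \<inter> S v \<noteq> {}"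
    using rep unfolding string_representation_def verts by auto
  then obtain \<phi> \<gamma> where P: "pair_graph P" and plane: "plane_graph P \<phi> \<gamma>"
    unfolding planar_graph_def plane_graph_def by blast
  note arcs = pair_graph_parcs[OF G, unfolded verts] pair_graph_parcs[OF P, unfolded verts]
  interpret input n m "parcs G" S "parcs P"
  proof
    show "S v \<subseteq> {..<m} \<and> S v \<noteq> {}" if "v < n" for v
      using sets[OF that] by blast
  qed (rule arcs)+
  let ?s = "input_store G P S"
  have linked: "\<forall>v<n. linked (parcs P) (S v)"
    using sets by (simp add: linked_if_connected[OF arcs(6)])
  have nm: "?s ''n'' 0 = n" "?s ''m'' 0 = m"
    by (simp_all add: input_store_def n_def m_def Let_def)
  have zero: "?s x i = 0" if "x \<in> {''vn'', ''vm'', ''pm'', ''C'', ''pr''}" for x i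
    using that by (auto simp: input_store_def Let_def)
  have inG: "0 < ?s ''G'' (u * n + v) \<longleftrightarrow> (u, v) \<in> parcs G" if "u < n" "v < n" for u v
    using row_index[OF that] by (simp add: input_store_def Let_def n_def[symmetric])
  have inS: "0 < ?s ''S'' (v * m + p) \<longleftrightarrow> p \<in> S v" if "v < n" "p < m" for v p
    using row_index[OF that] by (simp add: input_store_def Let_def n_def[symmetric] m_def[symmetric])
  have inP: "0 < ?s ''P'' (p * m + q) \<longleftrightarrow> (p, q) \<in> parcs P" if "p < m" "q < m" for p q
    using row_index[OF that] by (simp add: input_store_def Let_def m_def[symmetric])
  note store = den_main[OF nm zero inG inS inP plane refl linked edge]
  have out: "output_set G (den main ?s) = marked (den main ?s) ''C''"
    by (simp add: output_set_def marked_def verts)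
  have vcover: "vertex_cover G C \<longleftrightarrow> C \<subseteq> {..<n} \<and> cover C" for C
    using vertex_cover_iff[of G C] arcs(1) by (simp add: verts cover_def)
  \<comment> \<open>Every string has at least one point, so the sum of their sizes is at least
    \<open>n\<close>; this makes both loop limits bounded by the size of the representation.\<close>
  have size: "n \<le> representation_size G P S" "m \<le> representation_size G P S"
  proof -
    have "finite (S v)" if "v < n" for v
      using S[OF that] finite_subset by blast
    then have "1 \<le> card (S v)" if "v < n" for v
      using S[OF that] that by (simp add: Suc_le_eq card_gt_0_iff)
    then have "(\<Sum>v<n. 1) \<le> (\<Sum>v<n. card (S v))"
      by (intro sum_mono) simp
    then show "n \<le> representation_size G P S" "m \<le> representation_size G P S"
      by (simp_all add: representation_size_def verts)
  qed
  have "vertex_cover G (output_set G (den main ?s))"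
    using store(1) marked_subset by (simp add: vcover out)
  moreover have "real (card (output_set G (den main ?s))) \<le> 11 / 6 * real (vc G)"
  proof -
    obtain K where K: "vertex_cover G K" "card K = vc G"
      using vc_attained by blast
    then have "6 * card (output_set G (den main ?s)) \<le> 11 * card (K \<inter> {..<n})"
      using store(2)[of K] by (simp add: vcover out)
    moreover have "K \<inter> {..<n} = K"
      using K(1) by (auto simp: vcover)
    ultimately have "6 * card (output_set G (den main ?s)) \<le> 11 * vc G"
      using K(2) by simp
    then have "real (6 * card (output_set G (den main ?s))) \<le> real (11 * vc G)"
      by (rule of_nat_mono)
    then show ?thesis
      by simp
  qed
  moreover have "\<exists>t \<le> poly (time_bound main) (representation_size G P S). exec (compile main) ?s t (den main ?s)"
    using nm by (intro exec_main) (simp_all add: size)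
  ultimately show "\<exists>t s. exec (compile main) ?s t s \<and> t \<le> poly (time_bound main) (representation_size G P S) \<and>
      vertex_cover G (output_set G s) \<and> real (card (output_set G s)) \<le> 11 / 6 * real (vc G)"
    by blast
qed

end
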